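(* Let $(M,\omega,\eta)$ be a cosymplectic manifold of dimension $2n+1$ with Reeb vector field $\xi$, and let $X$ be a Lagrangian-like submanifold of $M$. Then the vector bundles $NX$ and $T^*X\oplus \mathrm{span}(\xi)^*$ over $X$ are canonically identified (canonically isomorphic).
   Context: A cosymplectic structure on a smooth manifold $M$ of dimension $2n+1$ is a pair $(\omega,\eta)$ of a closed $2$-form and a closed $1$-form such that at each $x\in M$ the map $T_xM\to T_x^*M$, $v\mapsto\iota_v\omega_x+\eta_x(v)\eta_x$, is bijective. The Reeb vector field $\xi$ is characterized by $\eta(\xi)=1$, $\iota_\xi\omega=0$. A submanifold with inclusion $i:L\hookrightarrow M$ is Lagrangian-like if $i^*\omega=0$, $i^*\eta=0$ and $\dim L=\frac12(\dim M-1)$. The normal bundle $NX$ of $X$ in $M$ has fibers $N_xX=T_xM/T_xX$. $\mathrm{span}(\xi)^*$ is the dual of the line bundle over $X$ spanned by $\xi$. *)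

theory Defs
  imports "HOL-Analysis.Analysis"
begin

section \<open>Smooth maps between open subsets of finite-dimensional normed spaces\<close>

text \<open>For finite-dimensional domain, \<open>Ck_on k f S\<close> with \<open>S\<close> open is the usual notion of a
  \<open>k\<close> times continuously differentiable map: all directional derivatives of \<open>Df\<close> are
  \<open>k - 1\<close> times continuously differentiable.\<close>

primrec Ck_on ::
  "nat \<Rightarrow> ('a::real_normed_vector \<Rightarrow> 'b::real_normed_vector) \<Rightarrow> 'a set \<Rightarrow> bool" where
  "Ck_on 0 f S \<longleftrightarrow> continuous_on S f"
| "Ck_on (Suc k) f S \<longleftrightarrow> (\<forall>x\<in>S. f differentiable (at x)) \<and>
     (\<forall>v. Ck_on k (\<lambda>x. frechet_derivative f (at x) v) S)"

definition smooth_on :: "('a::real_normed_vector \<Rightarrow> 'b::real_normed_vector) \<Rightarrow> 'a set \<Rightarrow> bool" where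
  "smooth_on f S \<longleftrightarrow> (\<forall>k. Ck_on k f S)"


section \<open>Smooth manifolds\<close>

text \<open>The model space is a finite-dimensional real normed space, given as a type; its dimension
  is the dimension of the manifold.  The class \<open>euclidean_space\<close> is not used because it
  excludes dimension 0.  Charts are pairs of a domain and a map whose values outside the domain
  are irrelevant.  The atlas need not be maximal: it only serves to determine a smooth structure.\<close>

type_synonym ('p, 'e) chart = "'p set \<times> ('p \<Rightarrow> 'e)"

record ('p, 'e) manifold =
  mtop :: "'p topology"
  atlas :: "('p, 'e) chart set"

abbreviation points :: "('p, 'e) manifold \<Rightarrow> 'p set" where
  "points M \<equiv> topspace (mtop M)"

abbreviation chart_inv :: "('p, 'e) chart \<Rightarrow> 'e \<Rightarrow> 'p" where
  "chart_inv c \<equiv> inv_into (fst c) (snd c)"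

definition mdim :: "('p, 'e::real_normed_vector) manifold \<Rightarrow> nat" where
  "mdim M = dim (UNIV :: 'e set)"

definition smooth_manifold :: "('p, 'e::real_normed_vector) manifold \<Rightarrow> bool" where
  "smooth_manifold M \<longleftrightarrow>
     (\<exists>B::'e set. finite B \<and> span B = UNIV) \<and>
     Hausdorff_space (mtop M) \<and> second_countable (mtop M) \<and>
     \<Union> (fst ` atlas M) = points M \<and>
     (\<forall>(U, \<phi>)\<in>atlas M. openin (mtop M) U \<and> open (\<phi> ` U) \<and>
        homeomorphic_map (subtopology (mtop M) U) (top_of_set (\<phi> ` U)) \<phi>) \<and>
     (\<forall>(U, \<phi>)\<in>atlas M. \<forall>(V, \<psi>)\<in>atlas M. smooth_on (\<psi> \<circ> inv_into U \<phi>) (\<phi> ` (U \<inter> V)))"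

definition charts_at :: "('p, 'e) manifold \<Rightarrow> 'p \<Rightarrow> ('p, 'e) chart set" where
  "charts_at M x = {c \<in> atlas M. x \<in> fst c}"

definition smooth_function_on :: "('p, 'e::real_normed_vector) manifold \<Rightarrow> 'p set \<Rightarrow> ('p \<Rightarrow> real) \<Rightarrow> bool" where
  "smooth_function_on M W f \<longleftrightarrow>
     (\<forall>(U, \<phi>)\<in>atlas M. smooth_on (f \<circ> inv_into U \<phi>) (\<phi> ` (U \<inter> W)))"

definition smooth_map ::
  "('p, 'e::real_normed_vector) manifold \<Rightarrow> ('q, 'f::real_normed_vector) manifold \<Rightarrow> ('p \<Rightarrow> 'q) \<Rightarrow> bool" where
  "smooth_map M N F \<longleftrightarrow> continuous_map (mtop M) (mtop N) F \<and>
     (\<forall>(U, \<phi>)\<in>atlas M. \<forall>(V, \<psi>)\<in>atlas N.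
        smooth_on (\<psi> \<circ> F \<circ> inv_into U \<phi>) (\<phi> ` (U \<inter> F -` V)))"


section \<open>Tangent vectors\<close>

text \<open>A tangent vector at \<open>x\<close> assigns to every chart around \<open>x\<close> a vector of the model space, the
  assigned vectors being related by the derivatives of the coordinate changes.  Charts that are
  not around \<open>x\<close> are assigned 0, so that the vector space operations are pointwise.\<close>

type_synonym ('p, 'e) tvec = "('p, 'e) chart \<Rightarrow> 'e"

definition coord_change_deriv ::
  "'p \<Rightarrow> ('p, 'e::real_normed_vector) chart \<Rightarrow> ('p, 'e) chart \<Rightarrow> 'e \<Rightarrow> 'e" where
  "coord_change_deriv x c d = frechet_derivative (snd d \<circ> chart_inv c) (at (snd c x))"

definition tangent_space :: "('p, 'e::real_normed_vector) manifold \<Rightarrow> 'p \<Rightarrow> ('p, 'e) tvec set" where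
  "tangent_space M x = {v.
     (\<forall>c\<in>charts_at M x. \<forall>d\<in>charts_at M x. v d = coord_change_deriv x c d (v c)) \<and>
     (\<forall>c. c \<notin> charts_at M x \<longrightarrow> v c = 0)}"

definition tadd :: "('p, 'e::real_normed_vector) tvec \<Rightarrow> ('p, 'e) tvec \<Rightarrow> ('p, 'e) tvec" where
  "tadd u v = (\<lambda>c. u c + v c)"

definition tscale :: "real \<Rightarrow> ('p, 'e::real_normed_vector) tvec \<Rightarrow> ('p, 'e) tvec" where
  "tscale a v = (\<lambda>c. a *\<^sub>R v c)"

text \<open>The tangent vector at \<open>x\<close> that is represented by \<open>u\<close> in the chart \<open>c\<close>; for fixed \<open>u\<close> this is
  a coordinate vector field on the domain of \<open>c\<close>.\<close>

definition coord_vec ::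
  "('p, 'e::real_normed_vector) manifold \<Rightarrow> ('p, 'e) chart \<Rightarrow> 'e \<Rightarrow> 'p \<Rightarrow> ('p, 'e) tvec" where
  "coord_vec M c u x = (\<lambda>d. if d \<in> charts_at M x then coord_change_deriv x c d u else 0)"

text \<open>The differential of \<open>F\<close> at \<open>x\<close>, computed in an arbitrary chart around \<open>x\<close>.\<close>

definition differential ::
  "('p, 'e::real_normed_vector) manifold \<Rightarrow> ('q, 'f::real_normed_vector) manifold \<Rightarrow> ('p \<Rightarrow> 'q)
     \<Rightarrow> 'p \<Rightarrow> ('p, 'e) tvec \<Rightarrow> ('q, 'f) tvec" where
  "differential M N F x v = (\<lambda>d. if d \<in> charts_at N (F x)
     then let c = (SOME c. c \<in> charts_at M x)
          in frechet_derivative (snd d \<circ> F \<circ> chart_inv c) (at (snd c x)) (v c)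
     else 0)"

text \<open>A submanifold \<open>X\<close> of \<open>M\<close> is a subset with its own manifold structure for which the inclusion
  is an injective immersion.  Embedded submanifolds are those with
  \<open>mtop X = subtopology (mtop M) (points X)\<close>.\<close>

definition incl_differential ::
  "('p, 'f::real_normed_vector) manifold \<Rightarrow> ('p, 'e::real_normed_vector) manifold
     \<Rightarrow> 'p \<Rightarrow> ('p, 'f) tvec \<Rightarrow> ('p, 'e) tvec" where
  "incl_differential X M = differential X M (\<lambda>x. x)"

definition submanifold ::
  "('p, 'f::real_normed_vector) manifold \<Rightarrow> ('p, 'e::real_normed_vector) manifold \<Rightarrow> bool" where
  "submanifold X M \<longleftrightarrow> smooth_manifold X \<and> points X \<subseteq> points M \<and> smooth_map X M (\<lambda>x. x) \<and>
     (\<forall>x\<in>points X. inj_on (incl_differential X M x) (tangent_space X x))"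


section \<open>Smooth vector bundles\<close>

text \<open>A vector bundle over a manifold is given by its fibres, with explicit vector space operations,
  and a vector bundle atlas: local trivialisations, linear on the fibres, with smooth transition
  functions.  By the vector bundle chart lemma this determines the total space as a manifold.
  The typical fibre is \<open>topspace (Euclidean_space k)\<close>, the functions on \<open>nat\<close> that vanish
  from \<open>k\<close> on.\<close>

record ('p, 'v) vbundle =
  vb_rank :: nat
  fibre :: "'p \<Rightarrow> 'v set"
  fadd :: "'p \<Rightarrow> 'v \<Rightarrow> 'v \<Rightarrow> 'v"
  fscale :: "'p \<Rightarrow> real \<Rightarrow> 'v \<Rightarrow> 'v"
  trivs :: "('p set \<times> ('p \<Rightarrow> 'v \<Rightarrow> nat \<Rightarrow> real)) set"

abbreviation Rn :: "nat \<Rightarrow> (nat \<Rightarrow> real) set" where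
  "Rn k \<equiv> topspace (Euclidean_space k)"

definition local_triv ::
  "('p, 'e) manifold \<Rightarrow> ('p, 'v) vbundle \<Rightarrow> 'p set \<Rightarrow> ('p \<Rightarrow> 'v \<Rightarrow> nat \<Rightarrow> real) \<Rightarrow> bool" where
  "local_triv B E U \<tau> \<longleftrightarrow> openin (mtop B) U \<and>
     (\<forall>x\<in>U. bij_betw (\<tau> x) (fibre E x) (Rn (vb_rank E)) \<and>
        (\<forall>u\<in>fibre E x. \<forall>v\<in>fibre E x. \<forall>i. \<tau> x (fadd E x u v) i = \<tau> x u i + \<tau> x v i) \<and>
        (\<forall>a. \<forall>v\<in>fibre E x. \<forall>i. \<tau> x (fscale E x a v) i = a * \<tau> x v i))"

text \<open>The vector space axioms in the fibres follow from closure and the existence of a linear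
  bijection onto \<open>Rn (vb_rank E)\<close>.\<close>

definition vector_bundle :: "('p, 'e::real_normed_vector) manifold \<Rightarrow> ('p, 'v) vbundle \<Rightarrow> bool" where
  "vector_bundle B E \<longleftrightarrow>
     (\<forall>x\<in>points B. (\<forall>u\<in>fibre E x. \<forall>v\<in>fibre E x. fadd E x u v \<in> fibre E x) \<and>
        (\<forall>a. \<forall>v\<in>fibre E x. fscale E x a v \<in> fibre E x)) \<and>
     \<Union> (fst ` trivs E) = points B \<and>
     (\<forall>(U, \<tau>)\<in>trivs E. local_triv B E U \<tau>) \<and>
     (\<forall>(U, \<tau>)\<in>trivs E. \<forall>(V, \<sigma>)\<in>trivs E. \<forall>w\<in>Rn (vb_rank E). \<forall>i.
        smooth_function_on B (U \<inter> V) (\<lambda>x. \<sigma> x (inv_into (fibre E x) (\<tau> x) w) i))"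

text \<open>Homomorphisms cover the identity of the base.\<close>

definition vb_hom ::
  "('p, 'e::real_normed_vector) manifold \<Rightarrow> ('p, 'v) vbundle \<Rightarrow> ('p, 'w) vbundle
     \<Rightarrow> ('p \<Rightarrow> 'v \<Rightarrow> 'w) \<Rightarrow> bool" where
  "vb_hom B E F \<Phi> \<longleftrightarrow>
     (\<forall>x\<in>points B. (\<forall>v\<in>fibre E x. \<Phi> x v \<in> fibre F x) \<and>
        (\<forall>u\<in>fibre E x. \<forall>v\<in>fibre E x. \<Phi> x (fadd E x u v) = fadd F x (\<Phi> x u) (\<Phi> x v)) \<and>
        (\<forall>a. \<forall>v\<in>fibre E x. \<Phi> x (fscale E x a v) = fscale F x a (\<Phi> x v))) \<and>
     (\<forall>(U, \<tau>)\<in>trivs E. \<forall>(V, \<sigma>)\<in>trivs F. \<forall>w\<in>Rn (vb_rank E). \<forall>i.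
        smooth_function_on B (U \<inter> V) (\<lambda>x. \<sigma> x (\<Phi> x (inv_into (fibre E x) (\<tau> x) w)) i))"

definition vb_isomorphism ::
  "('p, 'e::real_normed_vector) manifold \<Rightarrow> ('p, 'v) vbundle \<Rightarrow> ('p, 'w) vbundle
     \<Rightarrow> ('p \<Rightarrow> 'v \<Rightarrow> 'w) \<Rightarrow> bool" where
  "vb_isomorphism B E F \<Phi> \<longleftrightarrow> vector_bundle B E \<and> vector_bundle B F \<and> vb_hom B E F \<Phi> \<and>
     (\<exists>\<Psi>. vb_hom B F E \<Psi> \<and>
        (\<forall>x\<in>points B. (\<forall>v\<in>fibre E x. \<Psi> x (\<Phi> x v) = v) \<and> (\<forall>w\<in>fibre F x. \<Phi> x (\<Psi> x w) = w)))"


subsection \<open>Constructions\<close>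

definition tangent_bundle ::
  "('p, 'e::real_normed_vector) manifold \<Rightarrow> ('p, ('p, 'e) tvec) vbundle" where
  "tangent_bundle M =
     \<lparr>vb_rank = mdim M, fibre = tangent_space M, fadd = (\<lambda>_. tadd), fscale = (\<lambda>_. tscale),
      trivs = {(fst c, \<lambda>x v. L (v c)) |c L. c \<in> atlas M \<and>
        bij_betw L UNIV (Rn (mdim M)) \<and>
        (\<forall>a b i. L (a + b) i = L a i + L b i) \<and> (\<forall>r a i. L (r *\<^sub>R a) i = r * L a i)}\<rparr>"

text \<open>Pullback along \<open>F\<close> of a bundle to the manifold \<open>X\<close>; for an inclusion, the restriction.\<close>

definition pullback_bundle ::
  "('p, 'e) manifold \<Rightarrow> ('p \<Rightarrow> 'q) \<Rightarrow> ('q, 'v) vbundle \<Rightarrow> ('p, 'v) vbundle" where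
  "pullback_bundle X F E =
     \<lparr>vb_rank = vb_rank E, fibre = fibre E \<circ> F, fadd = fadd E \<circ> F, fscale = fscale E \<circ> F,
      trivs = {(points X \<inter> F -` U, \<tau> \<circ> F) |U \<tau>. (U, \<tau>) \<in> trivs E}\<rparr>"

text \<open>Linear functionals are extended by 0 outside the fibre.  The trivialisation dual to \<open>\<tau>\<close>
  takes the components of a functional with respect to the frame given by \<open>\<tau>\<close>.\<close>

definition dual_bundle :: "('p, 'v) vbundle \<Rightarrow> ('p, 'v \<Rightarrow> real) vbundle" where
  "dual_bundle E =
     \<lparr>vb_rank = vb_rank E,
      fibre = (\<lambda>x. {\<alpha>.
        (\<forall>u\<in>fibre E x. \<forall>v\<in>fibre E x. \<alpha> (fadd E x u v) = \<alpha> u + \<alpha> v) \<and>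
        (\<forall>a. \<forall>v\<in>fibre E x. \<alpha> (fscale E x a v) = a * \<alpha> v) \<and>
        (\<forall>v. v \<notin> fibre E x \<longrightarrow> \<alpha> v = 0)}),
      fadd = (\<lambda>_ \<alpha> \<beta> v. \<alpha> v + \<beta> v), fscale = (\<lambda>_ a \<alpha> v. a * \<alpha> v),
      trivs = {(U, \<lambda>x \<alpha> i. if i < vb_rank E
          then \<alpha> (inv_into (fibre E x) (\<tau> x) (\<lambda>j. if j = i then 1 else 0)) else 0) |U \<tau>.
        (U, \<tau>) \<in> trivs E}\<rparr>"

definition whitney_sum ::
  "('p, 'v) vbundle \<Rightarrow> ('p, 'w) vbundle \<Rightarrow> ('p, 'v \<times> 'w) vbundle" where
  "whitney_sum E F =
     \<lparr>vb_rank = vb_rank E + vb_rank F, fibre = (\<lambda>x. fibre E x \<times> fibre F x),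
      fadd = (\<lambda>x u v. (fadd E x (fst u) (fst v), fadd F x (snd u) (snd v))),
      fscale = (\<lambda>x a v. (fscale E x a (fst v), fscale F x a (snd v))),
      trivs = {(U \<inter> V, \<lambda>x v i. if i < vb_rank E then \<tau> x (fst v) i else \<sigma> x (snd v) (i - vb_rank E))
        |U \<tau> V \<sigma>. (U, \<tau>) \<in> trivs E \<and> (V, \<sigma>) \<in> trivs F}\<rparr>"

text \<open>The line subbundle of \<open>E\<close>, over \<open>X\<close>, spanned by a nowhere vanishing section \<open>s\<close>; the
  section \<open>s\<close> is a global frame.\<close>

definition line_bundle ::
  "('p, 'e) manifold \<Rightarrow> ('p, 'v) vbundle \<Rightarrow> ('p \<Rightarrow> 'v) \<Rightarrow> ('p, 'v) vbundle" where
  "line_bundle X E s =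
     \<lparr>vb_rank = 1, fibre = (\<lambda>x. range (\<lambda>a. fscale E x a (s x))), fadd = fadd E, fscale = fscale E,
      trivs = {(points X, \<lambda>x v i. if i = 0 then (THE a. v = fscale E x a (s x)) else 0)}\<rparr>"

text \<open>The quotient of \<open>E\<close> by a subbundle of rank \<open>r\<close> with fibres \<open>W x\<close>.  Its smooth structure is the
  one for which the projection from \<open>E\<close> is a smooth bundle map: the trivialisations are all those
  in which the projection is smooth.\<close>

definition coset :: "('p, 'v) vbundle \<Rightarrow> ('p \<Rightarrow> 'v set) \<Rightarrow> 'p \<Rightarrow> 'v \<Rightarrow> 'v set" where
  "coset E W x v = {fadd E x v w |w. w \<in> W x}"

definition quotient_bundle ::
  "('p, 'e::real_normed_vector) manifold \<Rightarrow> ('p, 'v) vbundle \<Rightarrow> nat \<Rightarrow> ('p \<Rightarrow> 'v set)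
     \<Rightarrow> ('p, 'v set) vbundle" where
  "quotient_bundle X E r W =
     (let Q = \<lparr>vb_rank = vb_rank E - r, fibre = (\<lambda>x. coset E W x ` fibre E x),
               fadd = (\<lambda>x A B. {fadd E x a b |a b. a \<in> A \<and> b \<in> B}),
               fscale = (\<lambda>x c A. {fadd E x (fscale E x c a) w |a w. a \<in> A \<and> w \<in> W x}),
               trivs = {}\<rparr>
      in Q\<lparr>trivs := {(U, \<tau>). local_triv X Q U \<tau> \<and>
             (\<forall>(V, \<sigma>)\<in>trivs E. \<forall>w\<in>Rn (vb_rank E). \<forall>i. smooth_function_on X (U \<inter> V)
                (\<lambda>x. \<tau> x (coset E W x (inv_into (fibre E x) (\<sigma> x) w)) i))}\<rparr>)"

definition cotangent_bundle ::
  "('p, 'e::real_normed_vector) manifold \<Rightarrow> ('p, ('p, 'e) tvec \<Rightarrow> real) vbundle" where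
  "cotangent_bundle M = dual_bundle (tangent_bundle M)"

abbreviation restricted_tangent_bundle ::
  "('p, 'f::real_normed_vector) manifold \<Rightarrow> ('p, 'e::real_normed_vector) manifold
     \<Rightarrow> ('p, ('p, 'e) tvec) vbundle" where
  "restricted_tangent_bundle X M \<equiv> pullback_bundle X (\<lambda>x. x) (tangent_bundle M)"

text \<open>\<open>T\<^sub>xX\<close> regarded as a subspace of \<open>T\<^sub>xM\<close>.\<close>

definition tangent_subspace ::
  "('p, 'f::real_normed_vector) manifold \<Rightarrow> ('p, 'e::real_normed_vector) manifold
     \<Rightarrow> 'p \<Rightarrow> ('p, 'e) tvec set" where
  "tangent_subspace X M x = incl_differential X M x ` tangent_space X x"

definition normal_bundle ::
  "('p, 'f::real_normed_vector) manifold \<Rightarrow> ('p, 'e::real_normed_vector) manifold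
     \<Rightarrow> ('p, ('p, 'e) tvec set) vbundle" where
  "normal_bundle X M =
     quotient_bundle X (restricted_tangent_bundle X M) (mdim X) (tangent_subspace X M)"

definition normal_class ::
  "('p, 'f::real_normed_vector) manifold \<Rightarrow> ('p, 'e::real_normed_vector) manifold
     \<Rightarrow> 'p \<Rightarrow> ('p, 'e) tvec \<Rightarrow> ('p, 'e) tvec set" where
  "normal_class X M = coset (restricted_tangent_bundle X M) (tangent_subspace X M)"


section \<open>Differential forms and cosymplectic structures\<close>

type_synonym ('p, 'e) form1 = "'p \<Rightarrow> ('p, 'e) tvec \<Rightarrow> real"
type_synonym ('p, 'e) form2 = "'p \<Rightarrow> ('p, 'e) tvec \<Rightarrow> ('p, 'e) tvec \<Rightarrow> real"

definition smooth_1form :: "('p, 'e::real_normed_vector) manifold \<Rightarrow> ('p, 'e) form1 \<Rightarrow> bool" where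
  "smooth_1form M \<eta> \<longleftrightarrow>
     (\<forall>x\<in>points M. \<forall>u\<in>tangent_space M x.
        (\<forall>v\<in>tangent_space M x. \<eta> x (tadd u v) = \<eta> x u + \<eta> x v) \<and>
        (\<forall>a. \<eta> x (tscale a u) = a * \<eta> x u)) \<and>
     (\<forall>c\<in>atlas M. \<forall>u. smooth_function_on M (fst c) (\<lambda>x. \<eta> x (coord_vec M c u x)))"

definition smooth_2form :: "('p, 'e::real_normed_vector) manifold \<Rightarrow> ('p, 'e) form2 \<Rightarrow> bool" where
  "smooth_2form M \<omega> \<longleftrightarrow>
     (\<forall>x\<in>points M. \<forall>u\<in>tangent_space M x. \<forall>v\<in>tangent_space M x.
        (\<forall>w\<in>tangent_space M x. \<omega> x (tadd u v) w = \<omega> x u w + \<omega> x v w) \<and>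
        (\<forall>a. \<omega> x (tscale a u) v = a * \<omega> x u v) \<and>
        \<omega> x u v = - \<omega> x v u) \<and>
     (\<forall>c\<in>atlas M. \<forall>u v.
        smooth_function_on M (fst c) (\<lambda>x. \<omega> x (coord_vec M c u x) (coord_vec M c v x)))"

text \<open>The derivative of \<open>f\<close> at \<open>x\<close> along the coordinate vector field of \<open>c\<close> given by \<open>u\<close>.\<close>

definition coord_deriv :: "('p, 'e::real_normed_vector) chart \<Rightarrow> 'e \<Rightarrow> ('p \<Rightarrow> real) \<Rightarrow> 'p \<Rightarrow> real" where
  "coord_deriv c u f x = frechet_derivative (f \<circ> chart_inv c) (at (snd c x)) u"

text \<open>Vanishing of the exterior derivative, evaluated on coordinate vector fields; these commute, so
  the terms with Lie brackets are absent.\<close>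

definition closed_1form :: "('p, 'e::real_normed_vector) manifold \<Rightarrow> ('p, 'e) form1 \<Rightarrow> bool" where
  "closed_1form M \<eta> \<longleftrightarrow> smooth_1form M \<eta> \<and>
     (\<forall>c\<in>atlas M. \<forall>x\<in>fst c. \<forall>u v.
        coord_deriv c u (\<lambda>y. \<eta> y (coord_vec M c v y)) x
        - coord_deriv c v (\<lambda>y. \<eta> y (coord_vec M c u y)) x = 0)"

definition closed_2form :: "('p, 'e::real_normed_vector) manifold \<Rightarrow> ('p, 'e) form2 \<Rightarrow> bool" where
  "closed_2form M \<omega> \<longleftrightarrow> smooth_2form M \<omega> \<and>
     (\<forall>c\<in>atlas M. \<forall>x\<in>fst c. \<forall>u v w.
        coord_deriv c u (\<lambda>y. \<omega> y (coord_vec M c v y) (coord_vec M c w y)) x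
        - coord_deriv c v (\<lambda>y. \<omega> y (coord_vec M c u y) (coord_vec M c w y)) x
        + coord_deriv c w (\<lambda>y. \<omega> y (coord_vec M c u y) (coord_vec M c v y)) x = 0)"

text \<open>The covector \<open>\<iota>\<^sub>v\<omega>\<^sub>x + \<eta>\<^sub>x(v)\<eta>\<^sub>x\<close>, extended by 0 outside \<open>T\<^sub>xM\<close>.\<close>

definition flat_map ::
  "('p, 'e::real_normed_vector) manifold \<Rightarrow> ('p, 'e) form2 \<Rightarrow> ('p, 'e) form1
     \<Rightarrow> 'p \<Rightarrow> ('p, 'e) tvec \<Rightarrow> ('p, 'e) tvec \<Rightarrow> real" where
  "flat_map M \<omega> \<eta> x v =
     (\<lambda>w. if w \<in> tangent_space M x then \<omega> x v w + \<eta> x v * \<eta> x w else 0)"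

definition cosymplectic ::
  "nat \<Rightarrow> ('p, 'e::real_normed_vector) manifold \<Rightarrow> ('p, 'e) form2 \<Rightarrow> ('p, 'e) form1 \<Rightarrow> bool" where
  "cosymplectic n M \<omega> \<eta> \<longleftrightarrow>
     smooth_manifold M \<and> mdim M = 2 * n + 1 \<and> closed_2form M \<omega> \<and> closed_1form M \<eta> \<and>
     (\<forall>x\<in>points M.
        bij_betw (flat_map M \<omega> \<eta> x) (tangent_space M x) (fibre (cotangent_bundle M) x))"

text \<open>These conditions determine \<open>\<xi>\<close> uniquely on \<open>M\<close>, and imply that it is smooth.\<close>

definition reeb_field ::
  "('p, 'e::real_normed_vector) manifold \<Rightarrow> ('p, 'e) form2 \<Rightarrow> ('p, 'e) form1
     \<Rightarrow> ('p \<Rightarrow> ('p, 'e) tvec) \<Rightarrow> bool" where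
  "reeb_field M \<omega> \<eta> \<xi> \<longleftrightarrow> (\<forall>x\<in>points M. \<xi> x \<in> tangent_space M x \<and> \<eta> x (\<xi> x) = 1 \<and>
     (\<forall>w\<in>tangent_space M x. \<omega> x (\<xi> x) w = 0))"

definition lagrangian_like ::
  "('p, 'f::real_normed_vector) manifold \<Rightarrow> ('p, 'e::real_normed_vector) manifold
     \<Rightarrow> ('p, 'e) form2 \<Rightarrow> ('p, 'e) form1 \<Rightarrow> bool" where
  "lagrangian_like X M \<omega> \<eta> \<longleftrightarrow> submanifold X M \<and>
     (\<forall>x\<in>points X. \<forall>u\<in>tangent_space X x. \<forall>v\<in>tangent_space X x.
        \<omega> x (incl_differential X M x u) (incl_differential X M x v) = 0) \<and>
     (\<forall>x\<in>points X. \<forall>u\<in>tangent_space X x. \<eta> x (incl_differential X M x u) = 0) \<and>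
     real (mdim X) = (real (mdim M) - 1) / 2"

definition reeb_line_bundle ::
  "('p, 'f::real_normed_vector) manifold \<Rightarrow> ('p, 'e::real_normed_vector) manifold
     \<Rightarrow> ('p \<Rightarrow> ('p, 'e) tvec) \<Rightarrow> ('p, ('p, 'e) tvec) vbundle" where
  "reeb_line_bundle X M \<xi> = line_bundle X (restricted_tangent_bundle X M) \<xi>"

text \<open>A covector \<open>\<alpha>\<close> on \<open>M\<close> at \<open>x\<close> gives the pair of its pullback to \<open>T\<^sub>xX\<close> and its restriction to
  the line spanned by \<open>\<xi>\<^sub>x\<close>.\<close>

definition covector_restriction ::
  "('p, 'f::real_normed_vector) manifold \<Rightarrow> ('p, 'e::real_normed_vector) manifold
     \<Rightarrow> ('p \<Rightarrow> ('p, 'e) tvec) \<Rightarrow> 'p \<Rightarrow> (('p, 'e) tvec \<Rightarrow> real)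
     \<Rightarrow> (('p, 'f) tvec \<Rightarrow> real) \<times> (('p, 'e) tvec \<Rightarrow> real)" where
  "covector_restriction X M \<xi> x \<alpha> =
     (\<lambda>u. if u \<in> tangent_space X x then \<alpha> (incl_differential X M x u) else 0,
      \<lambda>z. if z \<in> fibre (reeb_line_bundle X M \<xi>) x then \<alpha> z else 0)"

end

theory Submission
  imports Defs
begin

text \<open>Restricting the covector \<open>\<iota>\<^sub>v\<omega> + \<eta>(v)\<eta>\<close> to \<open>T\<^sub>xX\<close> and to the Reeb line defines a linear map
  \<open>T\<^sub>xM \<rightarrow> T\<^sub>x\<^sup>*X \<oplus> span(\<xi>)\<^sup>*\<close>.  It is onto because \<open>v \<mapsto> \<iota>\<^sub>v\<omega> + \<eta>(v)\<eta>\<close> is onto \<open>T\<^sub>x\<^sup>*M\<close> and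
  \<open>T\<^sub>xX \<inter> span(\<xi>) = 0\<close>, it vanishes on \<open>T\<^sub>xX\<close> since \<open>X\<close> is isotropic, and by a dimension count its
  kernel is exactly \<open>T\<^sub>xX\<close>.  In local frames its entries are values of \<open>\<omega>\<close> and \<open>\<eta>\<close> on coordinate
  fields, hence smooth.  Composing the trivialisations of the target with the induced map gives
  trivialisations of \<open>NX\<close> in which the projection from \<open>TM\<close> is smooth; since any two
  such trivialisations are smoothly related, the induced map and its inverse are smooth.\<close>

section \<open>Finite-dimensional normed spaces\<close>

text \<open>Since \<eta> vanishes on TX and \<omega> vanishes against \<xi>, the restricted covector
  decouples into \<omega>(v, .) on TX and \<eta>(v) on the Reeb line, and \<xi> is not tangent to X
  because \<eta>(\<xi>) = 1. The delicate part is smoothness. A trivialisation of the quotient is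
  only required to make the projection smooth, a condition that says nothing about inverses, so
  smooth relations between two of them have to be extracted. Sections of the larger bundle that are
  constant in a local trivialisation, and project at one point to the frame of a quotient
  trivialisation, give a linear system for the transition entries; its matrix is smooth and equals
  the identity at that point, so the entries are smooth nearby. This single fact yields smooth
  transitions of NX and of the target, and smoothness of the isomorphism in both directions. Model
  spaces are known only through a finite spanning set, so continuity of coordinates is derived from
  it; bases then serve to replace vectors that vary with the point by fixed ones with smooth
  coefficients.\<close>

lemma independent_coefficients_bound:
  fixes B :: "'a::real_normed_vector set"
  assumes "finite B" "independent B"
  shows "\<exists>C>0. \<forall>c. (\<Sum>b\<in>B. \<bar>c b\<bar>) \<le> C * norm (\<Sum>b\<in>B. c b *\<^sub>R b)"
  using assms
proof (induction B rule: finite_induct)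
  case empty
  then show ?case by (auto intro: exI[of _ 1])
next
  case (insert b B)
  have ind: "independent B" and b: "b \<notin> span B"
    using insert.hyps insert.prems by (simp_all add: independent_insert)
  then obtain C where C: "C > 0" "\<And>c. (\<Sum>b\<in>B. \<bar>c b\<bar>) \<le> C * norm (\<Sum>b\<in>B. c b *\<^sub>R b)"
    using insert.IH by blast
  \<comment> \<open>The span is closed: if points of it tended to \<open>b\<close>, their
    coefficients would be Cauchy by the inductive bound, and the limits of the coefficients would
    place \<open>b\<close> in the span.\<close>
  have "\<exists>d>0. \<forall>y\<in>span B. d \<le> norm (b - y)"
  proof (rule ccontr)
    assume "\<not> ?thesis"
    then have "\<exists>y\<in>span B. norm (b - y) < inverse (real (Suc n))" for n
      by (auto simp: not_le dest!: spec[of _ "inverse (real (Suc n))"])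
    then obtain y where y: "\<And>n. y n \<in> span B" "\<And>n. norm (b - y n) < inverse (real (Suc n))"
      by metis
    have "(\<lambda>n. b - y n) \<longlonglongrightarrow> 0"
      by (rule Lim_null_comparison[OF _ LIMSEQ_inverse_real_of_nat])
        (use y(2) in \<open>auto intro!: always_eventually less_imp_le\<close>)
    then have lim: "y \<longlonglongrightarrow> b"
      using tendsto_diff[OF tendsto_const[of b], of "\<lambda>n. b - y n" 0] by simp
    have "\<exists>c. y n = (\<Sum>b\<in>B. c b *\<^sub>R b)" for n
      using y(1)[of n] insert.hyps(1) by (auto simp: span_finite)
    then obtain c where c: "\<And>n. y n = (\<Sum>b\<in>B. c n b *\<^sub>R b)"
      by metis
    have "convergent (\<lambda>n. c n a)" if a: "a \<in> B" for a
    proof -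
      have le: "\<bar>c n a - c m a\<bar> \<le> C * norm (y n - y m)" for n m
      proof -
        have "\<bar>c n a - c m a\<bar> \<le> (\<Sum>b\<in>B. \<bar>c n b - c m b\<bar>)"
          using a insert.hyps(1) by (intro member_le_sum) auto
        also have "\<dots> \<le> C * norm (\<Sum>b\<in>B. (c n b - c m b) *\<^sub>R b)"
          by (rule C(2))
        also have "(\<Sum>b\<in>B. (c n b - c m b) *\<^sub>R b) = y n - y m"
          by (simp add: c scaleR_diff_left sum_subtractf)
        finally show ?thesis .
      qed
      have "Cauchy y"
        using lim convergent_def LIMSEQ_imp_Cauchy by blast
      have "Cauchy (\<lambda>n. c n a)"
      proof (rule metric_CauchyI)
        fix e :: real assume "e > 0"
        then have "e / C > 0" using C by simp
        then obtain N where N: "\<And>m n. m \<ge> N \<Longrightarrow> n \<ge> N \<Longrightarrow> dist (y m) (y n) < e / C"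
          using \<open>Cauchy y\<close> metric_CauchyD by blast
        have "dist (c m a) (c n a) < e" if "m \<ge> N" "n \<ge> N" for m n
          using le[of m n] N[OF that] C(1)
          by (simp add: dist_norm field_simps)
        then show "\<exists>N. \<forall>m\<ge>N. \<forall>n\<ge>N. dist (c m a) (c n a) < e" by blast
      qed
      then show ?thesis by (simp add: Cauchy_convergent_iff)
    qed
    then have "\<And>a. a \<in> B \<Longrightarrow> (\<lambda>n. c n a) \<longlonglongrightarrow> lim (\<lambda>n. c n a)"
      by (simp add: convergent_LIMSEQ_iff)
    then have "(\<lambda>n. \<Sum>b\<in>B. c n b *\<^sub>R b) \<longlonglongrightarrow> (\<Sum>b\<in>B. lim (\<lambda>n. c n b) *\<^sub>R b)"
      by (intro tendsto_sum tendsto_scaleR tendsto_const)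
    then have "b = (\<Sum>b\<in>B. lim (\<lambda>n. c n b) *\<^sub>R b)"
      using lim LIMSEQ_unique c by (metis (no_types, lifting) ext)
    also have "\<dots> \<in> span B"
      by (intro span_sum span_scale span_base)
    finally show False using b by simp
  qed
  then obtain d where d: "d > 0" "\<And>y. y \<in> span B \<Longrightarrow> d \<le> norm (b - y)" by blast
  \<comment> \<open>For v = c(b) b + y with y in \<open>span B\<close>, rescaling the distance bound
    gives |c(b)| \<le> |v| / d, hence |y| \<le> |v| (1 + |b| / d). The inductive bound applied to y
    gives the second summand.\<close>
  define K where "K = 1 / d + C * (1 + norm b / d)"
  have "(\<Sum>a\<in>insert b B. \<bar>c a\<bar>) \<le> K * norm (\<Sum>a\<in>insert b B. c a *\<^sub>R a)" for c
  proof -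
    define y where "y = (\<Sum>a\<in>B. c a *\<^sub>R a)"
    have y: "y \<in> span B"
      unfolding y_def by (intro span_sum span_scale span_base)
    define v where "v = c b *\<^sub>R b + y"
    have 1: "\<bar>c b\<bar> \<le> norm v / d"
    proof (cases "c b = 0")
      case False
      have "d \<le> norm (b - (- 1 / c b) *\<^sub>R y)"
        by (intro d span_scale y)
      then have "\<bar>c b\<bar> * d \<le> \<bar>c b\<bar> * norm (b - (- 1 / c b) *\<^sub>R y)"
        by (simp add: mult_left_mono)
      also have "\<dots> = norm (c b *\<^sub>R (b - (- 1 / c b) *\<^sub>R y))" by simp
      also have "c b *\<^sub>R (b - (- 1 / c b) *\<^sub>R y) = v"
        using False by (simp add: v_def algebra_simps)
      finally show ?thesis using d(1) by (simp add: field_simps)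
    qed (use d in simp)
    have "norm y = norm (v - c b *\<^sub>R b)" by (simp add: v_def)
    also have "\<dots> \<le> norm v + \<bar>c b\<bar> * norm b"
      by (metis norm_scaleR norm_triangle_ineq4)
    also have "\<dots> \<le> norm v + norm v / d * norm b"
      by (intro add_left_mono mult_right_mono 1) auto
    finally have 2: "C * norm y \<le> C * (norm v + norm v / d * norm b)"
      using C(1) by simp
    have "(\<Sum>a\<in>insert b B. \<bar>c a\<bar>) \<le> norm v / d + C * (norm v + norm v / d * norm b)"
      using insert.hyps C(2)[of c] 1 2 by (simp add: y_def)
    also have "\<dots> = K * norm v"
      by (simp add: K_def algebra_simps)
    finally show ?thesis
      using insert.hyps by (simp add: v_def y_def)
  qed
  moreover have "K > 0"
    using C(1) d(1) by (simp add: K_def add_pos_nonneg)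
  ultimately show ?case by blast
qed

text \<open>The coordinate bound yields |f x| \<le> C K |x|, where \<open>K\<close> sums the norms
  of the images of the basis vectors.\<close>

lemma finite_dim_bounded_linear:
  fixes f :: "'a::real_normed_vector \<Rightarrow> 'b::real_normed_vector"
  assumes "finite B" "span B = (UNIV :: 'a set)" "linear f"
  shows "bounded_linear f"
proof -
  interpret linear f by fact
  obtain B' where B': "B' \<subseteq> B" "independent B'" "span B' = UNIV"
    using maximal_independent_subset[of B] assms(2) span_mono span_span
    by (metis top.extremum_uniqueI)
  have fin: "finite B'" using B'(1) assms(1) finite_subset by blast
  obtain C where C: "C > 0" "\<And>c. (\<Sum>b\<in>B'. \<bar>c b\<bar>) \<le> C * norm (\<Sum>b\<in>B'. c b *\<^sub>R b)"
    using independent_coefficients_bound[OF fin B'(2)] by blast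
  define K where "K = (\<Sum>b\<in>B'. norm (f b))"
  have "norm (f x) \<le> norm x * (C * K)" for x
  proof -
    define c where "c = representation B' x"
    have x: "(\<Sum>b\<in>B'. c b *\<^sub>R b) = x"
      unfolding c_def using B' fin by (intro real_vector.sum_representation_eq) auto
    have "f x = (\<Sum>b\<in>B'. c b *\<^sub>R f b)"
      by (subst x[symmetric]) (simp add: sum scale)
    also have "norm \<dots> \<le> (\<Sum>b\<in>B'. \<bar>c b\<bar> * norm (f b))"
      by (rule norm_sum[THEN order_trans]) simp
    also have "\<dots> \<le> (\<Sum>b\<in>B'. \<bar>c b\<bar> * K)"
      using fin by (intro sum_mono mult_left_mono) (auto simp: K_def intro!: member_le_sum)
    also have "\<dots> = (\<Sum>b\<in>B'. \<bar>c b\<bar>) * K" by (simp add: sum_distrib_right)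
    also have "\<dots> \<le> (C * norm x) * K"
      using C(2)[of c] x by (intro mult_right_mono) (auto simp: K_def sum_nonneg)
    finally show ?thesis by (simp add: mult_ac)
  qed
  then show ?thesis
    by (intro bounded_linear_intro[of f "C * K"]) (auto simp: add scale)
qed

text \<open>A basis with continuous coordinate functionals: the device by which a vector depending
  on a point is written with fixed vectors and smooth coefficients.\<close>

lemma finite_dim_coordinates:
  assumes "\<exists>B::'a::real_normed_vector set. finite B \<and> span B = UNIV"
  obtains B :: "'a::real_normed_vector set" and c :: "'a::real_normed_vector \<Rightarrow> 'a \<Rightarrow> real"
  where "finite B" "independent B" "span B = UNIV" "card B = dim (UNIV :: 'a::real_normed_vector set)"
    "\<And>b. b \<in> B \<Longrightarrow> bounded_linear (c b)" "\<And>x. x = (\<Sum>b\<in>B. c b x *\<^sub>R b)"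
    "\<And>b b'. b' \<in> B \<Longrightarrow> c b b' = (if b = b' then 1 else 0)"
proof -
  obtain B0 :: "'a set" where B0: "finite B0" "span B0 = UNIV" using assms by blast
  obtain B where B: "B \<subseteq> B0" "independent B" "span B = UNIV"
    using maximal_independent_subset[of B0] B0(2) span_mono span_span
    by (metis top.extremum_uniqueI)
  have fin: "finite B" using B B0 finite_subset by blast
  have "linear (\<lambda>x. representation B x b)" for b
    using B by (intro linearI) (auto simp: real_vector.representation_add real_vector.representation_scale)
  then have "bounded_linear (\<lambda>x. representation B x b)" for b
    using finite_dim_bounded_linear[OF B0] by blast
  moreover have "x = (\<Sum>b\<in>B. representation B x b *\<^sub>R b)" for x
    using real_vector.sum_representation_eq[OF B(2) _ fin order_refl, of x] B(3) by simp
  moreover have "card B = dim (UNIV :: 'a set)"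
    using dim_eq_card_independent[OF B(2)] dim_span[of B] B(3) by simp
  moreover have "representation B b' b = (if b = b' then 1 else 0)" if "b' \<in> B" for b b'
    using that by (simp add: real_vector.representation_basis[OF B(2)])
  ultimately show ?thesis using that[of B "\<lambda>b x. representation B x b"] fin B by blast
qed

section \<open>Calculus of smooth maps\<close>

text \<open>\<open>frechet_derivative\<close> is selected among all derivatives by a choice
  operator. Functions that agree near \<open>x\<close> have the same derivatives, hence the same
  selected value, even where no derivative exists.\<close>

lemma frechet_derivative_cong_open:
  assumes "open S" "x \<in> S" "\<And>y. y \<in> S \<Longrightarrow> f y = g y"
  shows "frechet_derivative f (at x) = frechet_derivative g (at x)"
    and "f differentiable (at x) \<longleftrightarrow> g differentiable (at x)"
proof -
  have "(f has_derivative D) (at x) \<longleftrightarrow> (g has_derivative D) (at x)" for D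
    using has_derivative_transform_within_open[OF _ assms(1,2), where f = f and g = g and f' = D]
      has_derivative_transform_within_open[OF _ assms(1,2), where f = g and g = f and f' = D] assms(3) by auto
  then show "frechet_derivative f (at x) = frechet_derivative g (at x)"
    and "f differentiable (at x) \<longleftrightarrow> g differentiable (at x)"
    by (simp_all add: frechet_derivative_def differentiable_def)
qed

lemma Ck_on_cong:
  assumes "open S" "\<And>y. y \<in> S \<Longrightarrow> f y = g y"
  shows "Ck_on k f S \<longleftrightarrow> Ck_on k g S"
  using assms(2)
proof (induction k arbitrary: f g)
  case 0
  then show ?case using continuous_on_cong[OF refl, of S f g] by simp
next
  case (Suc k)
  have "Ck_on k (\<lambda>x. frechet_derivative f (at x) v) S \<longleftrightarrow> Ck_on k (\<lambda>x. frechet_derivative g (at x) v) S" for v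
    by (intro Suc.IH) (simp add: frechet_derivative_cong_open(1)[OF assms(1) _ Suc.prems])
  moreover have "f differentiable (at x) \<longleftrightarrow> g differentiable (at x)" if "x \<in> S" for x
    by (rule frechet_derivative_cong_open(2)[OF assms(1) that Suc.prems])
  ultimately show ?case by simp
qed

lemma Ck_on_subset: "Ck_on k f S \<Longrightarrow> T \<subseteq> S \<Longrightarrow> Ck_on k f T"
  by (induction k arbitrary: f) (auto intro: continuous_on_subset)

lemma Ck_on_local:
  assumes "\<And>x. x \<in> S \<Longrightarrow> \<exists>T. open T \<and> x \<in> T \<and> Ck_on k f T"
  shows "Ck_on k f S"
  using assms
proof (induction k arbitrary: f)
  case 0
  have "isCont f x" if "x \<in> S" for x
    using 0[OF that] by (auto simp: continuous_on_eq_continuous_at)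
  then show ?case by (simp add: continuous_at_imp_continuous_on)
next
  case (Suc k)
  have "Ck_on k (\<lambda>x. frechet_derivative f (at x) v) S" for v
    by (rule Suc.IH) (use Suc.prems in fastforce)
  then show ?case using Suc.prems by fastforce
qed

lemma Ck_on_Suc_imp: "Ck_on (Suc k) f S \<Longrightarrow> Ck_on k f S"
proof (induction k arbitrary: f)
  case 0
  then show ?case
    by (auto intro: continuous_at_imp_continuous_on differentiable_imp_continuous_within)
next
  case (Suc k)
  then show ?case by (metis Ck_on.simps(2))
qed

text \<open>Allows the inductions below to work with an explicit formula for the derivative instead
  of \<open>frechet_derivative\<close>.\<close>

lemma Ck_on_SucI:
  assumes "open S" "\<And>x. x \<in> S \<Longrightarrow> (f has_derivative D x) (at x)"
    "\<And>v. Ck_on k (\<lambda>x. D x v) S"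
  shows "Ck_on (Suc k) f S"
proof -
  have "frechet_derivative f (at x) = D x" if "x \<in> S" for x
    by (rule frechet_derivative_at[OF assms(2)[OF that], symmetric])
  then have "Ck_on k (\<lambda>x. frechet_derivative f (at x) v) S" for v
    using assms(3)[of v] Ck_on_cong[OF assms(1), of "\<lambda>x. frechet_derivative f (at x) v" "\<lambda>x. D x v"]
    by simp
  then show ?thesis using assms(2) by (auto simp: differentiable_def)
qed

lemma Ck_on_SucD:
  assumes "Ck_on (Suc k) f S"
  shows "x \<in> S \<Longrightarrow> (f has_derivative frechet_derivative f (at x)) (at x)"
    and "Ck_on k (\<lambda>x. frechet_derivative f (at x) v) S"
  using assms by (auto simp: frechet_derivative_works)

lemma Ck_on_const: "open S \<Longrightarrow> Ck_on k (\<lambda>x. a) S"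
proof (induction k arbitrary: a)
  case (Suc k)
  then show ?case by (intro Ck_on_SucI[where D="\<lambda>_ _. 0"]) auto
qed auto

lemma Ck_on_add:
  assumes "open S"
  shows "Ck_on k f S \<Longrightarrow> Ck_on k g S \<Longrightarrow> Ck_on k (\<lambda>x. f x + g x) S"
proof (induction k arbitrary: f g)
  case (Suc k)
  show ?case
    by (rule Ck_on_SucI[OF assms has_derivative_add[OF Ck_on_SucD(1)[OF Suc.prems(1)] Ck_on_SucD(1)[OF Suc.prems(2)]]])
      (use Suc in auto)
qed (auto intro: continuous_intros)

lemma Ck_on_sum:
  assumes "open S" "\<And>i. i \<in> I \<Longrightarrow> Ck_on k (f i) S"
  shows "Ck_on k (\<lambda>x. \<Sum>i\<in>I. f i x) S"
  using assms(2)
  by (induction I rule: infinite_finite_induct) (auto simp: Ck_on_const Ck_on_add assms(1))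

lemma Ck_on_bounded_linear:
  assumes "open S" "bounded_linear L"
  shows "Ck_on k f S \<Longrightarrow> Ck_on k (\<lambda>x. L (f x)) S"
proof (induction k arbitrary: f)
  case 0
  then show ?case using assms(2) by (auto intro: bounded_linear.continuous_on)
next
  case (Suc k)
  show ?case
    by (rule Ck_on_SucI[OF assms(1) bounded_linear.has_derivative[OF assms(2) Ck_on_SucD(1)[OF Suc.prems]]])
      (use Suc in auto)
qed

lemma Ck_on_bounded_bilinear:
  assumes "open S" "bounded_bilinear pr"
  shows "Ck_on k f S \<Longrightarrow> Ck_on k g S \<Longrightarrow> Ck_on k (\<lambda>x. pr (f x) (g x)) S"
proof (induction k arbitrary: f g)
  case 0
  then show ?case using bounded_bilinear.continuous_on[OF assms(2)] by auto
next
  case (Suc k)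
  let ?f' = "\<lambda>x. frechet_derivative f (at x)" and ?g' = "\<lambda>x. frechet_derivative g (at x)"
  have "Ck_on k (\<lambda>x. pr (f x) (?g' x v) + pr (?f' x v) (g x)) S" for v
    by (intro Ck_on_add[OF assms(1)] Suc.IH Ck_on_SucD(2)[OF Suc.prems(1)] Ck_on_SucD(2)[OF Suc.prems(2)]
        Ck_on_Suc_imp[OF Suc.prems(1)] Ck_on_Suc_imp[OF Suc.prems(2)])
  moreover have "((\<lambda>x. pr (f x) (g x)) has_derivative (\<lambda>v. pr (f x) (?g' x v) + pr (?f' x v) (g x))) (at x)"
    if "x \<in> S" for x
    by (intro bounded_bilinear.FDERIV[OF assms(2)] Ck_on_SucD(1)[OF Suc.prems(1) that]
        Ck_on_SucD(1)[OF Suc.prems(2) that])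
  ultimately show ?case by (intro Ck_on_SucI[OF assms(1)])
qed

lemma Ck_on_inverse:
  fixes f :: "'a::real_normed_vector \<Rightarrow> real"
  assumes "open S" "\<And>x. x \<in> S \<Longrightarrow> f x \<noteq> 0"
  shows "Ck_on k f S \<Longrightarrow> Ck_on k (\<lambda>x. inverse (f x)) S"
proof (induction k)
  case 0
  then show ?case using assms(2) by (auto intro!: continuous_intros)
next
  case (Suc k)
  \<comment> \<open>The derivative of 1/f is -(1/f) f' (1/f), so the reciprocal is needed one order
    lower and only for the same \<open>f\<close>; no generalisation over \<open>f\<close> is
    required.\<close>
  have i: "Ck_on k (\<lambda>x. inverse (f x)) S" using Suc Ck_on_Suc_imp by blast
  have "Ck_on k (\<lambda>x. - 1 * (inverse (f x) * frechet_derivative f (at x) v * inverse (f x))) S" for v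
    by (intro Ck_on_bounded_bilinear[OF assms(1) bounded_bilinear_mult] Ck_on_const assms(1) i Ck_on_SucD(2)[OF Suc.prems])
  then show ?case
    using Deriv.has_derivative_inverse[OF assms(2) Ck_on_SucD(1)[OF Suc.prems]]
    by (intro Ck_on_SucI[OF assms(1)]) simp_all
qed

text \<open>\<open>Ck_on\<close> controls derivatives in fixed directions, whereas the chain rule
  produces f'(g x) in the moving direction g'(x) v. Expanding that direction in a basis of the
  middle space gives a finite sum of products to which the induction hypothesis applies; finite
  dimension of the middle space enters here.\<close>

lemma Ck_on_compose:
  fixes f :: "'b::real_normed_vector \<Rightarrow> 'c::real_normed_vector"
    and g :: "'a::real_normed_vector \<Rightarrow> 'b"
  assumes "\<exists>B::'b set. finite B \<and> span B = UNIV" "open S" "open T" "g ` S \<subseteq> T"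
  shows "Ck_on k f T \<Longrightarrow> Ck_on k g S \<Longrightarrow> Ck_on k (\<lambda>x. f (g x)) S"
proof (induction k arbitrary: f)
  case 0
  then show ?case using assms(4) by (auto intro: continuous_on_compose2)
next
  case (Suc k)
  obtain B :: "'b set" and c :: "'b \<Rightarrow> 'b \<Rightarrow> real" where B: "finite B"
    "\<And>b. b \<in> B \<Longrightarrow> bounded_linear (c b)" and c: "\<And>x. x = (\<Sum>b\<in>B. c b x *\<^sub>R b)"
    using finite_dim_coordinates[OF assms(1)] by metis
  let ?f' = "\<lambda>x. frechet_derivative f (at x)" and ?g' = "\<lambda>x. frechet_derivative g (at x)"
  have D: "((\<lambda>x. f (g x)) has_derivative (\<lambda>v. ?f' (g x) (?g' x v))) (at x)" if "x \<in> S" for x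
    using diff_chain_at[OF Ck_on_SucD(1)[OF Suc.prems(2) that] Ck_on_SucD(1)[OF Suc.prems(1), of "g x"]]
      that assms(4) by (auto simp: o_def)
  have "?f' (g x) (?g' x v) = (\<Sum>b\<in>B. c b (?g' x v) *\<^sub>R ?f' (g x) b)" if "x \<in> S" for x v
  proof -
    have "linear (?f' (g x))"
      using Ck_on_SucD(1)[OF Suc.prems(1), of "g x"] that assms(4) has_derivative_linear by blast
    then have "?f' (g x) (\<Sum>b\<in>B. c b (?g' x v) *\<^sub>R b) = (\<Sum>b\<in>B. c b (?g' x v) *\<^sub>R ?f' (g x) b)"
      by (simp add: linear_sum linear_scale)
    then show ?thesis using c[of "?g' x v"] by simp
  qed
  moreover have "Ck_on k (\<lambda>x. \<Sum>b\<in>B. c b (?g' x v) *\<^sub>R ?f' (g x) b) S" for v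
  proof (intro Ck_on_sum assms(2) Ck_on_bounded_bilinear[OF assms(2) bounded_bilinear_scaleR])
    fix b assume "b \<in> B"
    then show "Ck_on k (\<lambda>x. c b (?g' x v)) S"
      by (intro Ck_on_bounded_linear[OF assms(2) B(2)] Ck_on_SucD(2)[OF Suc.prems(2)])
    show "Ck_on k (\<lambda>x. ?f' (g x) b) S"
      by (intro Suc.IH Ck_on_SucD(2)[OF Suc.prems(1)] Ck_on_Suc_imp[OF Suc.prems(2)])
  qed
  ultimately have "Ck_on k (\<lambda>x. ?f' (g x) (?g' x v)) S" for v
    using Ck_on_cong[OF assms(2), of "\<lambda>x. ?f' (g x) (?g' x v)"] by simp
  then show ?case using D by (intro Ck_on_SucI[OF assms(2)])
qed

lemma smooth_on_cong:
  "open S \<Longrightarrow> (\<And>y. y \<in> S \<Longrightarrow> f y = g y) \<Longrightarrow> smooth_on f S \<longleftrightarrow> smooth_on g S"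
  unfolding smooth_on_def using Ck_on_cong by metis

lemma smooth_on_subset: "smooth_on f S \<Longrightarrow> T \<subseteq> S \<Longrightarrow> smooth_on f T"
  unfolding smooth_on_def using Ck_on_subset by metis

lemma smooth_on_local:
  "(\<And>x. x \<in> S \<Longrightarrow> \<exists>T. open T \<and> x \<in> T \<and> smooth_on f T) \<Longrightarrow> smooth_on f S"
  unfolding smooth_on_def using Ck_on_local by metis

lemma smooth_on_const: "open S \<Longrightarrow> smooth_on (\<lambda>x. a) S"
  unfolding smooth_on_def using Ck_on_const by metis

lemma smooth_on_sum:
  "open S \<Longrightarrow> (\<And>i. i \<in> I \<Longrightarrow> smooth_on (f i) S) \<Longrightarrow> smooth_on (\<lambda>x. \<Sum>i\<in>I. f i x) S"
  unfolding smooth_on_def using Ck_on_sum by metis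

lemma smooth_on_bounded_linear:
  "open S \<Longrightarrow> bounded_linear L \<Longrightarrow> smooth_on f S \<Longrightarrow> smooth_on (\<lambda>x. L (f x)) S"
  unfolding smooth_on_def using Ck_on_bounded_linear by metis

lemma smooth_on_mult:
  fixes f g :: "'a::real_normed_vector \<Rightarrow> real"
  shows "open S \<Longrightarrow> smooth_on f S \<Longrightarrow> smooth_on g S \<Longrightarrow> smooth_on (\<lambda>x. f x * g x) S"
  unfolding smooth_on_def using Ck_on_bounded_bilinear[OF _ bounded_bilinear_mult] by metis

lemma smooth_on_diff:
  assumes "open S" "smooth_on f S" "smooth_on g S"
  shows "smooth_on (\<lambda>x. f x - g x) S"
proof -
  have "smooth_on (\<lambda>x. - g x) S"
    by (rule smooth_on_bounded_linear[OF assms(1) bounded_linear_minus[OF bounded_linear_ident] assms(3)])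
  then show ?thesis
    using assms(1,2) Ck_on_add[of S _ f "\<lambda>x. - g x"] by (simp add: smooth_on_def)
qed

lemma smooth_on_divide:
  fixes f g :: "'a::real_normed_vector \<Rightarrow> real"
  assumes "open S" "\<And>x. x \<in> S \<Longrightarrow> g x \<noteq> 0" "smooth_on f S" "smooth_on g S"
  shows "smooth_on (\<lambda>x. f x / g x) S"
  using assms smooth_on_mult[OF assms(1,3), of "\<lambda>x. inverse (g x)"] Ck_on_inverse[OF assms(1), of g]
  by (simp add: smooth_on_def divide_inverse)

lemma smooth_on_compose:
  fixes f :: "'b::real_normed_vector \<Rightarrow> 'c::real_normed_vector"
  assumes "\<exists>B::'b set. finite B \<and> span B = UNIV" "open S" "open T" "g ` S \<subseteq> T"
    "smooth_on f T" "smooth_on g S"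
  shows "smooth_on (\<lambda>x. f (g x)) S"
  using assms(5,6) Ck_on_compose[OF assms(1-4)] by (auto simp: smooth_on_def)

lemma smooth_on_has_derivative:
  "smooth_on f S \<Longrightarrow> x \<in> S \<Longrightarrow> (f has_derivative frechet_derivative f (at x)) (at x)"
  unfolding smooth_on_def using Ck_on_SucD(1) by blast

lemma smooth_on_derivative: "smooth_on f S \<Longrightarrow> smooth_on (\<lambda>x. frechet_derivative f (at x) v) S"
  unfolding smooth_on_def using Ck_on_SucD(2) by blast

lemma smooth_on_continuous: "smooth_on f S \<Longrightarrow> continuous_on S f"
  unfolding smooth_on_def using Ck_on.simps(1) by blast

text \<open>Gaussian elimination with parameters: near \<open>x0\<close> the pivots do not vanish.\<close>

lemma smooth_linear_system:
  fixes a :: "nat \<Rightarrow> nat \<Rightarrow> 'a::real_normed_vector \<Rightarrow> real"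
  assumes "open S" "x0 \<in> S" "\<And>i j. i < k \<Longrightarrow> j < k \<Longrightarrow> smooth_on (a i j) S"
    "\<And>i j. i < k \<Longrightarrow> j < k \<Longrightarrow> a i j x0 = (if i = j then 1 else 0)"
    "\<And>j. j < k \<Longrightarrow> smooth_on (b j) S"
    "\<And>x j. x \<in> S \<Longrightarrow> j < k \<Longrightarrow> b j x = (\<Sum>i<k. a i j x * h i x)"
  shows "\<exists>T. open T \<and> x0 \<in> T \<and> T \<subseteq> S \<and> (\<forall>i<k. smooth_on (h i) T)"
  using assms
proof (induction k arbitrary: a b S)
  case 0
  then show ?case by auto
next
  case (Suc k)
  note sm = Suc.prems(3)
  \<comment> \<open>The last pivot equals 1 at \<open>x0\<close>; \<open>S'\<close> is the open set
    on which division by it is possible.\<close>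
  define S' where "S' = S \<inter> a k k -` (- {0})"
  have S': "open S'" "S' \<subseteq> S" "x0 \<in> S'" and nz: "\<And>x. x \<in> S' \<Longrightarrow> a k k x \<noteq> 0"
    using continuous_open_preimage[OF smooth_on_continuous[OF sm[of k k]] \<open>open S\<close>, of "- {0}"]
      Suc.prems(2) Suc.prems(4)[of k k]
    by (auto simp: S'_def)
  note sm' = smooth_on_subset[OF sm S'(2)] smooth_on_subset[OF Suc.prems(5) S'(2)]
  have "\<exists>T. open T \<and> x0 \<in> T \<and> T \<subseteq> S' \<and> (\<forall>i<k. smooth_on (h i) T)"
  \<comment> \<open>Eliminating the last unknown leaves the Schur complement. The off-diagonal
    entries vanish at \<open>x0\<close>, so it is again the identity there and the induction
    continues.\<close>
  proof (rule Suc.IH[where a = "\<lambda>i j x. a i j x - a k j x * a i k x / a k k x"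
        and b = "\<lambda>j x. b j x - a k j x * b k x / a k k x", OF S'(1,3)])
    show "smooth_on (\<lambda>x. a i j x - a k j x * a i k x / a k k x) S'" if "i < k" "j < k" for i j
      by (intro smooth_on_diff smooth_on_divide smooth_on_mult S' nz sm') (use that in auto)
    show "smooth_on (\<lambda>x. b j x - a k j x * b k x / a k k x) S'" if "j < k" for j
      by (intro smooth_on_diff smooth_on_divide smooth_on_mult S' nz sm') (use that in auto)
    show "a i j x0 - a k j x0 * a i k x0 / a k k x0 = (if i = j then 1 else 0)" if "i < k" "j < k" for i j
      using Suc.prems(4) that by simp
    show "b j x - a k j x * b k x / a k k x = (\<Sum>i<k. (a i j x - a k j x * a i k x / a k k x) * h i x)"
      if "x \<in> S'" "j < k" for x j
    proof -
      have "a k j x * b k x / a k k x = (\<Sum>i<k. a k j x * a i k x / a k k x * h i x) + a k j x * h k x"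
        using Suc.prems(6)[of x k] that S' nz[OF that(1)]
        by (simp add: subset_iff sum_distrib_left distrib_left sum_divide_distrib add_divide_distrib algebra_simps)
      then show ?thesis
        using Suc.prems(6)[of x j] that S' by (simp add: subset_iff left_diff_distrib sum_subtractf)
    qed
  qed
  then obtain T where T: "open T" "x0 \<in> T" "T \<subseteq> S'" "\<And>i. i < k \<Longrightarrow> smooth_on (h i) T" by blast
  \<comment> \<open>Back substitution: the equation with index \<open>k\<close> expresses the last
    unknown through the others, which are already smooth on \<open>T\<close>.\<close>
  have "h k x = (b k x - (\<Sum>i<k. a i k x * h i x)) / a k k x" if "x \<in> T" for x
    using Suc.prems(6)[of x k] that subsetD[OF T(3)] subsetD[OF S'(2)] nz[of x] by (simp add: field_simps)
  moreover have "smooth_on (\<lambda>x. (b k x - (\<Sum>i<k. a i k x * h i x)) / a k k x) T"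
    by (intro smooth_on_diff smooth_on_divide smooth_on_sum smooth_on_mult T(1))
      (use T(3,4) nz in \<open>auto intro: smooth_on_subset[OF sm'(1)] smooth_on_subset[OF sm'(2)]\<close>)
  ultimately have "smooth_on (h k) T"
    using smooth_on_cong[OF T(1), of "h k" "\<lambda>x. (b k x - (\<Sum>i<k. a i k x * h i x)) / a k k x"] by simp
  then show ?case
    using T S'(2) by (intro exI[of _ T]) (auto simp: less_Suc_eq)
qed

section \<open>Charts and smooth functions\<close>

lemma chart_open: "smooth_manifold M \<Longrightarrow> c \<in> atlas M \<Longrightarrow> openin (mtop M) (fst c)"
  unfolding smooth_manifold_def by (cases c) fastforce

lemma chart_homeomorphic:
  assumes "smooth_manifold M" "c \<in> atlas M"
  shows "open (snd c ` fst c)"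
    and "homeomorphic_map (subtopology (mtop M) (fst c)) (top_of_set (snd c ` fst c)) (snd c)"
  using assms unfolding smooth_manifold_def by (cases c; fastforce)+

lemma chart_inj_on: "smooth_manifold M \<Longrightarrow> c \<in> atlas M \<Longrightarrow> inj_on (snd c) (fst c)"
  using homeomorphic_imp_injective_map[OF chart_homeomorphic(2)] openin_subset[OF chart_open]
  by (metis topspace_subtopology_subset)

lemma chart_image_open:
  assumes "smooth_manifold M" "c \<in> atlas M" "openin (mtop M) W"
  shows "open (snd c ` (fst c \<inter> W))"
proof -
  have "openin (subtopology (mtop M) (fst c)) (fst c \<inter> W)"
    using assms(3) by (metis inf_commute openin_subtopology_Int)
  then have "openin (top_of_set (snd c ` fst c)) (snd c ` (fst c \<inter> W))"
    using homeomorphic_imp_open_map[OF chart_homeomorphic(2)[OF assms(1,2)]] by (auto simp: open_map_def)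
  then show ?thesis
    using chart_homeomorphic(1)[OF assms(1,2)] by (simp add: openin_open_eq)
qed

lemma chart_inv_chart [simp]:
  "smooth_manifold M \<Longrightarrow> c \<in> atlas M \<Longrightarrow> x \<in> fst c \<Longrightarrow> chart_inv c (snd c x) = x"
  by (simp add: chart_inj_on inv_into_f_f)

lemma charts_at_nonempty:
  assumes "smooth_manifold M" "x \<in> points M"
  obtains c where "c \<in> charts_at M x"
  using assms unfolding smooth_manifold_def charts_at_def by (metis (mono_tags, lifting) UN_E mem_Collect_eq)

lemma charts_at_D:
  assumes "c \<in> charts_at M x"
  shows "c \<in> atlas M" "x \<in> fst c"
  using assms by (auto simp: charts_at_def)

lemma smooth_manifold_finite_dim:
  "smooth_manifold (M :: ('p, 'e::real_normed_vector) manifold) \<Longrightarrow> \<exists>B::'e set. finite B \<and> span B = UNIV"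
  unfolding smooth_manifold_def by blast

lemma smooth_map_id_chart:
  assumes "smooth_map X M (\<lambda>x. x)" "d \<in> atlas X" "c \<in> atlas M"
  shows "smooth_on (snd c \<circ> chart_inv d) (snd d ` (fst d \<inter> fst c))"
  using assms unfolding smooth_map_def by (cases c; cases d) (fastforce simp: o_def vimage_def Int_def)

lemma smooth_map_id_open:
  assumes "smooth_map X M (\<lambda>x. x)" "openin (mtop M) W"
  shows "openin (mtop X) (points X \<inter> W)"
  using openin_continuous_map_preimage[of "mtop X" "mtop M" "\<lambda>x. x" W] assms
  by (simp add: smooth_map_def Int_def)

text \<open>A manifold counts as included in itself, so facts comparing charts of \<open>X\<close>
  with charts of \<open>M\<close> specialise to coordinate changes.\<close>

lemma smooth_map_id: "smooth_manifold M \<Longrightarrow> smooth_map M M (\<lambda>x. x)"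
  unfolding smooth_manifold_def smooth_map_def by (simp add: o_def vimage_def Int_def)

lemma smooth_map_id_points: "smooth_map X M (\<lambda>x. x) \<Longrightarrow> x \<in> points X \<Longrightarrow> x \<in> points M"
  unfolding smooth_map_def using continuous_map_image_subset_topspace by fastforce

lemma smooth_function_on_charts:
  "smooth_function_on M W f \<longleftrightarrow> (\<forall>c\<in>atlas M. smooth_on (f \<circ> chart_inv c) (snd c ` (fst c \<inter> W)))"
  unfolding smooth_function_on_def by (auto simp: split_beta)

lemma smooth_function_on_subset: "smooth_function_on M W f \<Longrightarrow> W' \<subseteq> W \<Longrightarrow> smooth_function_on M W' f"
  unfolding smooth_function_on_charts by (meson Int_mono image_mono order_refl smooth_on_subset)

lemma smooth_function_on_local:
  assumes "smooth_manifold M"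
    "\<And>x. x \<in> W \<Longrightarrow> \<exists>W'. openin (mtop M) W' \<and> x \<in> W' \<and> smooth_function_on M W' f"
  shows "smooth_function_on M W f"
  unfolding smooth_function_on_charts
proof (intro ballI smooth_on_local)
  fix c y assume c: "c \<in> atlas M" and "y \<in> snd c ` (fst c \<inter> W)"
  then obtain x where x: "x \<in> fst c" "x \<in> W" "y = snd c x" by blast
  then obtain W' where "openin (mtop M) W'" "x \<in> W'" "smooth_function_on M W' f"
    using assms(2) by blast
  then show "\<exists>T. open T \<and> y \<in> T \<and> smooth_on (f \<circ> chart_inv c) T"
    using chart_image_open[OF assms(1) c] c x unfolding smooth_function_on_charts by blast
qed

lemma smooth_function_on_cong:
  assumes "smooth_manifold M" "openin (mtop M) W" "\<And>x. x \<in> W \<Longrightarrow> f x = g x"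
  shows "smooth_function_on M W f \<longleftrightarrow> smooth_function_on M W g"
proof -
  have "smooth_on (f \<circ> chart_inv c) (snd c ` (fst c \<inter> W)) \<longleftrightarrow> smooth_on (g \<circ> chart_inv c) (snd c ` (fst c \<inter> W))"
    if "c \<in> atlas M" for c
    by (rule smooth_on_cong[OF chart_image_open[OF assms(1) that assms(2)]])
      (use assms that in auto)
  then show ?thesis unfolding smooth_function_on_charts by blast
qed

lemma smooth_function_on_const:
  "smooth_manifold M \<Longrightarrow> openin (mtop M) W \<Longrightarrow> smooth_function_on M W (\<lambda>x. a)"
  by (simp add: smooth_function_on_charts o_def smooth_on_const chart_image_open)

lemma smooth_function_on_mult:
  "smooth_manifold M \<Longrightarrow> openin (mtop M) W \<Longrightarrow> smooth_function_on M W f \<Longrightarrow> smooth_function_on M W g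
    \<Longrightarrow> smooth_function_on M W (\<lambda>x. f x * g x)"
  by (simp add: smooth_function_on_charts o_def smooth_on_mult chart_image_open)

lemma smooth_function_on_sum:
  "smooth_manifold M \<Longrightarrow> openin (mtop M) W \<Longrightarrow> (\<And>i. i \<in> I \<Longrightarrow> smooth_function_on M W (f i))
    \<Longrightarrow> smooth_function_on M W (\<lambda>x. \<Sum>i\<in>I. f i x)"
  by (simp add: smooth_function_on_charts o_def smooth_on_sum chart_image_open)

text \<open>In a chart \<open>d\<close> of \<open>X\<close> the function is the composite of its
  expression in the one chart \<open>c\<close> with the smooth map from \<open>d\<close> to
  \<open>c\<close>. For \<open>M = X\<close> this says that a single chart covering \<open>W\<close>
  suffices to test smoothness.\<close>

lemma smooth_function_on_pullback_chart:
  fixes M :: "('p, 'e::real_normed_vector) manifold"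
  assumes "smooth_manifold X" "smooth_manifold M" "smooth_map X M (\<lambda>x. x)" "c \<in> atlas M"
    "openin (mtop X) W" "W \<subseteq> fst c" "open T" "snd c ` W \<subseteq> T" "smooth_on (f \<circ> chart_inv c) T"
  shows "smooth_function_on X W f"
  unfolding smooth_function_on_charts
proof
  fix d assume d: "d \<in> atlas X"
  have op: "open (snd d ` (fst d \<inter> W))" using chart_image_open assms(1,5) d by blast
  have "smooth_on (snd c \<circ> chart_inv d) (snd d ` (fst d \<inter> W))"
    by (rule smooth_on_subset[OF smooth_map_id_chart[OF assms(3) d assms(4)]]) (use assms(6) in auto)
  moreover have "(snd c \<circ> chart_inv d) ` (snd d ` (fst d \<inter> W)) \<subseteq> T"
    using assms(1,8) d by auto
  ultimately have "smooth_on (\<lambda>y. (f \<circ> chart_inv c) ((snd c \<circ> chart_inv d) y)) (snd d ` (fst d \<inter> W))"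
    using smooth_on_compose[OF smooth_manifold_finite_dim[OF assms(2)] op assms(7) _ assms(9)] by blast
  then show "smooth_on (f \<circ> chart_inv d) (snd d ` (fst d \<inter> W))"
    by (rule smooth_on_cong[OF op, THEN iffD1, rotated]) (use assms(1,2,4,6) d in \<open>auto dest!: subsetD\<close>)
qed

text \<open>\<open>X\<close> has its own topology, possibly finer than the subspace topology. Open
  sets therefore reach it through continuity of the inclusion, and smoothness is tested near each
  point in one chart of \<open>M\<close>.\<close>

lemma smooth_function_on_submanifold:
  assumes "smooth_manifold X" "smooth_manifold M" "smooth_map X M (\<lambda>x. x)"
    "openin (mtop M) W" "smooth_function_on M W f"
  shows "smooth_function_on X (points X \<inter> W) f"
proof (rule smooth_function_on_local[OF assms(1)])
  fix x assume x: "x \<in> points X \<inter> W"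
  then obtain c where c: "c \<in> charts_at M x"
    using charts_at_nonempty[OF assms(2)] smooth_map_id_points[OF assms(3)] by blast
  let ?W = "points X \<inter> (fst c \<inter> W)"
  have cM: "c \<in> atlas M" and xc: "x \<in> fst c" using charts_at_D[OF c] by auto
  have "openin (mtop X) ?W"
    using smooth_map_id_open[OF assms(3)] chart_open[OF assms(2) cM] assms(4) openin_Int by blast
  moreover have "smooth_function_on X ?W f"
    by (rule smooth_function_on_pullback_chart[OF assms(1-3) cM calculation _
          chart_image_open[OF assms(2) cM assms(4)]])
      (use assms(5) cM in \<open>auto simp: smooth_function_on_charts\<close>)
  ultimately show "\<exists>W'. openin (mtop X) W' \<and> x \<in> W' \<and> smooth_function_on X W' f"
    using x xc by blast
qed

section \<open>Tangent vectors in charts\<close>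

text \<open>Unlike \<open>coord_change_deriv\<close>, this allows the two charts to have different model spaces.\<close>

definition chart_jacobian ::
  "'p \<Rightarrow> ('p, 'e::real_normed_vector) chart \<Rightarrow> ('p, 'f::real_normed_vector) chart \<Rightarrow> 'e \<Rightarrow> 'f" where
  "chart_jacobian x c d = frechet_derivative (snd d \<circ> chart_inv c) (at (snd c x))"

lemma coord_change_deriv_eq: "coord_change_deriv = chart_jacobian"
  by (intro ext) (simp add: coord_change_deriv_def chart_jacobian_def)

lemma has_derivative_chart_jacobian:
  assumes "smooth_map X M (\<lambda>x. x)" "c \<in> charts_at X x" "d \<in> charts_at M x"
  shows "((snd d \<circ> chart_inv c) has_derivative chart_jacobian x c d) (at (snd c x))"
  unfolding chart_jacobian_def using smooth_on_has_derivative[OF smooth_map_id_chart[OF assms(1)]] assms(2,3)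
  by (auto simp: charts_at_def)

lemma linear_chart_jacobian:
  assumes "smooth_map X M (\<lambda>x. x)" "c \<in> charts_at X x" "d \<in> charts_at M x"
  shows "linear (chart_jacobian x c d)"
  using has_derivative_chart_jacobian[OF assms] has_derivative_linear by blast

text \<open>With three equal manifolds this is the cocycle rule for tangent vectors; with other
  choices it compares the differential of an inclusion in different charts. The detour through
  \<open>d\<close> agrees with the direct chart change only on the overlap of \<open>c\<close> and
  \<open>d\<close>, whose image is open because the inclusion is continuous.\<close>

lemma chart_jacobian_chain:
  assumes X: "smooth_manifold X" and Y: "smooth_manifold Y"
    and XY: "smooth_map X Y (\<lambda>x. x)" and YZ: "smooth_map Y Z (\<lambda>x. x)"
    and c: "c \<in> charts_at X x" and d: "d \<in> charts_at Y x" and e: "e \<in> charts_at Z x"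
  shows "chart_jacobian x d e (chart_jacobian x c d u) = chart_jacobian x c e u"
proof -
  note c' = charts_at_D[OF c] and d' = charts_at_D[OF d]
  let ?S = "snd c ` (fst c \<inter> fst d)"
  have "openin (mtop X) (points X \<inter> fst d)"
    using smooth_map_id_open[OF XY] chart_open[OF Y d'(1)] by blast
  moreover have "fst c \<inter> (points X \<inter> fst d) = fst c \<inter> fst d"
    using openin_subset[OF chart_open[OF X c'(1)]] by blast
  ultimately have S: "open ?S" using chart_image_open[OF X c'(1)] by metis
  have "((snd e \<circ> chart_inv d) has_derivative chart_jacobian x d e) (at ((snd d \<circ> chart_inv c) (snd c x)))"
    using has_derivative_chart_jacobian[OF YZ d e] X c' by simp
  from diff_chain_at[OF has_derivative_chart_jacobian[OF XY c d] this]
  have "((snd e \<circ> chart_inv d) \<circ> (snd d \<circ> chart_inv c) has_derivative chart_jacobian x d e \<circ> chart_jacobian x c d) (at (snd c x))" .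
  then have "((snd e \<circ> chart_inv c) has_derivative chart_jacobian x d e \<circ> chart_jacobian x c d) (at (snd c x))"
    by (rule has_derivative_transform_within_open[OF _ S]) (use X Y c' d' in auto)
  then have "chart_jacobian x d e \<circ> chart_jacobian x c d = chart_jacobian x c e"
    unfolding chart_jacobian_def[of x c e] by (rule frechet_derivative_at)
  then show ?thesis by (metis comp_apply)
qed

lemma chart_jacobian_same:
  assumes "smooth_manifold M" "c \<in> charts_at M x"
  shows "chart_jacobian x c c u = u"
proof -
  note c = charts_at_D[OF assms(2)]
  have "((\<lambda>x. x) has_derivative (\<lambda>x. x)) (at (snd c x))" by (rule has_derivative_ident)
  then have "((snd c \<circ> chart_inv c) has_derivative (\<lambda>x. x)) (at (snd c x))"
    by (rule has_derivative_transform_within_open[OF _ chart_homeomorphic(1)[OF assms(1) c(1)]])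
      (use assms(1) c in auto)
  then show ?thesis
    unfolding chart_jacobian_def using frechet_derivative_at by metis
qed

lemma tangent_space_iff:
  "v \<in> tangent_space M x \<longleftrightarrow>
     (\<forall>c\<in>charts_at M x. \<forall>d\<in>charts_at M x. chart_jacobian x c d (v c) = v d) \<and> (\<forall>c. c \<notin> charts_at M x \<longrightarrow> v c = 0)"
  unfolding tangent_space_def coord_change_deriv_eq mem_Collect_eq by metis

lemma coord_vec_in_tangent_space:
  assumes "smooth_manifold M" "c \<in> charts_at M x"
  shows "coord_vec M c u x \<in> tangent_space M x"
  using chart_jacobian_chain[OF assms(1) assms(1) smooth_map_id smooth_map_id assms(2)] assms(1)
  by (auto simp: tangent_space_iff coord_vec_def coord_change_deriv_eq)

lemma coord_vec_apply:
  assumes "smooth_manifold M" "c \<in> charts_at M x"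
  shows "coord_vec M c u x c = u"
  using assms chart_jacobian_same[OF assms] by (simp add: coord_vec_def coord_change_deriv_eq)

lemma coord_vec_component:
  assumes "c \<in> charts_at M x" "v \<in> tangent_space M x"
  shows "coord_vec M c (v c) x = v"
  using assms by (auto simp: tangent_space_iff coord_vec_def coord_change_deriv_eq)

lemma coord_vec_linear:
  assumes "smooth_manifold M" "c \<in> charts_at M x"
  shows "coord_vec M c (u + v) x = tadd (coord_vec M c u x) (coord_vec M c v x)"
    and "coord_vec M c (a *\<^sub>R u) x = tscale a (coord_vec M c u x)"
  using linear_chart_jacobian[OF smooth_map_id[OF assms(1)] assms(2)]
  by (auto simp: coord_vec_def tadd_def tscale_def coord_change_deriv_eq fun_eq_iff linear_add linear_scale)

lemma tangent_space_closed:
  assumes "smooth_manifold M"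
  shows "u \<in> tangent_space M x \<Longrightarrow> v \<in> tangent_space M x \<Longrightarrow> tadd u v \<in> tangent_space M x"
    and "u \<in> tangent_space M x \<Longrightarrow> tscale a u \<in> tangent_space M x"
  using linear_chart_jacobian[OF smooth_map_id[OF assms]]
  by (auto simp: tangent_space_iff tadd_def tscale_def coord_change_deriv_eq linear_add linear_scale)

text \<open>The differential is defined through a chart selected by \<open>SOME\<close>; the chain
  rule shows that every chart \<open>c\<close> gives the same value.\<close>

lemma incl_differential_component:
  assumes "smooth_manifold X" "smooth_manifold M" "smooth_map X M (\<lambda>x. x)"
    "c \<in> charts_at X x" "d \<in> charts_at M x" "v \<in> tangent_space X x"
  shows "incl_differential X M x v d = chart_jacobian x c d (v c)"
proof -
  define c' where "c' = (SOME c. c \<in> charts_at X x)"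
  have c': "c' \<in> charts_at X x" unfolding c'_def using assms(4) by (rule someI)
  have "snd d \<circ> (\<lambda>x. x) \<circ> chart_inv c' = snd d \<circ> chart_inv c'" by (simp add: o_def)
  then have "incl_differential X M x v d = chart_jacobian x c' d (v c')"
    using assms(5) by (simp add: incl_differential_def differential_def Let_def c'_def chart_jacobian_def)
  also have "v c' = chart_jacobian x c c' (v c)"
    using assms(4,6) c' by (simp add: tangent_space_iff)
  finally show ?thesis
    using chart_jacobian_chain[OF assms(1,1) smooth_map_id[OF assms(1)] assms(3,4) c' assms(5)] by simp
qed

lemma incl_differential_eq_coord_vec:
  assumes "smooth_manifold X" "smooth_manifold M" "smooth_map X M (\<lambda>x. x)"
    "c \<in> charts_at X x" "d \<in> charts_at M x" "v \<in> tangent_space X x"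
  shows "incl_differential X M x v = coord_vec M d (chart_jacobian x c d (v c)) x"
proof
  fix e
  show "incl_differential X M x v e = coord_vec M d (chart_jacobian x c d (v c)) x e"
  proof (cases "e \<in> charts_at M x")
    case True
    then show ?thesis
      using incl_differential_component[OF assms(1-4) True assms(6)]
        chart_jacobian_chain[OF assms(1-3) smooth_map_id[OF assms(2)] assms(4,5) True]
      by (simp add: coord_vec_def coord_change_deriv_eq)
  qed (simp add: incl_differential_def differential_def coord_vec_def)
qed

lemma incl_differential_in_tangent_space:
  assumes "smooth_manifold X" "smooth_manifold M" "smooth_map X M (\<lambda>x. x)"
    "x \<in> points X" "v \<in> tangent_space X x"
  shows "incl_differential X M x v \<in> tangent_space M x"
proof -
  obtain c d where "c \<in> charts_at X x" "d \<in> charts_at M x"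
    using charts_at_nonempty assms smooth_map_id_points by metis
  then show ?thesis
    using incl_differential_eq_coord_vec assms coord_vec_in_tangent_space by metis
qed

lemma incl_differential_linear:
  assumes "smooth_manifold X" "smooth_manifold M" "smooth_map X M (\<lambda>x. x)"
    "x \<in> points X" "u \<in> tangent_space X x" "v \<in> tangent_space X x"
  shows "incl_differential X M x (tadd u v) = tadd (incl_differential X M x u) (incl_differential X M x v)"
    and "incl_differential X M x (tscale a u) = tscale a (incl_differential X M x u)"
proof -
  obtain c d where cd: "c \<in> charts_at X x" "d \<in> charts_at M x"
    using charts_at_nonempty assms smooth_map_id_points by metis
  note eq = incl_differential_eq_coord_vec[OF assms(1-3) cd] and lin = linear_chart_jacobian[OF assms(3) cd]
  show "incl_differential X M x (tadd u v) = tadd (incl_differential X M x u) (incl_differential X M x v)"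
    using eq[OF assms(5)] eq[OF assms(6)] eq[OF tangent_space_closed(1)[OF assms(1,5,6)]]
    by (simp add: coord_vec_linear[OF assms(2) cd(2), symmetric] tadd_def[of u v] linear_add[OF lin])
  show "incl_differential X M x (tscale a u) = tscale a (incl_differential X M x u)"
    using eq[OF assms(5)] eq[OF tangent_space_closed(2)[OF assms(1,5), of a]]
    by (simp add: coord_vec_linear[OF assms(2) cd(2), symmetric] tscale_def[of a u] linear_scale[OF lin])
qed

section \<open>Vector bundles\<close>

abbreviation unit_seq :: "nat \<Rightarrow> nat \<Rightarrow> real" where
  "unit_seq i \<equiv> (\<lambda>j. if j = i then 1 else 0)"

lemma Rn_iff: "w \<in> Rn k \<longleftrightarrow> (\<forall>i\<ge>k. w i = 0)"
  by (simp add: topspace_Euclidean_space)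

text \<open>Linearity of \<open>g\<close> is known only on the set \<open>Rn k\<close>, so the
  expansion is built one coordinate at a time, by truncating \<open>w\<close> at \<open>m\<close>;
  all truncations stay in that set.\<close>

lemma Rn_linear_functional:
  assumes "\<And>u v. u \<in> Rn k \<Longrightarrow> v \<in> Rn k \<Longrightarrow> g (\<lambda>i. u i + v i) = g u + g v"
    "\<And>a u. u \<in> Rn k \<Longrightarrow> g (\<lambda>i. a * u i) = a * g u" "w \<in> Rn k"
  shows "g w = (\<Sum>i<k. w i * g (unit_seq i :: nat \<Rightarrow> real) :: real)"
proof -
  have "m \<le> k \<Longrightarrow> g (\<lambda>i. if i < m then w i else 0) = (\<Sum>i<m. w i * g (unit_seq i))" for m
  proof (induction m)
    case 0
    then show ?case using assms(2)[of "\<lambda>i. 0" 0] by (simp add: Rn_iff)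
  next
    case (Suc m)
    let ?u = "\<lambda>i. if i < m then w i else 0"
    have "(\<lambda>i. if i < Suc m then w i else 0) = (\<lambda>i. ?u i + (w m * unit_seq m i))"
      by (auto simp: less_Suc_eq)
    moreover have "g (\<lambda>i. ?u i + (w m * unit_seq m i)) = g ?u + g (\<lambda>i. w m * unit_seq m i)"
      using Suc.prems by (intro assms(1)) (auto simp: Rn_iff)
    moreover have "g (\<lambda>i. w m * unit_seq m i) = w m * g (unit_seq m)"
      using Suc.prems by (intro assms(2)) (auto simp: Rn_iff)
    ultimately show ?case using Suc by simp
  qed
  from this[of k] have "g (\<lambda>i. if i < k then w i else 0) = (\<Sum>i<k. w i * g (unit_seq i))" by simp
  also have "(\<lambda>i. if i < k then w i else 0) = w" using assms(3) by (auto simp: Rn_iff)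
  finally show ?thesis .
qed

definition closed_fibre :: "('p, 'v) vbundle \<Rightarrow> 'p \<Rightarrow> bool" where
  "closed_fibre E x \<longleftrightarrow> (\<forall>u\<in>fibre E x. \<forall>v\<in>fibre E x. fadd E x u v \<in> fibre E x) \<and>
     (\<forall>a. \<forall>v\<in>fibre E x. fscale E x a v \<in> fibre E x)"

text \<open>A vector bundle without the condition on transition functions. Only this much is
  verified directly for the restricted tangent bundle and for the target; smooth transitions of the
  target are later inherited from the quotient.\<close>

definition topological_bundle :: "('p, 'e) manifold \<Rightarrow> ('p, 'v) vbundle \<Rightarrow> bool" where
  "topological_bundle B E \<longleftrightarrow> (\<forall>x\<in>points B. closed_fibre E x) \<and> \<Union> (fst ` trivs E) = points B \<and>
     (\<forall>(U, \<tau>)\<in>trivs E. local_triv B E U \<tau>)"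

lemma vector_bundle_iff:
  "vector_bundle B E \<longleftrightarrow> topological_bundle B E \<and>
     (\<forall>(U, \<tau>)\<in>trivs E. \<forall>(V, \<sigma>)\<in>trivs E. \<forall>w\<in>Rn (vb_rank E). \<forall>i.
        smooth_function_on B (U \<inter> V) (\<lambda>x. \<sigma> x (inv_into (fibre E x) (\<tau> x) w) i))"
  by (simp add: vector_bundle_def topological_bundle_def closed_fibre_def)

context
  fixes B :: "('p, 'e) manifold" and E :: "('p, 'v) vbundle" and U \<tau> x
  assumes triv: "local_triv B E U \<tau>" and x: "x \<in> U"
begin

lemma local_triv_bij: "bij_betw (\<tau> x) (fibre E x) (Rn (vb_rank E))"
  using triv x by (simp add: local_triv_def)

lemma local_triv_add: "u \<in> fibre E x \<Longrightarrow> v \<in> fibre E x \<Longrightarrow> \<tau> x (fadd E x u v) i = \<tau> x u i + \<tau> x v i"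
  using triv x by (simp add: local_triv_def)

lemma local_triv_scale: "v \<in> fibre E x \<Longrightarrow> \<tau> x (fscale E x a v) i = a * \<tau> x v i"
  using triv x by (simp add: local_triv_def)

lemma local_triv_in_Rn: "v \<in> fibre E x \<Longrightarrow> \<tau> x v \<in> Rn (vb_rank E)"
  using local_triv_bij bij_betwE by blast

lemma local_triv_eqI: "u \<in> fibre E x \<Longrightarrow> v \<in> fibre E x \<Longrightarrow> (\<And>i. \<tau> x u i = \<tau> x v i) \<Longrightarrow> u = v"
  using bij_betw_imp_inj_on[OF local_triv_bij] by (meson ext inj_onD)

lemma local_triv_inv:
  "w \<in> Rn (vb_rank E) \<Longrightarrow> inv_into (fibre E x) (\<tau> x) w \<in> fibre E x"
  "w \<in> Rn (vb_rank E) \<Longrightarrow> \<tau> x (inv_into (fibre E x) (\<tau> x) w) = w"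
  "v \<in> fibre E x \<Longrightarrow> inv_into (fibre E x) (\<tau> x) (\<tau> x v) = v"
  using local_triv_bij by (auto simp: bij_betw_def inv_into_into f_inv_into_f)

lemma local_triv_inv_eqI:
  "v \<in> fibre E x \<Longrightarrow> \<tau> x v = w \<Longrightarrow> inv_into (fibre E x) (\<tau> x) w = v"
  using local_triv_inv(3) by blast

lemma local_triv_inv_linear:
  assumes "closed_fibre E x"
  shows "v \<in> Rn (vb_rank E) \<Longrightarrow> w \<in> Rn (vb_rank E) \<Longrightarrow> inv_into (fibre E x) (\<tau> x) (\<lambda>i. v i + w i) =
      fadd E x (inv_into (fibre E x) (\<tau> x) v) (inv_into (fibre E x) (\<tau> x) w)"
    and "w \<in> Rn (vb_rank E) \<Longrightarrow> inv_into (fibre E x) (\<tau> x) (\<lambda>i. a * w i) =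
      fscale E x a (inv_into (fibre E x) (\<tau> x) w)"
  using assms local_triv_inv
  by (auto intro!: local_triv_inv_eqI simp: closed_fibre_def local_triv_add local_triv_scale)

lemma local_triv_functional:
  assumes "closed_fibre E x" "v \<in> fibre E x"
    "\<And>u v. u \<in> fibre E x \<Longrightarrow> v \<in> fibre E x \<Longrightarrow> \<alpha> (fadd E x u v) = \<alpha> u + \<alpha> v"
    "\<And>a v. v \<in> fibre E x \<Longrightarrow> \<alpha> (fscale E x a v) = a * \<alpha> v"
  shows "\<alpha> v = (\<Sum>i<vb_rank E. \<tau> x v i * \<alpha> (inv_into (fibre E x) (\<tau> x) (unit_seq i)) :: real)"
  using Rn_linear_functional[of "vb_rank E" "\<lambda>w. \<alpha> (inv_into (fibre E x) (\<tau> x) w)" "\<tau> x v"] assms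
  by (simp add: local_triv_inv_linear local_triv_inv local_triv_in_Rn)

end

lemma topological_bundle_triv:
  assumes "topological_bundle B E" "x \<in> points B"
  obtains U \<tau> where "(U, \<tau>) \<in> trivs E" "local_triv B E U \<tau>" "x \<in> U"
  using assms unfolding topological_bundle_def by fastforce

text \<open>Each identity holds in \<open>Rn\<close> and is pulled back by injectivity of a
  trivialisation. The selection is what cosets and line bundles call for.\<close>

lemma topological_bundle_laws:
  assumes "topological_bundle B E" "x \<in> points B" "u \<in> fibre E x" "v \<in> fibre E x" "w \<in> fibre E x" "z \<in> fibre E x"
  shows "fadd E x (fadd E x u v) (fadd E x w z) = fadd E x (fadd E x u w) (fadd E x v z)"
    and "fadd E x u (fscale E x 0 z) = u"
    and "fscale E x a (fadd E x u v) = fadd E x (fscale E x a u) (fscale E x a v)"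
    and "fadd E x (fscale E x a u) (fscale E x b u) = fscale E x (a + b) u"
    and "fscale E x a (fscale E x b u) = fscale E x (a * b) u"
    and "fadd E x (fadd E x u v) w = fadd E x u (fadd E x v w)"
proof -
  obtain U \<tau> where t: "local_triv B E U \<tau>" "x \<in> U"
    using topological_bundle_triv[OF assms(1,2)] by metis
  have cl: "u \<in> fibre E x \<Longrightarrow> v \<in> fibre E x \<Longrightarrow> fadd E x u v \<in> fibre E x" "u \<in> fibre E x \<Longrightarrow> fscale E x a u \<in> fibre E x"
    for u v a using assms(1,2) by (auto simp: topological_bundle_def closed_fibre_def)
  note [simp] = local_triv_add[OF t] local_triv_scale[OF t] cl assms(3-6)
  show "fadd E x (fadd E x u v) (fadd E x w z) = fadd E x (fadd E x u w) (fadd E x v z)"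
    and "fadd E x u (fscale E x 0 z) = u"
    and "fscale E x a (fadd E x u v) = fadd E x (fscale E x a u) (fscale E x a v)"
    and "fadd E x (fscale E x a u) (fscale E x b u) = fscale E x (a + b) u"
    and "fscale E x a (fscale E x b u) = fscale E x (a * b) u"
    and "fadd E x (fadd E x u v) w = fadd E x u (fadd E x v w)"
    by (rule local_triv_eqI[OF t]; simp add: algebra_simps)+
qed

section \<open>Duals, Whitney sums, line bundles and pullbacks\<close>

lemma Collect_pair_image:
  "{(U, f \<tau>) |U \<tau>. (U, \<tau>) \<in> T} = (\<lambda>(U, \<tau>). (U, f \<tau>)) ` T"
  by force

lemma topological_bundle_dual:
  assumes "topological_bundle B E"
  shows "topological_bundle B (dual_bundle E)"
proof -
  have "local_triv B (dual_bundle E) U (\<lambda>x \<alpha> i. if i < vb_rank E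
      then \<alpha> (inv_into (fibre E x) (\<tau> x) (unit_seq i)) else 0)" if "(U, \<tau>) \<in> trivs E" for U \<tau>
  proof -
    have t: "local_triv B E U \<tau>" using assms that by (auto simp: topological_bundle_def)
    have "bij_betw (\<lambda>\<alpha> i. if i < vb_rank E then \<alpha> (inv_into (fibre E x) (\<tau> x) (unit_seq i)) else 0)
        (fibre (dual_bundle E) x) (Rn (vb_rank E))" (is "bij_betw ?T _ _") if x: "x \<in> U" for x
    proof (rule bij_betwI')
      have cl: "closed_fibre E x"
        using t x assms openin_subset by (fastforce simp: topological_bundle_def local_triv_def)
      note f = local_triv_functional[OF t x cl]
      show "(?T \<alpha> = ?T \<beta>) = (\<alpha> = \<beta>)" if ab: "\<alpha> \<in> fibre (dual_bundle E) x" "\<beta> \<in> fibre (dual_bundle E) x" for \<alpha> \<beta>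
      proof
        assume eq: "?T \<alpha> = ?T \<beta>"
        have e: "\<alpha> (inv_into (fibre E x) (\<tau> x) (unit_seq i)) = \<beta> (inv_into (fibre E x) (\<tau> x) (unit_seq i))"
          if "i < vb_rank E" for i
          using fun_cong[OF eq, of i] that by simp
        show "\<alpha> = \<beta>"
        proof
          fix v show "\<alpha> v = \<beta> v"
          proof (cases "v \<in> fibre E x")
            case True
            have "\<alpha> v = (\<Sum>i<vb_rank E. \<tau> x v i * \<alpha> (inv_into (fibre E x) (\<tau> x) (unit_seq i)))"
              using ab(1) by (intro f[OF True]) (auto simp: dual_bundle_def)
            also have "\<dots> = (\<Sum>i<vb_rank E. \<tau> x v i * \<beta> (inv_into (fibre E x) (\<tau> x) (unit_seq i)))"
              by (rule sum.cong) (simp_all add: e)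
            also have "\<dots> = \<beta> v"
              using ab(2) by (intro f[OF True, symmetric]) (auto simp: dual_bundle_def)
            finally show ?thesis .
          qed (use ab in \<open>simp add: dual_bundle_def\<close>)
        qed
      qed (hypsubst, rule refl)
      show "?T \<alpha> \<in> Rn (vb_rank E)" for \<alpha> by (simp add: Rn_iff)
      fix w assume w: "w \<in> Rn (vb_rank E)"
      \<comment> \<open>The functional with components \<open>w\<close> in the frame of \<tau> is
        the combination of the coordinates of \<tau> with weights \<open>w\<close>; it is 0 off the
        fibre, as the encoding of dual fibres requires.\<close>
      define \<alpha> where "\<alpha> v = (if v \<in> fibre E x then \<Sum>i<vb_rank E. w i * \<tau> x v i else 0)" for v
      have "\<alpha> \<in> fibre (dual_bundle E) x"
      proof -
        have "\<alpha> (fadd E x u v) = \<alpha> u + \<alpha> v" if "u \<in> fibre E x" "v \<in> fibre E x" for u v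
        proof -
          have "fadd E x u v \<in> fibre E x" using cl that by (simp add: closed_fibre_def)
          then show ?thesis
            using that by (simp add: \<alpha>_def local_triv_add[OF t x] distrib_left sum.distrib)
        qed
        moreover have "\<alpha> (fscale E x a v) = a * \<alpha> v" if "v \<in> fibre E x" for a v
        proof -
          have "fscale E x a v \<in> fibre E x" using cl that by (simp add: closed_fibre_def)
          then show ?thesis
            using that by (simp add: \<alpha>_def local_triv_scale[OF t x] sum_distrib_left mult.left_commute)
        qed
        ultimately show ?thesis by (simp add: dual_bundle_def \<alpha>_def)
      qed
      moreover have "\<alpha> (inv_into (fibre E x) (\<tau> x) (unit_seq i)) = w i" if "i < vb_rank E" for i
      proof -
        have "unit_seq i \<in> Rn (vb_rank E)" using that by (simp add: Rn_iff)
        then show ?thesis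
          using that by (simp add: \<alpha>_def local_triv_inv[OF t x] if_distrib[of "(*) _"] cong: if_cong)
      qed
      then have "w = ?T \<alpha>"
        using w by (auto simp: Rn_iff)
      ultimately show "\<exists>\<alpha>\<in>fibre (dual_bundle E) x. w = ?T \<alpha>" by blast
    qed
    then show ?thesis
      using t by (auto simp: local_triv_def dual_bundle_def)
  qed
  moreover have "closed_fibre (dual_bundle E) x" if "x \<in> points B" for x
    by (auto simp: closed_fibre_def dual_bundle_def algebra_simps)
  moreover have tr: "trivs (dual_bundle E) = (\<lambda>(U, \<tau>). (U, \<lambda>x \<alpha> i. if i < vb_rank E
      then \<alpha> (inv_into (fibre E x) (\<tau> x) (unit_seq i)) else 0)) ` trivs E"
    unfolding dual_bundle_def by (simp add: Collect_pair_image)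
  have "\<Union> (fst ` trivs (dual_bundle E)) = \<Union> (fst ` trivs E)"
    by (simp add: tr image_image split_beta)
  ultimately show ?thesis
    using assms unfolding topological_bundle_def tr by (simp add: split_beta)
qed

lemma whitney_sum_trivs:
  assumes "(W, \<rho>) \<in> trivs (whitney_sum E F)"
  obtains U \<tau> V \<sigma> where "(U, \<tau>) \<in> trivs E" "(V, \<sigma>) \<in> trivs F" "W = U \<inter> V"
    "\<rho> = (\<lambda>x v i. if i < vb_rank E then \<tau> x (fst v) i else \<sigma> x (snd v) (i - vb_rank E))"
proof -
  have "\<exists>U \<tau> V \<sigma>. W = U \<inter> V \<and>
      \<rho> = (\<lambda>x v i. if i < vb_rank E then \<tau> x (fst v) i else \<sigma> x (snd v) (i - vb_rank E)) \<and>
      (U, \<tau>) \<in> trivs E \<and> (V, \<sigma>) \<in> trivs F"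
    using assms by (simp add: whitney_sum_def)
  then show ?thesis using that by (elim exE conjE) simp
qed

lemma topological_bundle_whitney_sum:
  assumes "topological_bundle B E" "topological_bundle B F"
  shows "topological_bundle B (whitney_sum E F)"
proof -
  let ?k = "vb_rank E" and ?l = "vb_rank F"
  have "local_triv B (whitney_sum E F) (U \<inter> V)
      (\<lambda>x v i. if i < ?k then \<tau> x (fst v) i else \<sigma> x (snd v) (i - ?k))"
    if "(U, \<tau>) \<in> trivs E" "(V, \<sigma>) \<in> trivs F" for U \<tau> V \<sigma>
  proof -
    have t: "local_triv B E U \<tau>"
      using assms(1) that(1) by (auto simp: topological_bundle_def)
    have s: "local_triv B F V \<sigma>"
      using assms(2) that(2) by (auto simp: topological_bundle_def)
    have "bij_betw (\<lambda>v i. if i < ?k then \<tau> x (fst v) i else \<sigma> x (snd v) (i - ?k))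
       (fibre E x \<times> fibre F x) (Rn (?k + ?l))" (is "bij_betw ?T _ _") if "x \<in> U" "x \<in> V" for x
    proof (rule bij_betwI')
      note t = t that(1) and s = s that(2)
      show "(?T u = ?T v) = (u = v)" if uv: "u \<in> fibre E x \<times> fibre F x" "v \<in> fibre E x \<times> fibre F x" for u v
      proof
        assume eq: "?T u = ?T v"
        \<comment> \<open>Below the rank these entries are part of the joint coordinates; from the
          rank on, both are 0 by membership in \<open>Rn\<close>.\<close>
        have "\<tau> x (fst u) i = \<tau> x (fst v) i" for i
        proof (cases "i < ?k")
          case True
          then show ?thesis using fun_cong[OF eq, of i] by simp
        next
          case False
          then have "\<tau> x w i = 0" if "w \<in> fibre E x" for w
            using local_triv_in_Rn[OF t that] by (simp add: Rn_iff)
          then show ?thesis using uv by (metis mem_Times_iff)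
        qed
        then have 1: "fst u = fst v" using uv by (intro local_triv_eqI[OF t]) auto
        have "\<sigma> x (snd u) i = \<sigma> x (snd v) i" for i
          using fun_cong[OF eq, of "?k + i"] by simp
        then have "snd u = snd v" using uv by (intro local_triv_eqI[OF s]) auto
        with 1 show "u = v" by (simp add: prod_eq_iff)
      qed (hypsubst, rule refl)
      show "?T v \<in> Rn (?k + ?l)" if "v \<in> fibre E x \<times> fibre F x" for v
        using local_triv_in_Rn[OF s, of "snd v"] that by (auto simp: Rn_iff)
      fix w assume w: "w \<in> Rn (?k + ?l)"
      \<comment> \<open>The two blocks of \<open>w\<close>: the first cut off at the rank of
        \<open>E\<close>, the second shifted down by that rank.\<close>
      define w1 where "w1 i = (if i < ?k then w i else 0)" for i
      define w2 where "w2 i = w (?k + i)" for i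
      have "w1 \<in> Rn ?k" "w2 \<in> Rn ?l" using w by (auto simp: Rn_iff w1_def w2_def)
      then show "\<exists>v\<in>fibre E x \<times> fibre F x. w = ?T v"
        using local_triv_inv[OF t] local_triv_inv[OF s]
        by (intro bexI[of _ "(inv_into (fibre E x) (\<tau> x) w1, inv_into (fibre F x) (\<sigma> x) w2)"])
          (auto simp: w1_def[abs_def] w2_def[abs_def])
    qed
    then show ?thesis
      using t s by (auto simp: local_triv_def whitney_sum_def openin_Int)
  qed
  then have triv: "local_triv B (whitney_sum E F) W \<rho>" if "(W, \<rho>) \<in> trivs (whitney_sum E F)" for W \<rho>
    using that by (elim whitney_sum_trivs) simp
  have "\<Union> (fst ` trivs (whitney_sum E F)) = points B"
  proof (intro equalityI subsetI)
    fix x assume "x \<in> \<Union> (fst ` trivs (whitney_sum E F))"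
    then obtain W \<rho> where "(W, \<rho>) \<in> trivs (whitney_sum E F)" "x \<in> W" by auto
    then show "x \<in> points B"
      using triv openin_subset by (metis local_triv_def subsetD)
  next
    fix x assume x: "x \<in> points B"
    obtain U \<tau> V \<sigma> where "(U, \<tau>) \<in> trivs E" "(V, \<sigma>) \<in> trivs F" "x \<in> U \<inter> V"
      using topological_bundle_triv[OF assms(1) x] topological_bundle_triv[OF assms(2) x] by (metis IntI)
    then have "(U \<inter> V, \<lambda>x v i. if i < ?k then \<tau> x (fst v) i else \<sigma> x (snd v) (i - ?k)) \<in> trivs (whitney_sum E F)"
      by (auto simp: whitney_sum_def)
    then have "U \<inter> V \<in> fst ` trivs (whitney_sum E F)" by (rule image_eqI[rotated]) simp
    with \<open>x \<in> U \<inter> V\<close> show "x \<in> \<Union> (fst ` trivs (whitney_sum E F))" by (rule UnionI[rotated])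
  qed
  moreover have "closed_fibre (whitney_sum E F) x" if "x \<in> points B" for x
    using assms that by (simp add: topological_bundle_def closed_fibre_def whitney_sum_def)
  ultimately show ?thesis
    unfolding topological_bundle_def using triv by (simp add: split_beta)
qed

text \<open>Injectivity of a \<mapsto> a s(x), that is s(x) \<noteq> 0, makes the definite
  description in the trivialisation return the coefficient.\<close>

lemma topological_bundle_line:
  assumes E: "topological_bundle B E"
    and s: "\<And>x. x \<in> points B \<Longrightarrow> s x \<in> fibre E x" "\<And>x. x \<in> points B \<Longrightarrow> inj (\<lambda>a. fscale E x a (s x))"
  shows "topological_bundle B (line_bundle B E s)"
proof -
  have the: "(THE b. fscale E x a (s x) = fscale E x b (s x)) = a" if "x \<in> points B" for x a
    using s(2)[OF that] by (auto simp: inj_def)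
  have add: "fadd E x (fscale E x a (s x)) (fscale E x b (s x)) = fscale E x (a + b) (s x)"
    and scale: "fscale E x a (fscale E x b (s x)) = fscale E x (a * b) (s x)" if "x \<in> points B" for x a b
    using topological_bundle_laws[OF E that s(1)[OF that] s(1)[OF that] s(1)[OF that] s(1)[OF that]] by auto
  have "bij_betw (\<lambda>v i. if i = 0 then THE a. v = fscale E x a (s x) else 0)
      (range (\<lambda>a. fscale E x a (s x))) (Rn (Suc 0))" (is "bij_betw ?T _ _") if x: "x \<in> points B" for x
  proof (rule bij_betwI')
    have *: "?T (fscale E x a (s x)) = (\<lambda>i. if i = 0 then a else 0)" for a
      by (intro ext) (simp add: the[OF x])
    show "(?T u = ?T v) = (u = v)"
      if "u \<in> range (\<lambda>a. fscale E x a (s x))" "v \<in> range (\<lambda>a. fscale E x a (s x))" for u v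
      using that by (auto simp: the[OF x] fun_eq_iff)
    show "?T v \<in> Rn (Suc 0)" for v by (simp add: Rn_iff)
    fix w assume "w \<in> Rn (Suc 0)"
    then have "w = ?T (fscale E x (w 0) (s x))"
      unfolding * by (auto simp: Rn_iff)
    then show "\<exists>v\<in>range (\<lambda>a. fscale E x a (s x)). w = ?T v" by blast
  qed
  moreover have "closed_fibre (line_bundle B E s) x" if "x \<in> points B" for x
    unfolding closed_fibre_def by (auto simp: line_bundle_def add[OF that] scale[OF that])
  ultimately show ?thesis
    unfolding topological_bundle_def
    by (simp add: line_bundle_def local_triv_def the add scale)
qed

lemma topological_bundle_pullback:
  assumes "topological_bundle M E" "continuous_map (mtop X) (mtop M) F"
  shows "topological_bundle X (pullback_bundle X F E)"
proof -
  have F: "F x \<in> points M" if "x \<in> points X" for x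
    using continuous_map_image_subset_topspace[OF assms(2)] that by blast
  have "openin (mtop X) (points X \<inter> F -` U)" if "openin (mtop M) U" for U
    using openin_continuous_map_preimage[OF assms(2) that] by (simp add: vimage_def Int_def)
  then have "local_triv X (pullback_bundle X F E) (points X \<inter> F -` U) (\<tau> \<circ> F)" if "(U, \<tau>) \<in> trivs E" for U \<tau>
    using assms(1) that by (auto simp: topological_bundle_def local_triv_def pullback_bundle_def)
  moreover have "\<Union> (fst ` trivs (pullback_bundle X F E)) = points X"
  proof (intro equalityI subsetI)
    fix x assume x: "x \<in> points X"
    obtain U \<tau> where "(U, \<tau>) \<in> trivs E" "F x \<in> U"
      using topological_bundle_triv[OF assms(1) F[OF x]] by metis
    with x have "(points X \<inter> F -` U, \<tau> \<circ> F) \<in> trivs (pullback_bundle X F E)" "x \<in> points X \<inter> F -` U"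
      by (auto simp: pullback_bundle_def)
    moreover from this(1) have "points X \<inter> F -` U \<in> fst ` trivs (pullback_bundle X F E)"
      by (rule image_eqI[rotated]) simp
    ultimately show "x \<in> \<Union> (fst ` trivs (pullback_bundle X F E))" by blast
  qed (auto simp: pullback_bundle_def)
  moreover have "closed_fibre (pullback_bundle X F E) x" if "x \<in> points X" for x
    using assms(1) F[OF that] by (simp add: topological_bundle_def closed_fibre_def pullback_bundle_def)
  ultimately show ?thesis
    unfolding topological_bundle_def by (auto simp: pullback_bundle_def[of X F E])
qed

section \<open>Quotient bundles\<close>

text \<open>Locally, the inverse of \<open>\<tau>\<close> has a smooth lift along \<open>p\<close>, obtained by solving a linear system.\<close>

lemma smooth_transition_of_projection:
  assumes X: "smooth_manifold X" and E: "topological_bundle X E"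
    and Q: "\<And>x. x \<in> points X \<Longrightarrow> closed_fibre Q x"
    and p: "\<And>x. x \<in> points X \<Longrightarrow> p x ` fibre E x = fibre Q x"
    and \<tau>: "local_triv X Q U \<tau>" and \<tau>': "local_triv X Q U' \<tau>'"
    and sm: "\<And>V \<sigma> w i. (V, \<sigma>) \<in> trivs E \<Longrightarrow> w \<in> Rn (vb_rank E) \<Longrightarrow>
        smooth_function_on X (U \<inter> V) (\<lambda>x. \<tau> x (p x (inv_into (fibre E x) (\<sigma> x) w)) i)"
    and sm': "\<And>V \<sigma> w i. (V, \<sigma>) \<in> trivs E \<Longrightarrow> w \<in> Rn (vb_rank E) \<Longrightarrow>
        smooth_function_on X (U' \<inter> V) (\<lambda>x. \<tau>' x (p x (inv_into (fibre E x) (\<sigma> x) w)) i)"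
    and w: "w \<in> Rn (vb_rank Q)"
  shows "smooth_function_on X (U \<inter> U') (\<lambda>x. \<tau>' x (inv_into (fibre Q x) (\<tau> x) w) l)"
  unfolding smooth_function_on_charts
proof (intro ballI smooth_on_local)
  fix c y assume c: "c \<in> atlas X" and "y \<in> snd c ` (fst c \<inter> (U \<inter> U'))"
  then obtain x0 where x0: "x0 \<in> fst c" "x0 \<in> U" "x0 \<in> U'" "y = snd c x0" by blast
  have U: "openin (mtop X) U" "openin (mtop X) U'" using \<tau> \<tau>' by (auto simp: local_triv_def)
  have x0X: "x0 \<in> points X" using U(1) x0(2) openin_subset by blast
  obtain V \<sigma> where V: "(V, \<sigma>) \<in> trivs E" "local_triv X E V \<sigma>" "x0 \<in> V"
    by (rule topological_bundle_triv[OF E x0X])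
  have oV: "openin (mtop X) V" using V(2) by (simp add: local_triv_def)
  define k where "k = vb_rank Q"
  define S where "S = snd c ` (fst c \<inter> (U \<inter> U' \<inter> V))"
  have S: "open S" "y \<in> S"
    unfolding S_def using chart_image_open[OF X c openin_Int[OF openin_Int[OF U] oV]] x0 V(3) by auto
  let ?J = "\<lambda>x w. inv_into (fibre Q x) (\<tau> x) w" and ?P = "\<lambda>x w. p x (inv_into (fibre E x) (\<sigma> x) w)"
  \<comment> \<open>Surjectivity of the projection at \<open>x0\<close> supplies coordinate vectors
    whose constant sections in the frame of \<sigma> project, at \<open>x0\<close>, to the frame of
    \<tau>.\<close>
  have "\<exists>u. u \<in> Rn (vb_rank E) \<and> ?P x0 u = ?J x0 (unit_seq j)" if "j < k" for j
  proof -
    have "?J x0 (unit_seq j) \<in> p x0 ` fibre E x0"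
      unfolding p[OF x0X] using that by (intro local_triv_inv[OF \<tau> x0(2)]) (simp add: Rn_iff k_def)
    then obtain v where v: "v \<in> fibre E x0" "?J x0 (unit_seq j) = p x0 v" by blast
    then show ?thesis
      using local_triv_inv(3)[OF V(2,3) v(1)] local_triv_in_Rn[OF V(2,3) v(1)] by metis
  qed
  then obtain u where u: "\<And>j. j < k \<Longrightarrow> u j \<in> Rn (vb_rank E)"
    "\<And>j. j < k \<Longrightarrow> ?P x0 (u j) = ?J x0 (unit_seq j)" by metis
  \<comment> \<open>\<open>a\<close> and \<open>b\<close> are coordinates of the projected sections
    in \<tau> and \<tau>', smooth by hypothesis; \<open>h\<close> holds the entries with index
    \<open>l\<close> of the transition functions, about which nothing is known yet. Linearity of the
    transition gives b j = \<Sum> a i j h i, and the choice of \<open>u\<close> makes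
    \<open>a\<close> the identity at \<open>x0\<close>.\<close>
  define a where "a i j = (\<lambda>x. \<tau> x (?P x (u j)) i) \<circ> chart_inv c" for i j
  define b where "b j = (\<lambda>x. \<tau>' x (?P x (u j)) l) \<circ> chart_inv c" for j
  define h where "h i = (\<lambda>x. \<tau>' x (?J x (unit_seq i)) l) \<circ> chart_inv c" for i
  have lin: "\<tau>' x (?J x z) l = (\<Sum>i<k. z i * \<tau>' x (?J x (unit_seq i)) l)"
    if x: "x \<in> U" "x \<in> U'" and z: "z \<in> Rn k" for x z
  proof (rule Rn_linear_functional[OF _ _ z])
    have cl: "closed_fibre Q x" using Q U(1) x(1) openin_subset by blast
    note J = local_triv_inv(1)[OF \<tau> x(1), folded k_def]
    note L = local_triv_inv_linear[OF \<tau> x(1) cl, folded k_def]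
    show "\<tau>' x (?J x (\<lambda>i. u i + v i)) l = \<tau>' x (?J x u) l + \<tau>' x (?J x v) l"
      if "u \<in> Rn k" "v \<in> Rn k" for u v
      using L(1)[OF that] local_triv_add[OF \<tau>' x(2) J[OF that(1)] J[OF that(2)]] by simp
    show "\<tau>' x (?J x (\<lambda>i. a * u i)) l = a * \<tau>' x (?J x u) l" if "u \<in> Rn k" for a u
      using L(2)[OF that] local_triv_scale[OF \<tau>' x(2) J[OF that]] by simp
  qed
  have "\<exists>T. open T \<and> y \<in> T \<and> T \<subseteq> S \<and> (\<forall>i<k. smooth_on (h i) T)"
  proof (rule smooth_linear_system[OF S, where a = a and b = b])
    show "smooth_on (a i j) S" if "i < k" "j < k" for i j
      using sm[OF V(1) u(1)[OF that(2)], of i] c unfolding smooth_function_on_charts a_def S_def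
      by (auto elim!: smooth_on_subset)
    show "smooth_on (b j) S" if "j < k" for j
      using sm'[OF V(1) u(1)[OF that], of l] c unfolding smooth_function_on_charts b_def S_def
      by (auto elim!: smooth_on_subset)
    show "a i j y = (if i = j then 1 else 0)" if "i < k" "j < k" for i j
    proof -
      have "unit_seq j \<in> Rn (vb_rank Q)" using that by (simp add: Rn_iff k_def)
      from local_triv_inv(2)[OF \<tau> x0(2) this]
      show ?thesis using X c x0 u(2)[OF that(2)] by (simp add: a_def)
    qed
    show "b j z = (\<Sum>i<k. a i j z * h i z)" if z: "z \<in> S" and j: "j < k" for z j
    proof -
      obtain x where x: "x \<in> fst c" "x \<in> U" "x \<in> U'" "x \<in> V" "z = snd c x"
        using z by (auto simp: S_def)
      have "x \<in> points X" using U(1) x(2) openin_subset by blast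
      then have P: "?P x (u j) \<in> fibre Q x"
        using p local_triv_inv(1)[OF V(2) x(4) u(1)[OF j]] by blast
      then show ?thesis
        using lin[OF x(2,3) local_triv_in_Rn[OF \<tau> x(2) P, folded k_def]] local_triv_inv(3)[OF \<tau> x(2) P] X c x
        by (simp add: a_def b_def h_def)
    qed
  qed
  then obtain T where T: "open T" "y \<in> T" "T \<subseteq> S" "\<And>i. i < k \<Longrightarrow> smooth_on (h i) T" by blast
  have "smooth_on (\<lambda>z. \<Sum>i<k. w i * h i z) T"
    using T(1,4) by (intro smooth_on_sum smooth_on_mult smooth_on_const) auto
  moreover have "((\<lambda>x. \<tau>' x (?J x w) l) \<circ> chart_inv c) z = (\<Sum>i<k. w i * h i z)" if z: "z \<in> T" for z
  proof -
    obtain x where x: "x \<in> fst c" "x \<in> U" "x \<in> U'" "z = snd c x"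
      using z T(3) by (auto simp: S_def)
    then show ?thesis
      using lin[OF x(2,3) w[folded k_def]] X c by (simp add: h_def)
  qed
  ultimately have "smooth_on ((\<lambda>x. \<tau>' x (?J x w) l) \<circ> chart_inv c) T"
    by (subst smooth_on_cong[OF T(1)])
  then show "\<exists>T. open T \<and> y \<in> T \<and> smooth_on ((\<lambda>x. \<tau>' x (?J x w) l) \<circ> chart_inv c) T"
    using T by blast
qed

section \<open>Quotient fibres and the isomorphism theorem for bundles\<close>

lemma quotient_bundle_simps:
  "vb_rank (quotient_bundle X E r W) = vb_rank E - r"
  "fibre (quotient_bundle X E r W) x = coset E W x ` fibre E x"
  "fadd (quotient_bundle X E r W) x A B = {fadd E x a b |a b. a \<in> A \<and> b \<in> B}"
  "fscale (quotient_bundle X E r W) x c A = {fadd E x (fscale E x c a) w |a w. a \<in> A \<and> w \<in> W x}"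
  by (simp_all add: quotient_bundle_def Let_def)

lemma quotient_bundle_trivs:
  "(U, \<tau>) \<in> trivs (quotient_bundle X E r W) \<longleftrightarrow> local_triv X (quotient_bundle X E r W) U \<tau> \<and>
     (\<forall>(V, \<sigma>)\<in>trivs E. \<forall>w\<in>Rn (vb_rank E). \<forall>i. smooth_function_on X (U \<inter> V)
        (\<lambda>x. \<tau> x (coset E W x (inv_into (fibre E x) (\<sigma> x) w)) i))"
  by (simp add: quotient_bundle_def Let_def local_triv_def)

text \<open>The elementwise operations descend because \<open>W x\<close> is a subspace. Scaling
  adds an element of \<open>W x\<close> afterwards, since for the factor 0 the scaled elements alone
  would reduce to the zero vector instead of filling the coset.\<close>

lemma coset_operations:
  assumes E: "topological_bundle X E" and x: "x \<in> points X"
    and W: "W x \<subseteq> fibre E x" "W x \<noteq> {}"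
      "\<And>u v. u \<in> W x \<Longrightarrow> v \<in> W x \<Longrightarrow> fadd E x u v \<in> W x" "\<And>a v. v \<in> W x \<Longrightarrow> fscale E x a v \<in> W x"
    and u: "u \<in> fibre E x" and v: "v \<in> fibre E x"
  shows "{fadd E x a b |a b. a \<in> coset E W x u \<and> b \<in> coset E W x v} = coset E W x (fadd E x u v)"
    and "{fadd E x (fscale E x c a) w |a w. a \<in> coset E W x u \<and> w \<in> W x} = coset E W x (fscale E x c u)"
proof -
  note laws = topological_bundle_laws[OF E x]
  obtain w0 where w0: "w0 \<in> W x" using W(2) by blast
  \<comment> \<open>The zero vector of the fibre; bundles name no zero, so it is obtained as 0 times
    an element of \<open>W x\<close>.\<close>
  define z where "z = fscale E x 0 w0"
  have z: "z \<in> W x" unfolding z_def using W(4) w0 by blast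
  have zero: "fadd E x u z = u" if "u \<in> fibre E x" for u
    unfolding z_def using laws(2)[OF that that that] W(1) w0 by blast
  have cl: "fscale E x a u \<in> fibre E x" if "u \<in> fibre E x" for a u
    using E x that by (auto simp: topological_bundle_def closed_fibre_def)
  show "{fadd E x a b |a b. a \<in> coset E W x u \<and> b \<in> coset E W x v} = coset E W x (fadd E x u v)"
  proof (intro equalityI subsetI)
    fix y assume "y \<in> {fadd E x a b |a b. a \<in> coset E W x u \<and> b \<in> coset E W x v}"
    then obtain w w' where w: "w \<in> W x" "w' \<in> W x" and y: "y = fadd E x (fadd E x u w) (fadd E x v w')"
      by (auto simp: coset_def)
    then have "y = fadd E x (fadd E x u v) (fadd E x w w')"
      using laws(1)[OF u _ v, of w w'] W(1) by blast
    then show "y \<in> coset E W x (fadd E x u v)"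
      using W(3)[OF w] by (auto simp: coset_def)
  next
    fix y assume "y \<in> coset E W x (fadd E x u v)"
    then obtain w where w: "w \<in> W x" and y: "y = fadd E x (fadd E x u v) w" by (auto simp: coset_def)
    have "y = fadd E x (fadd E x u w) (fadd E x v z)"
    proof -
      have "fadd E x (fadd E x u w) (fadd E x v z) = fadd E x (fadd E x u v) (fadd E x w z)"
        using laws(1)[OF u _ v, of w z] W(1) w z by blast
      then show ?thesis using zero[of w] w W(1) y by auto
    qed
    then show "y \<in> {fadd E x a b |a b. a \<in> coset E W x u \<and> b \<in> coset E W x v}"
      using w z by (auto simp: coset_def)
  qed
  show "{fadd E x (fscale E x c a) w |a w. a \<in> coset E W x u \<and> w \<in> W x} = coset E W x (fscale E x c u)"
  proof (intro equalityI subsetI)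
    fix y assume "y \<in> {fadd E x (fscale E x c a) w |a w. a \<in> coset E W x u \<and> w \<in> W x}"
    then obtain w w' where w: "w \<in> W x" "w' \<in> W x" and y: "y = fadd E x (fscale E x c (fadd E x u w)) w'"
      by (auto simp: coset_def)
    have wf: "w \<in> fibre E x" "w' \<in> fibre E x" using W(1) w by auto
    have "y = fadd E x (fscale E x c u) (fadd E x (fscale E x c w) w')"
      unfolding y laws(3)[OF u wf(1) u u] by (rule laws(6)[OF cl[OF u] cl[OF wf(1)] wf(2) u])
    then show "y \<in> coset E W x (fscale E x c u)"
      using W(3)[OF W(4)[OF w(1)] w(2)] by (auto simp: coset_def)
  next
    fix y assume "y \<in> coset E W x (fscale E x c u)"
    then obtain w where w: "w \<in> W x" and y: "y = fadd E x (fscale E x c u) w" by (auto simp: coset_def)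
    have "u \<in> coset E W x u" using zero[OF u] z by (force simp: coset_def)
    then show "y \<in> {fadd E x (fscale E x c a) w |a w. a \<in> coset E W x u \<and> w \<in> W x}"
      using w y by blast
  qed
qed

text \<open>Fibrewise this is the first isomorphism theorem for \<open>G\<close>. For smoothness, a
  trivialisation of \<open>F\<close> composed with the induced map is a trivialisation of the
  quotient, and all trivialisations of the quotient are smoothly related. Smoothness of the induced
  map, of its inverse and of the transitions of \<open>F\<close> are then instances of that one
  relation.\<close>

theorem quotient_bundle_isomorphism:
  assumes X: "smooth_manifold X" and E: "topological_bundle X E" and F: "topological_bundle X F"
    and W: "\<And>x. x \<in> points X \<Longrightarrow> W x \<subseteq> fibre E x" "\<And>x. x \<in> points X \<Longrightarrow> W x \<noteq> {}"
      "\<And>x u v. x \<in> points X \<Longrightarrow> u \<in> W x \<Longrightarrow> v \<in> W x \<Longrightarrow> fadd E x u v \<in> W x"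
      "\<And>x a v. x \<in> points X \<Longrightarrow> v \<in> W x \<Longrightarrow> fscale E x a v \<in> W x"
    and rank: "vb_rank F = vb_rank E - r"
    and add: "\<And>x u v. x \<in> points X \<Longrightarrow> u \<in> fibre E x \<Longrightarrow> v \<in> fibre E x \<Longrightarrow>
        G x (fadd E x u v) = fadd F x (G x u) (G x v)"
    and scale: "\<And>x a v. x \<in> points X \<Longrightarrow> v \<in> fibre E x \<Longrightarrow> G x (fscale E x a v) = fscale F x a (G x v)"
    and surj: "\<And>x. x \<in> points X \<Longrightarrow> G x ` fibre E x = fibre F x"
    and ker: "\<And>x u v. x \<in> points X \<Longrightarrow> u \<in> fibre E x \<Longrightarrow> v \<in> fibre E x \<Longrightarrow>
        G x u = G x v \<longleftrightarrow> coset E W x u = coset E W x v"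
    and smooth: "\<And>V \<sigma> U \<tau> w i. (V, \<sigma>) \<in> trivs E \<Longrightarrow> (U, \<tau>) \<in> trivs F \<Longrightarrow> w \<in> Rn (vb_rank E) \<Longrightarrow>
        smooth_function_on X (U \<inter> V) (\<lambda>x. \<tau> x (G x (inv_into (fibre E x) (\<sigma> x) w)) i)"
  shows "\<exists>\<Phi>. vb_isomorphism X (quotient_bundle X E r W) F \<Phi> \<and>
    (\<forall>x\<in>points X. \<forall>v\<in>fibre E x. \<Phi> x (coset E W x v) = G x v)"
proof -
  define Q where "Q = quotient_bundle X E r W"
  \<comment> \<open>A representative of the coset is selected; by \<open>ker\<close> the value of
    \<open>G\<close> does not depend on it.\<close>
  define \<Phi> where "\<Phi> x A = G x (SOME v. v \<in> fibre E x \<and> coset E W x v = A)" for x A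
  have \<Phi>: "\<Phi> x (coset E W x v) = G x v" if "x \<in> points X" "v \<in> fibre E x" for x v
  proof -
    have "\<exists>u. u \<in> fibre E x \<and> coset E W x u = coset E W x v" using that by blast
    from someI_ex[OF this] show ?thesis unfolding \<Phi>_def using ker that by blast
  qed
  have fQ: "fibre Q x = coset E W x ` fibre E x" for x by (simp add: Q_def quotient_bundle_simps)
  have rQ: "vb_rank Q = vb_rank F" by (simp add: Q_def quotient_bundle_simps rank)
  have bij: "bij_betw (\<Phi> x) (fibre Q x) (fibre F x)" if x: "x \<in> points X" for x
    unfolding fQ surj[OF x, symmetric] bij_betw_def inj_on_def image_image
    using \<Phi>[OF x] ker[OF x] by (auto intro!: image_cong)
  have clE: "fadd E x u v \<in> fibre E x" "fscale E x a u \<in> fibre E x"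
    if "x \<in> points X" "u \<in> fibre E x" "v \<in> fibre E x" for x u v a
    using E that by (auto simp: topological_bundle_def closed_fibre_def)
  have aQ: "fadd Q x (coset E W x u) (coset E W x v) = coset E W x (fadd E x u v)"
    and sQ: "fscale Q x a (coset E W x u) = coset E W x (fscale E x a u)"
    if "x \<in> points X" "u \<in> fibre E x" "v \<in> fibre E x" for x u v a
    unfolding Q_def quotient_bundle_simps
    by (rule coset_operations[where W = W and x = x and u = u and v = v, OF E that(1) W[OF that(1)] that(2,3)];
        assumption)+
  have clQ: "closed_fibre Q x" if "x \<in> points X" for x
    unfolding closed_fibre_def fQ using aQ[OF that] sQ[OF that] clE[OF that] by auto
  have \<Phi>add: "\<Phi> x (fadd Q x A B) = fadd F x (\<Phi> x A) (\<Phi> x B)"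
    if "x \<in> points X" "A \<in> fibre Q x" "B \<in> fibre Q x" for x A B
    using that aQ[OF that(1)] \<Phi>[OF that(1)] clE[OF that(1)] add[OF that(1)] by (auto simp: fQ)
  have \<Phi>scale: "\<Phi> x (fscale Q x a A) = fscale F x a (\<Phi> x A)"
    if "x \<in> points X" "A \<in> fibre Q x" for x a A
    using that sQ[OF that(1)] \<Phi>[OF that(1)] clE[OF that(1)] scale[OF that(1)] by (auto simp: fQ)
  have UX: "x \<in> points X" if "local_triv X N U \<tau>" "x \<in> U" for N :: "('a, 'z) vbundle" and U \<tau> x
    using that openin_subset unfolding local_triv_def by blast
  have cong: "smooth_function_on X (U \<inter> V) f \<Longrightarrow> smooth_function_on X (U \<inter> V) g"
    if "openin (mtop X) U" "openin (mtop X) V" "\<And>x. x \<in> U \<Longrightarrow> x \<in> V \<Longrightarrow> f x = g x" for U V f g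
    using smooth_function_on_cong[OF X, of "U \<inter> V" f g] that by blast
  have trivQ: "local_triv X Q U \<tau>" "\<And>V \<sigma> w i. (V, \<sigma>) \<in> trivs E \<Longrightarrow> w \<in> Rn (vb_rank E) \<Longrightarrow>
      smooth_function_on X (U \<inter> V) (\<lambda>x. \<tau> x (coset E W x (inv_into (fibre E x) (\<sigma> x) w)) i)"
    if "(U, \<tau>) \<in> trivs Q" for U \<tau>
    using that unfolding Q_def quotient_bundle_trivs by blast+
  \<comment> \<open>Smoothness of the entries of \<open>G\<close> in local frames is exactly the
    requirement that the projection be smooth in the composed trivialisation.\<close>
  have \<Phi>triv: "(U, \<lambda>x A. \<tau> x (\<Phi> x A)) \<in> trivs Q" if U: "(U, \<tau>) \<in> trivs F" for U \<tau>
  proof -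
    have t: "local_triv X F U \<tau>" using F U by (auto simp: topological_bundle_def)
    have "bij_betw (\<lambda>A. \<tau> x (\<Phi> x A)) (fibre Q x) (Rn (vb_rank Q))" if "x \<in> U" for x
      using bij_betw_trans[OF bij[OF UX[OF t that]] local_triv_bij[OF t that]] by (simp add: rQ o_def)
    moreover have "\<tau> x (\<Phi> x (fadd Q x A B)) i = \<tau> x (\<Phi> x A) i + \<tau> x (\<Phi> x B) i"
      if "x \<in> U" "A \<in> fibre Q x" "B \<in> fibre Q x" for x A B i
      using \<Phi>add[OF UX[OF t that(1)] that(2,3)] local_triv_add[OF t that(1)] bij_betwE[OF bij[OF UX[OF t that(1)]]] that
      by simp
    moreover have "\<tau> x (\<Phi> x (fscale Q x a A)) i = a * \<tau> x (\<Phi> x A) i"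
      if "x \<in> U" "A \<in> fibre Q x" for x a A i
      using \<Phi>scale[OF UX[OF t that(1)] that(2)] local_triv_scale[OF t that(1)] bij_betwE[OF bij[OF UX[OF t that(1)]]] that
      by simp
    moreover have "openin (mtop X) U" using t by (simp add: local_triv_def)
    ultimately have "local_triv X Q U (\<lambda>x A. \<tau> x (\<Phi> x A))"
      unfolding local_triv_def by blast
    moreover have "smooth_function_on X (U \<inter> V) (\<lambda>x. \<tau> x (\<Phi> x (coset E W x (inv_into (fibre E x) (\<sigma> x) w))) i)"
      if "(V, \<sigma>) \<in> trivs E" "w \<in> Rn (vb_rank E)" for V \<sigma> w i
    proof -
      have s: "local_triv X E V \<sigma>" using E that by (auto simp: topological_bundle_def)
      have op: "openin (mtop X) U" "openin (mtop X) V" using t s by (auto simp: local_triv_def)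
      show ?thesis
      proof (rule cong[OF op _ smooth[OF that(1) U that(2)]])
        fix x assume x: "x \<in> U" "x \<in> V"
        show "\<tau> x (G x (inv_into (fibre E x) (\<sigma> x) w)) i = \<tau> x (\<Phi> x (coset E W x (inv_into (fibre E x) (\<sigma> x) w))) i"
          using \<Phi>[OF UX[OF s x(2)] local_triv_inv(1)[OF s x(2) that(2)]] by simp
      qed
    qed
    ultimately show ?thesis
      unfolding Q_def quotient_bundle_trivs by blast
  qed
  have trans: "smooth_function_on X (U \<inter> U') (\<lambda>x. \<tau>' x (inv_into (fibre Q x) (\<tau> x) w) i)"
    if "(U, \<tau>) \<in> trivs Q" "(U', \<tau>') \<in> trivs Q" "w \<in> Rn (vb_rank Q)" for U \<tau> U' \<tau>' w i
    by (rule smooth_transition_of_projection[OF X E clQ fQ[symmetric] trivQ(1)[OF that(1)] trivQ(1)[OF that(2)]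
          trivQ(2)[OF that(1)] trivQ(2)[OF that(2)] that(3)])
  have Funion: "\<Union> (fst ` trivs F) = points X" using F by (simp add: topological_bundle_def)
  have "topological_bundle X Q"
    unfolding topological_bundle_def
  proof (intro conjI equalityI subsetI)
    show "\<forall>x\<in>points X. closed_fibre Q x" using clQ by blast
    show "\<forall>(U, \<tau>)\<in>trivs Q. local_triv X Q U \<tau>" using trivQ(1) by blast
    show "x \<in> points X" if "x \<in> \<Union> (fst ` trivs Q)" for x
      using that UX[OF trivQ(1)] by auto
    show "x \<in> \<Union> (fst ` trivs Q)" if x: "x \<in> points X" for x
    proof -
      obtain U \<tau> where "(U, \<tau>) \<in> trivs F" "local_triv X F U \<tau>" "x \<in> U"
        by (rule topological_bundle_triv[OF F x])
      then show ?thesis using image_eqI[OF _ \<Phi>triv, of U fst U \<tau>] by auto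
    qed
  qed
  then have vbQ: "vector_bundle X Q"
    unfolding vector_bundle_iff using trans by blast
  define \<Psi> where "\<Psi> x = inv_into (fibre Q x) (\<Phi> x)" for x
  have \<Psi>: "\<Psi> x (\<Phi> x A) = A" if "x \<in> points X" "A \<in> fibre Q x" for x A
    unfolding \<Psi>_def using bij_betw_inv_into_left[OF bij] that by blast
  have \<Psi>': "\<Phi> x (\<Psi> x v) = v" "\<Psi> x v \<in> fibre Q x" if "x \<in> points X" "v \<in> fibre F x" for x v
    unfolding \<Psi>_def using bij_betw_inv_into_right[OF bij] inv_into_into[of v "\<Phi> x" "fibre Q x"]
      bij_betw_imp_surj_on[OF bij] that by blast+
  \<comment> \<open>The frame of a composed trivialisation is the \<Psi>-image of the frame of
    \<tau>; this turns transition functions of the quotient into statements about \<open>F\<close>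
    and \<Psi>.\<close>
  have inv: "inv_into (fibre Q x) (\<lambda>A. \<tau> x (\<Phi> x A)) w = \<Psi> x (inv_into (fibre F x) (\<tau> x) w)"
    if "(U, \<tau>) \<in> trivs F" "x \<in> U" "w \<in> Rn (vb_rank F)" for U \<tau> x w
  proof -
    have t: "local_triv X F U \<tau>" using F that by (auto simp: topological_bundle_def)
    have q: "local_triv X Q U (\<lambda>x A. \<tau> x (\<Phi> x A))" using trivQ(1)[OF \<Phi>triv[OF that(1)]] .
    note v = local_triv_inv(1,2)[OF t that(2,3)]
    show ?thesis
      by (rule local_triv_inv_eqI[OF q that(2)]) (use \<Psi>'[OF UX[OF t that(2)] v(1)] v(2) in simp_all)
  qed
  have opF: "openin (mtop X) U" if "(U, \<tau>) \<in> trivs F" for U \<tau>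
    using F that by (auto simp: topological_bundle_def local_triv_def)
  have opQ: "openin (mtop X) U" if "(U, \<tau>) \<in> trivs Q" for U \<tau>
    using trivQ(1)[OF that] by (simp add: local_triv_def)
  \<comment> \<open>Between two composed trivialisations \<Phi> and \<Psi> cancel, so the transition
    of the quotient is the transition of \<open>F\<close>.\<close>
  have "smooth_function_on X (U \<inter> V) (\<lambda>x. \<sigma> x (inv_into (fibre F x) (\<tau> x) w) i)"
    if U: "(U, \<tau>) \<in> trivs F" and V: "(V, \<sigma>) \<in> trivs F" and w: "w \<in> Rn (vb_rank F)" for U \<tau> V \<sigma> w i
  proof (rule cong[OF opF[OF U] opF[OF V] _ trans[OF \<Phi>triv[OF U] \<Phi>triv[OF V] w[folded rQ]]])
    fix x assume x: "x \<in> U" "x \<in> V"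
    have t: "local_triv X F U \<tau>" using F U by (auto simp: topological_bundle_def)
    show "\<sigma> x (\<Phi> x (inv_into (fibre Q x) (\<lambda>A. \<tau> x (\<Phi> x A)) w)) i = \<sigma> x (inv_into (fibre F x) (\<tau> x) w) i"
      unfolding inv[OF U x(1) w] using \<Psi>'(1)[OF UX[OF t x(1)] local_triv_inv(1)[OF t x(1) w]] by simp
  qed
  then have vbF: "vector_bundle X F"
    unfolding vector_bundle_iff using F by blast
  have "vb_hom X Q F \<Phi>"
    unfolding vb_hom_def
    using trans[OF _ \<Phi>triv] \<Phi>add \<Phi>scale bij_betwE[OF bij] by blast
  moreover have "vb_hom X F Q \<Psi>"
    unfolding vb_hom_def
  proof (intro conjI ballI allI)
    fix x assume x: "x \<in> points X"
    have clF: "closed_fibre F x" using F x by (simp add: topological_bundle_def)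
    show "\<Psi> x v \<in> fibre Q x" if "v \<in> fibre F x" for v using \<Psi>'(2)[OF x that] .
    show "\<Psi> x (fadd F x u v) = fadd Q x (\<Psi> x u) (\<Psi> x v)" if "u \<in> fibre F x" "v \<in> fibre F x" for u v
    proof -
      have "fadd Q x (\<Psi> x u) (\<Psi> x v) \<in> fibre Q x"
        using clQ[OF x] \<Psi>'(2)[OF x] that by (simp add: closed_fibre_def)
      from \<Psi>[OF x this] show ?thesis
        using \<Phi>add[OF x \<Psi>'(2)[OF x that(1)] \<Psi>'(2)[OF x that(2)]] \<Psi>'(1)[OF x] that by simp
    qed
    show "\<Psi> x (fscale F x a v) = fscale Q x a (\<Psi> x v)" if "v \<in> fibre F x" for a v
    proof -
      have "fscale Q x a (\<Psi> x v) \<in> fibre Q x"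
        using clQ[OF x] \<Psi>'(2)[OF x] that by (simp add: closed_fibre_def)
      from \<Psi>[OF x this] show ?thesis
        using \<Phi>scale[OF x \<Psi>'(2)[OF x that]] \<Psi>'(1)[OF x] that by simp
    qed
  next
    \<comment> \<open>Seen from the composed trivialisation, the local expression of \<Psi> is
      itself a transition function of the quotient.\<close>
    have "smooth_function_on X (U \<inter> V) (\<lambda>x. \<sigma> x (\<Psi> x (inv_into (fibre F x) (\<tau> x) w)) i)"
      if U: "(U, \<tau>) \<in> trivs F" and V: "(V, \<sigma>) \<in> trivs Q" and w: "w \<in> Rn (vb_rank F)" for U \<tau> V \<sigma> w i
      by (rule cong[OF opF[OF U] opQ[OF V] _ trans[OF \<Phi>triv[OF U] V w[folded rQ]]])
        (simp add: inv[OF U _ w])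
    then show "case a of (U, \<tau>) \<Rightarrow> \<forall>(V, \<sigma>)\<in>trivs Q. \<forall>w\<in>Rn (vb_rank F). \<forall>i.
        smooth_function_on X (U \<inter> V) (\<lambda>x. \<sigma> x (\<Psi> x (inv_into (fibre F x) (\<tau> x) w)) i)"
      if "a \<in> trivs F" for a using that by blast
  qed
  ultimately have "vb_isomorphism X Q F \<Phi>"
    unfolding vb_isomorphism_def using vbQ vbF \<Psi> \<Psi>'(1) by blast
  then show ?thesis using \<Phi> unfolding Q_def by blast
qed

section \<open>The tangent bundle\<close>

text \<open>Trivialisations of a tangent bundle are indexed by a chart and linear coordinates on the
  model space; at least one such coordinate system must exist for them to cover the
  manifold.\<close>

lemma linear_coordinates_exist:
  assumes "\<exists>B::'a::real_normed_vector set. finite B \<and> span B = UNIV"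
  shows "\<exists>L. bij_betw L UNIV (Rn (dim (UNIV :: 'a::real_normed_vector set))) \<and>
    (\<forall>u v i. L (u + v) i = L u i + L v i) \<and> (\<forall>a u i. L (a *\<^sub>R u :: 'a) i = a * L u i)"
proof -
  obtain B :: "'a set" and c :: "'a \<Rightarrow> 'a \<Rightarrow> real" where B: "finite B" "independent B" "span B = UNIV"
      "card B = dim (UNIV :: 'a set)"
    and lin: "\<And>b. b \<in> B \<Longrightarrow> bounded_linear (c b)" and c: "\<And>x. x = (\<Sum>b\<in>B. c b x *\<^sub>R b)"
    and cb: "\<And>b b'. b' \<in> B \<Longrightarrow> c b b' = (if b = b' then 1 else 0)"
    by (rule finite_dim_coordinates[OF assms]) (rule that; assumption)
  define k where "k = dim (UNIV :: 'a set)"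
  obtain e where e: "bij_betw e {..<k} B"
    using ex_bij_betw_nat_finite[OF B(1)] B(4) by (auto simp: k_def atLeast0LessThan)
  have eB: "e i \<in> B" if "i < k" for i using bij_betwE[OF e] that by blast
  have sum: "(\<Sum>b\<in>B. g b) = (\<Sum>i<k. g (e i))" for g :: "'a \<Rightarrow> 'a"
    by (rule sum.reindex_bij_betw[OF e, symmetric])
  define L where "L v i = (if i < k then c (e i) v else 0)" for v i
  have "bij_betw L UNIV (Rn k)"
  proof (rule bij_betwI')
    show "(L u = L v) = (u = v)" for u v
    proof
      assume eq: "L u = L v"
      have "c (e i) u = c (e i) v" if "i < k" for i
        using fun_cong[OF eq, of i] that by (simp add: L_def)
      then have "(\<Sum>b\<in>B. c b u *\<^sub>R b) = (\<Sum>b\<in>B. c b v *\<^sub>R b)" by (simp add: sum)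
      then show "u = v" unfolding c[symmetric] .
    qed (hypsubst, rule refl)
    show "L v \<in> Rn k" for v by (simp add: L_def Rn_iff)
    fix w assume w: "w \<in> Rn k"
    have "c (e i) (\<Sum>j<k. w j *\<^sub>R e j) = w i" if i: "i < k" for i
    proof -
      interpret bounded_linear "c (e i)" using lin eB i by blast
      have "c (e i) (\<Sum>j<k. w j *\<^sub>R e j) = (\<Sum>j<k. w j * c (e i) (e j))"
        by (simp add: sum scale)
      also have "\<dots> = (\<Sum>j<k. if j = i then w j else 0)"
      proof (rule sum.cong)
        fix j assume "j \<in> {..<k}"
        then show "w j * c (e i) (e j) = (if j = i then w j else 0)"
          using cb[OF eB, of j "e i"] i inj_onD[OF bij_betw_imp_inj_on[OF e], of i j] by auto
      qed simp
      finally show ?thesis using i by simp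
    qed
    then have "w = L (\<Sum>j<k. w j *\<^sub>R e j)"
      using w by (auto simp: L_def Rn_iff)
    then show "\<exists>v\<in>UNIV. w = L v" by blast
  qed
  moreover have "L (u + v) i = L u i + L v i" "L (a *\<^sub>R u) i = a * L u i" for u v i a
    using bounded_linear.linear[OF lin[OF eB]] by (simp_all add: L_def linear_add linear_scale)
  ultimately show ?thesis unfolding k_def by (intro exI[of _ L]) simp
qed

lemma tangent_component_bij:
  assumes "smooth_manifold M" "c \<in> charts_at M x"
  shows "bij_betw (\<lambda>v. v c) (tangent_space M x) UNIV"
  by (rule bij_betw_byWitness[where f' = "\<lambda>u. coord_vec M c u x"])
    (auto simp: coord_vec_component[OF assms(2)] coord_vec_apply[OF assms] coord_vec_in_tangent_space[OF assms])

lemma topological_bundle_tangent: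
  fixes M :: "('p, 'e::real_normed_vector) manifold"
  assumes M: "smooth_manifold M"
  shows "topological_bundle M (tangent_bundle M)"
proof -
  have "local_triv M (tangent_bundle M) (fst c) (\<lambda>x v. L (v c))"
    if c: "c \<in> atlas M" and L: "bij_betw L UNIV (Rn (mdim M))"
      "\<And>a b i. L (a + b) i = L a i + L b i" "\<And>r a i. L (r *\<^sub>R a) i = r * L a i"
    for c :: "('p, 'e) chart" and L
  proof -
    have "bij_betw (\<lambda>v. L (v c)) (tangent_space M x) (Rn (mdim M))" if "x \<in> fst c" for x
      using bij_betw_trans[OF tangent_component_bij[OF M, of c x] L(1)] c that
      by (simp add: charts_at_def o_def)
    then show ?thesis
      using L chart_open[OF M c] by (simp add: local_triv_def tangent_bundle_def tadd_def tscale_def)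
  qed
  then have triv: "local_triv M (tangent_bundle M) U \<tau>" if "(U, \<tau>) \<in> trivs (tangent_bundle M)" for U \<tau>
    using that by (auto simp: tangent_bundle_def)
  obtain L :: "'e \<Rightarrow> nat \<Rightarrow> real" where L: "bij_betw L UNIV (Rn (mdim M))"
      "\<forall>a b i. L (a + b) i = L a i + L b i" "\<forall>r a i. L (r *\<^sub>R a) i = r * L a i"
    using linear_coordinates_exist[OF smooth_manifold_finite_dim[OF M]] unfolding mdim_def by blast
  have "\<Union> (fst ` trivs (tangent_bundle M)) = points M"
  proof (intro equalityI subsetI)
    fix x assume "x \<in> points M"
    then obtain c where "c \<in> charts_at M x" by (rule charts_at_nonempty[OF M])
    then have c: "c \<in> atlas M" "x \<in> fst c" by (auto simp: charts_at_def)
    then have "(fst c, \<lambda>x v. L (v c)) \<in> trivs (tangent_bundle M)"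
      unfolding tangent_bundle_def vbundle.simps mem_Collect_eq using L by (intro exI[of _ c] exI[of _ L]) simp
    then have "fst c \<in> fst ` trivs (tangent_bundle M)" by (rule image_eqI[rotated]) simp
    then show "x \<in> \<Union> (fst ` trivs (tangent_bundle M))" using c(2) by (rule UnionI)
  next
    fix x assume "x \<in> \<Union> (fst ` trivs (tangent_bundle M))"
    then obtain U \<tau> where U: "(U, \<tau>) \<in> trivs (tangent_bundle M)" "x \<in> U" by auto
    then have "openin (mtop M) U" using triv by (simp add: local_triv_def)
    then show "x \<in> points M" using U(2) openin_subset by blast
  qed
  moreover have "closed_fibre (tangent_bundle M) x" for x
    by (simp add: closed_fibre_def tangent_bundle_def tangent_space_closed[OF M])
  ultimately show ?thesis
    unfolding topological_bundle_def using triv by blast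
qed

text \<open>A section that is constant in a tangent trivialisation is a coordinate vector field, the
  kind of field by which smoothness of forms is defined.\<close>

lemma inv_into_tangent_triv:
  assumes "smooth_manifold M" "c \<in> charts_at M x" "bij_betw L UNIV (Rn k)" "w \<in> Rn k"
  shows "inv_into (tangent_space M x) (\<lambda>v. L (v c)) w = coord_vec M c (inv_into UNIV L w) x"
proof (rule inv_into_f_eq)
  show "inj_on (\<lambda>v. L (v c)) (tangent_space M x)"
    using bij_betw_imp_inj_on[OF bij_betw_trans[OF tangent_component_bij[OF assms(1,2)] assms(3)]]
    by (simp add: o_def)
  show "coord_vec M c (inv_into UNIV L w) x \<in> tangent_space M x"
    by (rule coord_vec_in_tangent_space[OF assms(1,2)])
  show "L (coord_vec M c (inv_into UNIV L w) x c) = w"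
    unfolding coord_vec_apply[OF assms(1,2)] by (rule bij_betw_inv_into_right[OF assms(3,4)])
qed

lemma tangent_bundle_trivs:
  assumes "(U, \<tau>) \<in> trivs (tangent_bundle M)"
  obtains c L where "c \<in> atlas M" "U = fst c" "bij_betw L UNIV (Rn (mdim M))" "\<tau> = (\<lambda>x v. L (v c))"
  using assms unfolding tangent_bundle_def vbundle.simps mem_Collect_eq prod.inject by (elim exE conjE) (rule that)

lemma dual_bundle_trivs:
  assumes "(U, \<tau>) \<in> trivs (dual_bundle E)"
  obtains \<rho> where "(U, \<rho>) \<in> trivs E" "\<tau> = (\<lambda>x \<alpha> i. if i < vb_rank E
      then \<alpha> (inv_into (fibre E x) (\<rho> x) (unit_seq i)) else 0)"
proof -
  have "\<exists>\<rho>. \<tau> = (\<lambda>x \<alpha> i. if i < vb_rank E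
      then \<alpha> (inv_into (fibre E x) (\<rho> x) (unit_seq i)) else 0) \<and> (U, \<rho>) \<in> trivs E"
    using assms by (simp add: dual_bundle_def)
  then show ?thesis using that by (elim exE conjE) simp
qed

section \<open>Lagrangian complements\<close>

text \<open>In the application \<beta> is \<omega> + \<eta> \<otimes> \<eta> in a chart, in general
  neither symmetric nor alternating, so left and right arguments are kept apart. After completing
  \<xi> and a basis of \<open>range D\<close> to a basis, as many vectors remain as
  \<open>range D\<close> has dimensions. A vector annihilating \<open>range D\<close> and \<xi> is
  determined by its pairings with the remaining ones, so these annihilators leave no room beyond
  \<open>range D\<close>.\<close>

lemma lagrangian_linear_algebra:
  fixes D :: "'f::real_normed_vector \<Rightarrow> 'e::real_normed_vector" and \<beta> :: "'e \<Rightarrow> 'e \<Rightarrow> real"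
  assumes fin: "\<exists>B::'e set. finite B \<and> span B = UNIV" "\<exists>B::'f set. finite B \<and> span B = UNIV"
    and dim: "dim (UNIV :: 'e set) = 2 * dim (UNIV :: 'f set) + 1"
    and D: "linear D" "inj D"
    and \<beta>: "\<And>w. linear (\<lambda>v. \<beta> v w)" "\<And>v. linear (\<beta> v)"
    and nondeg: "\<And>v. (\<And>w. \<beta> v w = 0) \<Longrightarrow> v = 0"
    and onto: "\<And>g. linear g \<Longrightarrow> \<exists>v. \<forall>w. \<beta> v w = g w"
    and iso: "\<And>u u'. \<beta> (D u) (D u') = 0" "\<And>u. \<beta> (D u) \<xi> = 0" and \<xi>: "\<xi> \<notin> range D"
  shows "(\<And>u. \<beta> v (D u) = 0) \<Longrightarrow> \<beta> v \<xi> = 0 \<Longrightarrow> v \<in> range D"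
    and "linear \<alpha> \<Longrightarrow> \<exists>v. (\<forall>u. \<beta> v (D u) = \<alpha> u) \<and> \<beta> v \<xi> = b"
proof -
  obtain Be :: "'e set" where Be: "finite Be" "independent Be" "span Be = UNIV" "card Be = dim (UNIV :: 'e set)"
    by (rule finite_dim_coordinates[OF fin(1)]) (rule that; assumption)
  obtain Bf :: "'f set" where Bf: "finite Bf" "independent Bf" "span Bf = UNIV" "card Bf = dim (UNIV :: 'f set)"
    by (rule finite_dim_coordinates[OF fin(2)]) (rule that; assumption)
  define S where "S = D ` Bf"
  have S: "independent S" "finite S" "card S = dim (UNIV :: 'f set)" "span S = range D"
    unfolding S_def
    using linear_independent_injective_image[OF D(1) Bf(2)] D Bf card_image[of D Bf]
    by (auto simp: inj_on_subset linear_span_image)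
  have I: "independent (insert \<xi> S)" "\<xi> \<notin> S"
    using S(1,4) \<xi> span_base[of \<xi> S] by (auto simp: independent_insert)
  obtain T where T: "insert \<xi> S \<subseteq> T" "independent T" "span T = UNIV"
    using maximal_independent_subset_extend[OF subset_UNIV I(1)] by (metis top.extremum_uniqueI)
  have "T \<subseteq> span Be" unfolding Be(3) by (rule subset_UNIV)
  then have finT: "finite T" using independent_span_bound[OF Be(1) T(2)] by blast
  have "span T = span UNIV" unfolding T(3) span_UNIV ..
  then have "card T = dim (UNIV :: 'e set)" by (rule dim_eq_card[OF _ T(2), symmetric])
  then have cardT: "card (T - insert \<xi> S) = dim (UNIV :: 'f set)"
    using card_Diff_subset[OF _ T(1)] S(2,3) I(2) dim by simp
  have \<beta>_left: "\<beta> 0 w = 0" "\<beta> (v + v') w = \<beta> v w + \<beta> v' w" "\<beta> (a *\<^sub>R v) w = a * \<beta> v w" for v v' w a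
    using linear_0[OF \<beta>(1)[of w]] linear_add[OF \<beta>(1)[of w]] linear_scale[OF \<beta>(1)[of w]] by simp_all
  show "v \<in> range D" if v: "\<And>u. \<beta> v (D u) = 0" "\<beta> v \<xi> = 0"
  proof (rule ccontr)
    assume "v \<notin> range D"
    \<comment> \<open>Outside \<open>range D\<close>, the vector \<open>v\<close> would raise the
      number of independent annihilating vectors to one more than the number of remaining basis
      vectors.\<close>
    then have vS: "independent (insert v S)" "v \<notin> S"
      using S(1,4) span_base[of v S] by (auto simp: independent_insert)
    define K where "K = {z. (\<forall>u. \<beta> z (D u) = 0) \<and> \<beta> z \<xi> = 0}"
    have "subspace K"
      unfolding K_def by (intro subspaceI) (simp_all add: \<beta>_left)
    moreover have "insert v S \<subseteq> K" using v iso by (auto simp: K_def S_def)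
    ultimately have K: "span (insert v S) \<subseteq> K" by (rule span_minimal[rotated])
    \<comment> \<open>Pairings with the remaining basis vectors are recorded as coefficients of
      those same vectors, so the dimension count becomes a comparison of independent sets.
      Injectivity on \<open>K\<close> is nondegeneracy of \<beta>.\<close>
    define \<phi> where "\<phi> z = (\<Sum>t\<in>T - insert \<xi> S. \<beta> z t *\<^sub>R t)" for z
    have lin: "linear \<phi>"
      unfolding \<phi>_def
      by (intro linearI)
        (simp_all add: \<beta>_left scaleR_left_distrib sum.distrib scaleR_sum_right)
    have ker: "z = 0" if z: "z \<in> K" "\<phi> z = 0" for z
    proof -
      have "\<beta> z t = 0" if t: "t \<in> T" for t
      proof (cases "t \<in> insert \<xi> S")
        case True
        then show ?thesis using z(1) by (auto simp: K_def S_def)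
      next
        case False
        then show ?thesis
          using independentD[of T "T - insert \<xi> S" "\<beta> z" t] T(2) finT z(2) t by (auto simp: \<phi>_def)
      qed
      then have "\<beta> z w = 0" for w
        using linear_eq_0_on_span[OF \<beta>(2), of T z w] T(3) by simp
      then show "z = 0" by (rule nondeg)
    qed
    have inj: "inj_on \<phi> (span (insert v S))"
    proof (rule inj_onI)
      fix y z assume yz: "y \<in> span (insert v S)" "z \<in> span (insert v S)" "\<phi> y = \<phi> z"
      then have "y - z \<in> K" using subsetD[OF K span_diff] by blast
      moreover have "\<phi> (y - z) = 0" using linear_diff[OF lin] yz(3) by simp
      ultimately show "y = z" using ker[of "y - z"] by simp
    qed
    have "independent (\<phi> ` insert v S)"
      by (rule linear_independent_injective_image[OF lin vS(1) inj])
    moreover have "card (\<phi> ` insert v S) = card (insert v S)"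
      by (rule card_image[OF inj_on_subset[OF inj span_superset]])
    moreover have "\<phi> ` insert v S \<subseteq> span (T - insert \<xi> S)"
      unfolding \<phi>_def by (intro image_subsetI span_sum span_scale span_base)
    ultimately have "card (insert v S) \<le> card (T - insert \<xi> S)"
      using independent_span_bound[of "T - insert \<xi> S" "\<phi> ` insert v S"] finT by simp
    then show False using cardT S(2,3) vS(2) by simp
  qed
  show "\<exists>v. (\<forall>u. \<beta> v (D u) = \<alpha> u) \<and> \<beta> v \<xi> = b" if \<alpha>: "linear \<alpha>"
  proof -
    \<comment> \<open>The values coming from \<alpha> on the images of basis vectors and the value
      \<open>b\<close> at \<xi> can be prescribed together because these vectors are independent;
      \<beta> then represents the extended functional.\<close>
    obtain g where g: "linear g" "\<And>y. y \<in> insert \<xi> S \<Longrightarrow> g y = (if y = \<xi> then b else \<alpha> (inv D y))"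
      using linear_independent_extend[OF I(1), of "\<lambda>y. if y = \<xi> then b else \<alpha> (inv D y)"] by blast
    have "(g \<circ> D) u = \<alpha> u" for u
    proof (rule linear_eq_on[of "g \<circ> D" \<alpha> u Bf])
      show "linear (g \<circ> D)" using D(1) g(1) by (rule linear_compose)
      show "(g \<circ> D) y = \<alpha> y" if "y \<in> Bf" for y
        using g(2)[of "D y"] that D(2) \<xi> by (auto simp: S_def inv_f_f)
    qed (use \<alpha> Bf in auto)
    then show ?thesis
      using onto[OF g(1)] g(2)[of \<xi>] by (metis comp_apply insertI1)
  qed
qed

section \<open>Lagrangian-like submanifolds\<close>

locale lagrangian_like_in_cosymplectic =
  fixes n :: nat
    and M :: "('p, 'e::real_normed_vector) manifold"
    and X :: "('p, 'f::real_normed_vector) manifold"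
    and \<omega> :: "('p, 'e) form2" and \<eta> :: "('p, 'e) form1"
    and \<xi> :: "'p \<Rightarrow> ('p, 'e) tvec"
  assumes cosymplectic: "cosymplectic n M \<omega> \<eta>"
    and reeb: "reeb_field M \<omega> \<eta> \<xi>"
    and lagrangian: "lagrangian_like X M \<omega> \<eta>"
begin

lemma manifold_M: "smooth_manifold M" and dim_M: "mdim M = 2 * n + 1"
  and form2: "smooth_2form M \<omega>" and form1: "smooth_1form M \<eta>"
  using cosymplectic by (simp_all add: cosymplectic_def closed_2form_def closed_1form_def)

lemma manifold_X: "smooth_manifold X" and incl_smooth: "smooth_map X M (\<lambda>x. x)"
  using lagrangian by (simp_all add: lagrangian_like_def submanifold_def)

lemma dim_X: "mdim X = n"
proof -
  have "real (mdim X) = real n" using lagrangian dim_M by (simp add: lagrangian_like_def)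
  then show ?thesis by simp
qed

lemma points_X_M: "x \<in> points X \<Longrightarrow> x \<in> points M"
  by (rule smooth_map_id_points[OF incl_smooth])

lemma incl_inj: "x \<in> points X \<Longrightarrow> inj_on (incl_differential X M x) (tangent_space X x)"
  using lagrangian by (simp add: lagrangian_like_def submanifold_def)

lemma \<omega>_incl: "x \<in> points X \<Longrightarrow> u \<in> tangent_space X x \<Longrightarrow> v \<in> tangent_space X x \<Longrightarrow>
    \<omega> x (incl_differential X M x u) (incl_differential X M x v) = 0"
  and \<eta>_incl: "x \<in> points X \<Longrightarrow> u \<in> tangent_space X x \<Longrightarrow> \<eta> x (incl_differential X M x u) = 0"
  using lagrangian by (simp_all add: lagrangian_like_def)

lemma reeb_in: "x \<in> points X \<Longrightarrow> \<xi> x \<in> tangent_space M x"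
  and \<eta>_reeb: "x \<in> points X \<Longrightarrow> \<eta> x (\<xi> x) = 1"
  using reeb points_X_M by (simp_all add: reeb_field_def)

lemma \<omega>_antisym:
  assumes "x \<in> points X" "u \<in> tangent_space M x" "v \<in> tangent_space M x"
  shows "\<omega> x u v = - \<omega> x v u"
  using form2 points_X_M[OF assms(1)] assms(2,3) unfolding smooth_2form_def by blast

lemma \<omega>_reeb: "x \<in> points X \<Longrightarrow> w \<in> tangent_space M x \<Longrightarrow> \<omega> x w (\<xi> x) = 0"
  using \<omega>_antisym[of x w "\<xi> x"] reeb_in[of x] reeb points_X_M[of x] by (simp add: reeb_field_def)

lemma \<omega>_left:
  assumes "x \<in> points X" "u \<in> tangent_space M x" "v \<in> tangent_space M x" "w \<in> tangent_space M x"
  shows "\<omega> x (tadd u v) w = \<omega> x u w + \<omega> x v w" and "\<omega> x (tscale a u) w = a * \<omega> x u w"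
  using form2 points_X_M[OF assms(1)] assms(2-4) unfolding smooth_2form_def by blast+

text \<open>\<open>smooth_2form\<close> states linearity in the first slot; antisymmetry carries it
  to the second.\<close>

lemma \<omega>_right:
  assumes "x \<in> points X" "u \<in> tangent_space M x" "v \<in> tangent_space M x" "w \<in> tangent_space M x"
  shows "\<omega> x w (tadd u v) = \<omega> x w u + \<omega> x w v" and "\<omega> x w (tscale a u) = a * \<omega> x w u"
proof -
  note closed = tangent_space_closed(1)[OF manifold_M assms(2,3)] tangent_space_closed(2)[OF manifold_M assms(2), of a]
  show "\<omega> x w (tadd u v) = \<omega> x w u + \<omega> x w v"
    using \<omega>_left(1)[OF assms] \<omega>_antisym[OF assms(1,4) closed(1)] \<omega>_antisym[OF assms(1,4,2)] \<omega>_antisym[OF assms(1,4,3)]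
    by simp
  show "\<omega> x w (tscale a u) = a * \<omega> x w u"
    using \<omega>_left(2)[OF assms, of a] \<omega>_antisym[OF assms(1,4) closed(2)] \<omega>_antisym[OF assms(1,4,2)]
    by simp
qed

lemma \<eta>_linear:
  assumes "x \<in> points X" "u \<in> tangent_space M x"
  shows "v \<in> tangent_space M x \<Longrightarrow> \<eta> x (tadd u v) = \<eta> x u + \<eta> x v" and "\<eta> x (tscale a u) = a * \<eta> x u"
  using form1 points_X_M[OF assms(1)] assms(2) unfolding smooth_1form_def by blast+

section \<open>The flat map along the submanifold\<close>

abbreviation flat where "flat \<equiv> flat_map M \<omega> \<eta>"

abbreviation incl where "incl \<equiv> incl_differential X M"

lemma incl_in: "x \<in> points X \<Longrightarrow> u \<in> tangent_space X x \<Longrightarrow> incl x u \<in> tangent_space M x"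
  by (rule incl_differential_in_tangent_space[OF manifold_X manifold_M incl_smooth])

lemmas incl_linear = incl_differential_linear[OF manifold_X manifold_M incl_smooth]

lemma flat_left:
  assumes "x \<in> points X" "u \<in> tangent_space M x"
  shows "v \<in> tangent_space M x \<Longrightarrow> flat x (tadd u v) w = flat x u w + flat x v w"
    and "flat x (tscale a u) w = a * flat x u w"
  using assms \<omega>_left[OF assms] \<eta>_linear[OF assms] by (simp_all add: flat_map_def algebra_simps)

lemma flat_right:
  assumes "x \<in> points X" "u \<in> tangent_space M x" "w \<in> tangent_space M x"
  shows "v \<in> tangent_space M x \<Longrightarrow> flat x w (tadd u v) = flat x w u + flat x w v"
    and "flat x w (tscale a u) = a * flat x w u"
  using assms \<omega>_right[OF assms(1,2) _ assms(3)] \<omega>_right(2)[OF assms(1,2,2,3)] \<eta>_linear[OF assms(1,2)]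
  by (simp_all add: flat_map_def algebra_simps tangent_space_closed[OF manifold_M])

lemma flat_incl_incl: "x \<in> points X \<Longrightarrow> u \<in> tangent_space X x \<Longrightarrow> v \<in> tangent_space X x \<Longrightarrow>
    flat x (incl x u) (incl x v) = 0"
  by (simp add: flat_map_def \<omega>_incl \<eta>_incl)

text \<open>\<omega> vanishes against \<xi> and \<eta>(\<xi>) = 1, so only \<eta> survives on the
  Reeb line.\<close>

lemma flat_reeb: "x \<in> points X \<Longrightarrow> w \<in> tangent_space M x \<Longrightarrow> flat x w (\<xi> x) = \<eta> x w"
  by (simp add: flat_map_def \<omega>_reeb \<eta>_reeb reeb_in)

text \<open>Reading both tangent spaces in charts reduces the claim to linear algebra, with
  \<open>D\<close> the Jacobian of the inclusion and \<beta> the flat map. The two parts later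
  supply the kernel and the surjectivity of the map into the target fibre.\<close>

lemma flat_restriction:
  assumes x: "x \<in> points X"
  shows "\<And>v. v \<in> tangent_space M x \<Longrightarrow> (\<And>u. u \<in> tangent_space X x \<Longrightarrow> flat x v (incl x u) = 0) \<Longrightarrow>
      flat x v (\<xi> x) = 0 \<Longrightarrow> v \<in> tangent_subspace X M x"
    and "\<And>\<alpha> b. (\<And>u v. u \<in> tangent_space X x \<Longrightarrow> v \<in> tangent_space X x \<Longrightarrow> \<alpha> (tadd u v) = \<alpha> u + \<alpha> v) \<Longrightarrow>
      (\<And>a u. u \<in> tangent_space X x \<Longrightarrow> \<alpha> (tscale a u) = a * \<alpha> u) \<Longrightarrow>
      \<exists>v\<in>tangent_space M x. (\<forall>u\<in>tangent_space X x. flat x v (incl x u) = \<alpha> u) \<and> flat x v (\<xi> x) = b"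
proof -
  obtain c where c: "c \<in> charts_at M x" using charts_at_nonempty[OF manifold_M points_X_M[OF x]] .
  obtain d where d: "d \<in> charts_at X x" using charts_at_nonempty[OF manifold_X x] .
  define D where "D = chart_jacobian x d c"
  have linD: "linear D" unfolding D_def by (rule linear_chart_jacobian[OF incl_smooth d c])
  let ?C = "\<lambda>u. coord_vec M c u x" and ?K = "\<lambda>u. coord_vec X d u x"
  note C = coord_vec_in_tangent_space[OF manifold_M c] coord_vec_linear[OF manifold_M c]
    coord_vec_apply[OF manifold_M c] coord_vec_component[OF c]
  note K = coord_vec_in_tangent_space[OF manifold_X d] coord_vec_linear[OF manifold_X d]
    coord_vec_apply[OF manifold_X d] coord_vec_component[OF d]
  have incl_K: "incl x (?K u) = ?C (D u)" for u
    using incl_differential_eq_coord_vec[OF manifold_X manifold_M incl_smooth d c K(1)] K(4) by (simp add: D_def)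
  define \<beta> where "\<beta> u w = flat x (?C u) (?C w)" for u w
  have \<beta>: "linear (\<lambda>u. \<beta> u w)" "linear (\<beta> u)" for u w
    by (intro linearI; simp add: \<beta>_def C flat_left[OF x] flat_right[OF x])+
  have bij: "bij_betw (flat x) (tangent_space M x) (fibre (cotangent_bundle M) x)"
    using cosymplectic points_X_M[OF x] by (simp add: cosymplectic_def)
  have nondeg: "u = 0" if "\<And>w. \<beta> u w = 0" for u
  proof -
    \<comment> \<open>Injectivity of the flat map compares two tangent vectors, so \<open>u\<close>
      is tested against the vector with component 0; off the tangent space both covectors are 0 by
      convention.\<close>
    have "flat x (?C u) v = flat x (?C 0) v" for v
    proof (cases "v \<in> tangent_space M x")
      case True
      then have v: "v = ?C (v c)" by (simp add: C)
      show ?thesis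
        by (subst (1 2) v) (use that[of "v c"] linear_0[OF \<beta>(1)] in \<open>simp add: \<beta>_def\<close>)
    qed (simp add: flat_map_def)
    then have "?C u = ?C 0"
      using inj_onD[OF bij_betw_imp_inj_on[OF bij], of "?C u" "?C 0"] C(1) by blast
    then show "u = 0" using C(4) by metis
  qed
  have onto: "\<exists>u. \<forall>w. \<beta> u w = g w" if g: "linear g" for g
  proof -
    define \<alpha> where "\<alpha> v = (if v \<in> tangent_space M x then g (v c) else 0)" for v
    have "\<alpha> \<in> fibre (cotangent_bundle M) x"
      using linear_add[OF g] linear_scale[OF g] tangent_space_closed[OF manifold_M, of _ x]
      by (simp add: \<alpha>_def cotangent_bundle_def dual_bundle_def tangent_bundle_def)
        (simp add: tadd_def tscale_def)
    then obtain v where v: "v \<in> tangent_space M x" "flat x v = \<alpha>"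
      using bij_betw_imp_surj_on[OF bij] by (metis imageE)
    have "\<beta> (v c) w = g w" for w
      using C(1,4) C(5)[OF v(1)] v(2) by (simp add: \<beta>_def \<alpha>_def)
    then show ?thesis by blast
  qed
  have inj: "inj D"
  proof (rule injI)
    fix u v assume "D u = D v"
    then have "incl x (?K u) = incl x (?K v)" by (simp add: incl_K)
    then have "?K u = ?K v" using inj_onD[OF incl_inj[OF x]] K(1) by blast
    then show "u = v" using K(4) by metis
  qed
  define z where "z = \<xi> x c"
  have z: "?C z = \<xi> x" unfolding z_def by (rule C(5)[OF reeb_in[OF x]])
  have iso: "\<beta> (D u) (D u') = 0" "\<beta> (D u) z = 0" for u u'
    by (simp_all add: \<beta>_def z incl_K[symmetric] flat_incl_incl[OF x] flat_reeb[OF x] incl_in[OF x] \<eta>_incl[OF x] K(1))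
  \<comment> \<open>The Reeb vector is not tangent to \<open>X\<close>: \<eta> is 1 on it and 0 on
    vectors tangent to \<open>X\<close>.\<close>
  have notin: "z \<notin> range D"
  proof
    assume "z \<in> range D"
    then obtain u where "z = D u" by blast
    then have "\<xi> x = incl x (?K u)" by (simp add: incl_K z[symmetric])
    then show False using \<eta>_incl[OF x K(1), of u] \<eta>_reeb[OF x] by simp
  qed
  have dims: "dim (UNIV :: 'e set) = 2 * dim (UNIV :: 'f set) + 1"
    using dim_M dim_X by (simp add: mdim_def)
  note algebra = lagrangian_linear_algebra[OF smooth_manifold_finite_dim[OF manifold_M]
      smooth_manifold_finite_dim[OF manifold_X] dims linD inj \<beta> nondeg onto iso notin]
  show "v \<in> tangent_subspace X M x" if v: "v \<in> tangent_space M x"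
    "\<And>u. u \<in> tangent_space X x \<Longrightarrow> flat x v (incl x u) = 0" "flat x v (\<xi> x) = 0" for v
  proof -
    have "v c \<in> range D"
    proof (rule algebra(1))
      show "\<beta> (v c) (D u) = 0" for u
        using v(2)[OF K(1), of u] by (simp add: \<beta>_def C(5)[OF v(1)] incl_K)
      show "\<beta> (v c) z = 0" using v(3) by (simp add: \<beta>_def C(5)[OF v(1)] z)
    qed
    then obtain u where "v c = D u" by blast
    then have "v = incl x (?K u)" using C(5)[OF v(1)] by (simp add: incl_K)
    then show ?thesis using K(1) by (auto simp: tangent_subspace_def)
  qed
  show "\<exists>v\<in>tangent_space M x. (\<forall>u\<in>tangent_space X x. flat x v (incl x u) = \<alpha> u) \<and> flat x v (\<xi> x) = b"
    if \<alpha>: "\<And>u v. u \<in> tangent_space X x \<Longrightarrow> v \<in> tangent_space X x \<Longrightarrow> \<alpha> (tadd u v) = \<alpha> u + \<alpha> v"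
      "\<And>a u. u \<in> tangent_space X x \<Longrightarrow> \<alpha> (tscale a u) = a * \<alpha> u" for \<alpha> b
  proof -
    have "linear (\<lambda>u. \<alpha> (?K u))" by (rule linearI) (simp_all add: K \<alpha>)
    then obtain v where v: "\<And>u. \<beta> v (D u) = \<alpha> (?K u)" "\<beta> v z = b"
      using algebra(2)[of "\<lambda>u. \<alpha> (?K u)" b] by blast
    have "flat x (?C v) (incl x u) = \<alpha> u" if "u \<in> tangent_space X x" for u
      using v(1)[of "u d"] K(5)[OF that] incl_K[of "u d"] by (simp add: \<beta>_def)
    then show ?thesis using C(1)[of v] v(2) z by (auto simp: \<beta>_def)
  qed
qed

section \<open>Smoothness of the flat map on coordinate fields\<close>

lemma smooth_\<eta>_coord_vec:
  assumes c: "c \<in> atlas M"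
  shows "smooth_function_on X (points X \<inter> fst c) (\<lambda>x. \<eta> x (coord_vec M c a x))"
  using form1 c by (intro smooth_function_on_submanifold[OF manifold_X manifold_M incl_smooth chart_open[OF manifold_M c]])
    (simp add: smooth_1form_def)

lemma smooth_\<omega>_coord_vec:
  assumes c: "c \<in> atlas M"
  shows "smooth_function_on X (points X \<inter> fst c) (\<lambda>x. \<omega> x (coord_vec M c a x) (coord_vec M c b x))"
  using form2 c by (intro smooth_function_on_submanifold[OF manifold_X manifold_M incl_smooth chart_open[OF manifold_M c]])
    (simp add: smooth_2form_def)

text \<open>The \<eta>-term drops out because \<eta> vanishes on vectors tangent to
  \<open>X\<close>. The included field has components \<open>chart_jacobian x d c b\<close> that
  vary with the point, while \<omega> is known to be smooth on fields with constant components; a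
  basis expansion separates the two.\<close>

lemma smooth_flat_incl:
  assumes c: "c \<in> atlas M" and d: "d \<in> atlas X"
  shows "smooth_function_on X (fst d \<inter> (points X \<inter> fst c))
    (\<lambda>x. flat x (coord_vec M c a x) (incl x (coord_vec X d b x)))"
proof -
  let ?W = "fst d \<inter> (points X \<inter> fst c)"
  have W: "openin (mtop X) ?W"
    using chart_open[OF manifold_X d] smooth_map_id_open[OF incl_smooth chart_open[OF manifold_M c]] by (rule openin_Int)
  obtain B :: "'e set" and coef :: "'e \<Rightarrow> 'e \<Rightarrow> real" where B: "finite B"
    "\<And>e. e \<in> B \<Longrightarrow> bounded_linear (coef e)" and coef: "\<And>v. v = (\<Sum>e\<in>B. coef e v *\<^sub>R e)"
    using finite_dim_coordinates[OF smooth_manifold_finite_dim[OF manifold_M]] by metis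
  have "flat x (coord_vec M c a x) (incl x (coord_vec X d b x)) =
      (\<Sum>e\<in>B. coef e (chart_jacobian x d c b) * \<omega> x (coord_vec M c a x) (coord_vec M c e x))" if "x \<in> ?W" for x
  proof -
    have x: "x \<in> points X" and c': "c \<in> charts_at M x" and d': "d \<in> charts_at X x"
      using that c d by (auto simp: charts_at_def)
    note C = coord_vec_in_tangent_space[OF manifold_M c'] coord_vec_linear[OF manifold_M c']
    note K = coord_vec_in_tangent_space[OF manifold_X d', of b]
    have "incl x (coord_vec X d b x) = coord_vec M c (chart_jacobian x d c b) x"
      using incl_differential_eq_coord_vec[OF manifold_X manifold_M incl_smooth d' c' K]
      by (simp add: coord_vec_apply[OF manifold_X d'])
    then have "flat x (coord_vec M c a x) (incl x (coord_vec X d b x)) =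
        \<omega> x (coord_vec M c a x) (coord_vec M c (chart_jacobian x d c b) x)"
      using \<eta>_incl[OF x K] C(1) by (simp add: flat_map_def)
    moreover have lin: "linear (\<lambda>u. \<omega> x (coord_vec M c a x) (coord_vec M c u x))"
      by (rule linearI) (simp_all add: C \<omega>_right[OF x _ C(1) C(1)])
    have "\<omega> x (coord_vec M c a x) (coord_vec M c (\<Sum>e\<in>B. coef e (chart_jacobian x d c b) *\<^sub>R e) x) =
        (\<Sum>e\<in>B. coef e (chart_jacobian x d c b) * \<omega> x (coord_vec M c a x) (coord_vec M c e x))"
      using linear_sum[OF lin, of "\<lambda>e. coef e (chart_jacobian x d c b) *\<^sub>R e" B] linear_scale[OF lin] by simp
    ultimately show ?thesis unfolding coef[symmetric] by simp
  qed
  moreover have "smooth_function_on X ?W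
      (\<lambda>x. \<Sum>e\<in>B. coef e (chart_jacobian x d c b) * \<omega> x (coord_vec M c a x) (coord_vec M c e x))"
  proof (intro smooth_function_on_sum smooth_function_on_mult manifold_X W)
    fix e assume e: "e \<in> B"
    show "smooth_function_on X ?W (\<lambda>x. \<omega> x (coord_vec M c a x) (coord_vec M c e x))"
      by (rule smooth_function_on_subset[OF smooth_\<omega>_coord_vec[OF c]]) auto
    have op: "open (snd d ` ?W)"
      using chart_image_open[OF manifold_X d W] by (simp add: Int_assoc[symmetric])
    have "smooth_on (snd c \<circ> chart_inv d) (snd d ` ?W)"
      by (rule smooth_on_subset[OF smooth_map_id_chart[OF incl_smooth d c]]) auto
    then have "smooth_on (\<lambda>y. coef e (frechet_derivative (snd c \<circ> chart_inv d) (at y) b)) (snd d ` ?W)"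
      by (intro smooth_on_bounded_linear[OF op B(2)[OF e]] smooth_on_derivative)
    then have "smooth_on ((\<lambda>x. coef e (chart_jacobian x d c b)) \<circ> chart_inv d) (snd d ` ?W)"
      by (rule smooth_on_cong[OF op, THEN iffD1, rotated])
        (use d manifold_X in \<open>auto simp: chart_jacobian_def\<close>)
    \<comment> \<open>The single chart \<open>d\<close> suffices here, with \<open>X\<close>
      regarded as included in itself.\<close>
    then show "smooth_function_on X ?W (\<lambda>x. coef e (chart_jacobian x d c b))"
      by (intro smooth_function_on_pullback_chart[OF manifold_X manifold_X smooth_map_id[OF manifold_X] d W _ op]) auto
  qed
  ultimately show ?thesis
    using smooth_function_on_cong[OF manifold_X W, of
        "\<lambda>x. flat x (coord_vec M c a x) (incl x (coord_vec X d b x))"] by simp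
qed

section \<open>The bundles involved and the fibre map between them\<close>

lemma bundle_TM: "topological_bundle X (restricted_tangent_bundle X M)"
  by (rule topological_bundle_pullback[OF topological_bundle_tangent[OF manifold_M]])
    (use incl_smooth in \<open>simp add: smooth_map_def\<close>)

lemma TM_simps:
  "fibre (restricted_tangent_bundle X M) x = tangent_space M x" "fadd (restricted_tangent_bundle X M) x = tadd"
  "fscale (restricted_tangent_bundle X M) x = tscale" "vb_rank (restricted_tangent_bundle X M) = mdim M"
  by (simp_all add: pullback_bundle_def tangent_bundle_def)

text \<open>\<eta> recovers the scalar, since \<eta>(a \<xi>) = a.\<close>

lemma reeb_scale_inj: "x \<in> points X \<Longrightarrow> inj (\<lambda>a. tscale a (\<xi> x))"
  using \<eta>_linear(2)[of x "\<xi> x"] \<eta>_reeb[of x] reeb_in[of x] by (intro injI) (metis mult_1_right)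

lemma bundle_line: "topological_bundle X (reeb_line_bundle X M \<xi>)"
  unfolding reeb_line_bundle_def
  by (rule topological_bundle_line[OF bundle_TM]) (simp_all add: TM_simps reeb_in reeb_scale_inj)

lemma bundle_target:
  "topological_bundle X (whitney_sum (cotangent_bundle X) (dual_bundle (reeb_line_bundle X M \<xi>)))"
  unfolding cotangent_bundle_def
  by (intro topological_bundle_whitney_sum topological_bundle_dual topological_bundle_tangent manifold_X bundle_line)

abbreviation E where "E \<equiv> restricted_tangent_bundle X M"

abbreviation F where "F \<equiv> whitney_sum (cotangent_bundle X) (dual_bundle (reeb_line_bundle X M \<xi>))"

definition G where "G x v = covector_restriction X M \<xi> x (flat x v)"

lemma line_fibre: "fibre (reeb_line_bundle X M \<xi>) x = range (\<lambda>a. tscale a (\<xi> x))"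
  by (simp add: reeb_line_bundle_def line_bundle_def TM_simps)

lemma reeb_in_line: "\<xi> x \<in> fibre (reeb_line_bundle X M \<xi>) x"
  unfolding line_fibre by (rule range_eqI[of _ _ 1]) (simp add: tscale_def)

lemma line_in: "x \<in> points X \<Longrightarrow> z \<in> fibre (reeb_line_bundle X M \<xi>) x \<Longrightarrow> z \<in> tangent_space M x"
  using reeb_in tangent_space_closed(2)[OF manifold_M] by (auto simp: line_fibre)

lemma flat_line: "x \<in> points X \<Longrightarrow> v \<in> tangent_space M x \<Longrightarrow> flat x v (tscale a (\<xi> x)) = a * flat x v (\<xi> x)"
  using flat_right(2)[OF _ reeb_in] by blast

lemma G_apply:
  "fst (G x v) u = (if u \<in> tangent_space X x then flat x v (incl x u) else 0)"
  "snd (G x v) z = (if z \<in> fibre (reeb_line_bundle X M \<xi>) x then flat x v z else 0)"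
  by (simp_all add: G_def covector_restriction_def)

text \<open>A functional on the Reeb line is fixed by its value at \<xi>, so one number decides the
  second component.\<close>

lemma G_eqI:
  assumes x: "x \<in> points X" and v: "v \<in> tangent_space M x" "w \<in> tangent_space M x"
    and eq: "\<And>u. u \<in> tangent_space X x \<Longrightarrow> flat x v (incl x u) = flat x w (incl x u)" "flat x v (\<xi> x) = flat x w (\<xi> x)"
  shows "G x v = G x w"
proof (intro prod_eqI ext)
  show "fst (G x v) u = fst (G x w) u" for u by (simp add: G_apply eq)
  show "snd (G x v) z = snd (G x w) z" for z
    using eq(2) by (auto simp: G_apply line_fibre flat_line[OF x v(1)] flat_line[OF x v(2)])
qed

lemma target_simps:
  "vb_rank F = n + 1"
  "fadd F x p q = (\<lambda>u. fst p u + fst q u, \<lambda>z. snd p z + snd q z)"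
  "fscale F x a p = (\<lambda>u. a * fst p u, \<lambda>z. a * snd p z)"
  by (simp_all add: whitney_sum_def cotangent_bundle_def dual_bundle_def tangent_bundle_def reeb_line_bundle_def
      line_bundle_def dim_X)

lemma target_fibre:
  "p \<in> fibre F x \<longleftrightarrow>
     (\<forall>u\<in>tangent_space X x. \<forall>v\<in>tangent_space X x. fst p (tadd u v) = fst p u + fst p v) \<and>
     (\<forall>a. \<forall>v\<in>tangent_space X x. fst p (tscale a v) = a * fst p v) \<and>
     (\<forall>v. v \<notin> tangent_space X x \<longrightarrow> fst p v = 0) \<and>
     (\<forall>u\<in>fibre (reeb_line_bundle X M \<xi>) x. \<forall>v\<in>fibre (reeb_line_bundle X M \<xi>) x. snd p (tadd u v) = snd p u + snd p v) \<and>
     (\<forall>a. \<forall>v\<in>fibre (reeb_line_bundle X M \<xi>) x. snd p (tscale a v) = a * snd p v) \<and>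
     (\<forall>v. v \<notin> fibre (reeb_line_bundle X M \<xi>) x \<longrightarrow> snd p v = 0)"
proof -
  have "fadd (reeb_line_bundle X M \<xi>) x = tadd" "fscale (reeb_line_bundle X M \<xi>) x = tscale"
    by (simp_all add: reeb_line_bundle_def line_bundle_def TM_simps)
  then show ?thesis
    by (cases p) (simp add: whitney_sum_def cotangent_bundle_def dual_bundle_def tangent_bundle_def conj_assoc)
qed

lemma G_linear:
  assumes "x \<in> points X" "u \<in> tangent_space M x"
  shows "v \<in> tangent_space M x \<Longrightarrow> G x (tadd u v) = fadd F x (G x u) (G x v)"
    and "G x (tscale a u) = fscale F x a (G x u)"
  unfolding target_simps by (intro prod_eqI ext; simp add: G_apply flat_left[OF assms])+

lemma G_in:
  assumes x: "x \<in> points X" and v: "v \<in> tangent_space M x"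
  shows "G x v \<in> fibre F x"
proof -
  note clX = tangent_space_closed[OF manifold_X]
  have "tadd y z \<in> fibre (reeb_line_bundle X M \<xi>) x" "tscale a y \<in> fibre (reeb_line_bundle X M \<xi>) x"
    if y: "y \<in> fibre (reeb_line_bundle X M \<xi>) x" and z: "z \<in> fibre (reeb_line_bundle X M \<xi>) x" for y z a
  proof -
    obtain b c where "y = tscale b (\<xi> x)" "z = tscale c (\<xi> x)" using y z by (auto simp: line_fibre)
    then have "tadd y z = tscale (b + c) (\<xi> x)" "tscale a y = tscale (a * b) (\<xi> x)"
      by (simp_all add: tadd_def tscale_def scaleR_left_distrib)
    then show "tadd y z \<in> fibre (reeb_line_bundle X M \<xi>) x" "tscale a y \<in> fibre (reeb_line_bundle X M \<xi>) x"
      by (simp_all add: line_fibre)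
  qed
  then show ?thesis
    unfolding target_fibre
    by (simp add: G_apply clX incl_linear[OF x] flat_right[OF x _ v] incl_in[OF x] line_in[OF x])
qed

lemma G_surj:
  assumes x: "x \<in> points X"
  shows "G x ` tangent_space M x = fibre F x"
proof (intro equalityI subsetI)
  fix p assume p: "p \<in> fibre F x"
  then obtain v where v: "v \<in> tangent_space M x" "\<And>u. u \<in> tangent_space X x \<Longrightarrow> flat x v (incl x u) = fst p u"
    "flat x v (\<xi> x) = snd p (\<xi> x)"
    using flat_restriction(2)[OF x, of "fst p" "snd p (\<xi> x)"] unfolding target_fibre by blast
  have "G x v = p"
  proof (intro prod_eqI ext)
    show "fst (G x v) u = fst p u" for u
      using p by (cases "u \<in> tangent_space X x") (simp_all add: G_apply v(2) target_fibre)
    show "snd (G x v) z = snd p z" for z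
    proof (cases "z \<in> fibre (reeb_line_bundle X M \<xi>) x")
      case True
      then obtain a where z: "z = tscale a (\<xi> x)" by (auto simp: line_fibre)
      have "snd p z = a * snd p (\<xi> x)" using p reeb_in_line unfolding z target_fibre by blast
      then show ?thesis using True by (simp add: G_apply z flat_line[OF x v(1)] v(3))
    next
      case False
      then show ?thesis using p unfolding target_fibre by (simp add: G_apply)
    qed
  qed
  with v(1) show "p \<in> G x ` tangent_space M x" by blast
next
  fix p assume "p \<in> G x ` tangent_space M x"
  then show "p \<in> fibre F x" using G_in[OF x] by blast
qed

lemma tangent_subspace_closed:
  assumes x: "x \<in> points X"
  shows "tangent_subspace X M x \<subseteq> tangent_space M x" "tangent_subspace X M x \<noteq> {}"
    "u \<in> tangent_subspace X M x \<Longrightarrow> v \<in> tangent_subspace X M x \<Longrightarrow> tadd u v \<in> tangent_subspace X M x"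
    "v \<in> tangent_subspace X M x \<Longrightarrow> tscale a v \<in> tangent_subspace X M x"
proof -
  show "tangent_subspace X M x \<subseteq> tangent_space M x"
    using incl_in[OF x] by (auto simp: tangent_subspace_def)
  obtain d where d: "d \<in> charts_at X x" using charts_at_nonempty[OF manifold_X x] .
  show "tangent_subspace X M x \<noteq> {}"
    using coord_vec_in_tangent_space[OF manifold_X d] by (auto simp: tangent_subspace_def)
  show "tadd u v \<in> tangent_subspace X M x" if "u \<in> tangent_subspace X M x" "v \<in> tangent_subspace X M x"
    using that unfolding tangent_subspace_def
    by (auto simp: incl_linear(1)[OF x, symmetric] tangent_space_closed[OF manifold_X] intro!: imageI)
  show "tscale a v \<in> tangent_subspace X M x" if "v \<in> tangent_subspace X M x"
    using that unfolding tangent_subspace_def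
    by (auto simp: incl_linear(2)[OF x, symmetric] tangent_space_closed[OF manifold_X] intro!: imageI)
qed

text \<open>Equal images mean that u - v pairs to 0 with vectors tangent to \<open>X\<close> and
  with \<xi>, so it is itself tangent to \<open>X\<close> by the dimension count. Conversely,
  translation by such a vector changes neither component, because \<omega> and \<eta> pull back to
  0.\<close>

lemma G_kernel:
  assumes x: "x \<in> points X" and u: "u \<in> tangent_space M x" and v: "v \<in> tangent_space M x"
  shows "G x u = G x v \<longleftrightarrow> normal_class X M x u = normal_class X M x v"
proof
  note W = tangent_subspace_closed[OF x]
  have coset: "normal_class X M x v = {tadd v w |w. w \<in> tangent_subspace X M x}" for v
    by (simp add: normal_class_def coset_def TM_simps)
  {
    assume eq: "G x u = G x v"
    define w where "w = tadd u (tscale (-1) v)"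
    have w: "w \<in> tangent_space M x"
      unfolding w_def by (intro tangent_space_closed[OF manifold_M] u v)
    have flat_w: "flat x w z = flat x u z - flat x v z" for z
      unfolding w_def using flat_left(1)[OF x u tangent_space_closed(2)[OF manifold_M v]] flat_left(2)[OF x v] by simp
    have "flat x w (incl x y) = 0" if "y \<in> tangent_space X x" for y
      using fun_cong[OF arg_cong[OF eq, of fst], of y] that by (simp add: G_apply flat_w)
    moreover have "flat x w (\<xi> x) = 0"
      using fun_cong[OF arg_cong[OF eq, of snd], of "\<xi> x"] by (simp add: G_apply flat_w reeb_in_line)
    ultimately have wW: "w \<in> tangent_subspace X M x" using flat_restriction(1)[OF x w] by blast
    \<comment> \<open>Translations by \<open>w\<close> and by its negative, both tangent to
      \<open>X\<close>, give the two inclusions between the cosets.\<close>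
    have "tadd u y = tadd v (tadd w y)" "tadd v y = tadd u (tadd (tscale (-1) w) y)" for y
      by (simp_all add: w_def tadd_def tscale_def)
    moreover have "tadd w y \<in> tangent_subspace X M x" "tadd (tscale (-1) w) y \<in> tangent_subspace X M x"
      if "y \<in> tangent_subspace X M x" for y
      using W(3)[OF wW that] W(3)[OF W(4)[OF wW] that] by auto
    ultimately show "normal_class X M x u = normal_class X M x v"
      unfolding coset by blast
  }
  assume eq: "normal_class X M x u = normal_class X M x v"
  \<comment> \<open>Used to obtain the zero vector inside the tangent subspace, which puts
    \<open>u\<close> in its own class and hence in that of \<open>v\<close>.\<close>
  obtain w0 where "w0 \<in> tangent_subspace X M x" using W(2) by blast
  then have "tscale 0 w0 \<in> tangent_subspace X M x" by (rule W(4))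
  then have "tadd u (tscale 0 w0) \<in> normal_class X M x u" unfolding coset by blast
  moreover have "tadd u (tscale 0 w0) = u" by (simp add: tadd_def tscale_def)
  ultimately obtain y where y: "y \<in> tangent_space X x" "u = tadd v (incl x y)"
    unfolding eq unfolding coset by (auto simp: tangent_subspace_def)
  have yM: "incl x y \<in> tangent_space M x" using incl_in[OF x y(1)] .
  show "G x u = G x v"
    using flat_left(1)[OF x v yM] flat_incl_incl[OF x y(1)] flat_reeb[OF x yM] \<eta>_incl[OF x y(1)]
    by (intro G_eqI[OF x u v]) (simp_all add: y(2))
qed

text \<open>The trivialisation of the line reads off the coefficient of \<xi>. Hence a dual
  trivialisation evaluates a functional at \<xi>, which makes the last component of the fibre map
  equal to \<eta>(v).\<close>

lemma line_frame:
  assumes x: "x \<in> points X" and \<tau>: "(U, \<tau>) \<in> trivs (reeb_line_bundle X M \<xi>)"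
  shows "inv_into (fibre (reeb_line_bundle X M \<xi>) x) (\<tau> x) (unit_seq 0) = \<xi> x"
proof -
  have t: "local_triv X (reeb_line_bundle X M \<xi>) U \<tau>"
    using bundle_line \<tau> by (auto simp: topological_bundle_def)
  have U: "U = points X" and \<tau>_eq: "\<tau> = (\<lambda>x v i. if i = 0 then THE a. v = fscale E x a (\<xi> x) else 0)"
    using \<tau> by (simp_all add: reeb_line_bundle_def line_bundle_def)
  have one: "tscale 1 (\<xi> x) = \<xi> x" by (simp add: tscale_def)
  have "(THE a. \<xi> x = tscale a (\<xi> x)) = 1"
  proof (rule the_equality)
    show "a = 1" if "\<xi> x = tscale a (\<xi> x)" for a
      using injD[OF reeb_scale_inj[OF x], of a 1] one that by simp
  qed (simp add: one)
  then show ?thesis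
    by (intro local_triv_inv_eqI[OF t x[folded U] reeb_in_line]) (auto simp: \<tau>_eq TM_simps)
qed

lemma G_smooth:
  assumes V: "(V, \<sigma>) \<in> trivs E" and U: "(U, \<tau>) \<in> trivs F" and w: "w \<in> Rn (vb_rank E)"
  shows "smooth_function_on X (U \<inter> V) (\<lambda>x. \<tau> x (G x (inv_into (fibre E x) (\<sigma> x) w)) i)"
proof -
  obtain V' \<sigma>' where "(V', \<sigma>') \<in> trivs (tangent_bundle M)" and V': "V = points X \<inter> V'" "\<sigma> = \<sigma>'"
    using V by (auto simp: pullback_bundle_def o_def)
  then obtain c L where c: "c \<in> atlas M" "V' = fst c" and L: "bij_betw L UNIV (Rn (mdim M))"
    and \<sigma>': "\<sigma>' = (\<lambda>x v. L (v c))"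
    by (elim tangent_bundle_trivs)
  obtain U1 \<tau>1 U2 \<tau>2 where U12: "(U1, \<tau>1) \<in> trivs (cotangent_bundle X)"
      "(U2, \<tau>2) \<in> trivs (dual_bundle (reeb_line_bundle X M \<xi>))" "U = U1 \<inter> U2"
    and \<tau>: "\<tau> = (\<lambda>x v i. if i < vb_rank (cotangent_bundle X) then \<tau>1 x (fst v) i
      else \<tau>2 x (snd v) (i - vb_rank (cotangent_bundle X)))"
    using U by (rule whitney_sum_trivs)
  obtain \<rho>1 where "(U1, \<rho>1) \<in> trivs (tangent_bundle X)"
    and \<tau>1: "\<tau>1 = (\<lambda>x \<alpha> i. if i < vb_rank (tangent_bundle X)
      then \<alpha> (inv_into (fibre (tangent_bundle X) x) (\<rho>1 x) (unit_seq i)) else 0)"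
    using U12(1) unfolding cotangent_bundle_def by (rule dual_bundle_trivs)
  then obtain d K where d: "d \<in> atlas X" "U1 = fst d" and K: "bij_betw K UNIV (Rn (mdim X))"
    and \<rho>1: "\<rho>1 = (\<lambda>x v. K (v d))"
    by (elim tangent_bundle_trivs)
  obtain \<rho>2 where \<rho>2: "(U2, \<rho>2) \<in> trivs (reeb_line_bundle X M \<xi>)"
    and \<tau>2: "\<tau>2 = (\<lambda>x \<alpha> i. if i < vb_rank (reeb_line_bundle X M \<xi>)
      then \<alpha> (inv_into (fibre (reeb_line_bundle X M \<xi>) x) (\<rho>2 x) (unit_seq i)) else 0)"
    using U12(2) by (rule dual_bundle_trivs)
  have U2: "U2 = points X" using \<rho>2 by (simp add: reeb_line_bundle_def line_bundle_def)
  have UV: "U \<inter> V = fst d \<inter> (points X \<inter> fst c)"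
    unfolding U12(3) U2 V'(1) c(2) d(2) by blast
  let ?W = "fst d \<inter> (points X \<inter> fst c)"
  have W: "openin (mtop X) ?W"
    using chart_open[OF manifold_X d(1)] smooth_map_id_open[OF incl_smooth chart_open[OF manifold_M c(1)]]
    by (rule openin_Int)
  \<comment> \<open>Model vectors of the coordinate fields to which the frames reduce.
    \<open>b\<close> is relevant for \<open>i < n\<close> only, where the unit sequence lies in
    \<open>Rn n\<close>.\<close>
  define a where "a = inv_into UNIV L w"
  define b where "b = inv_into UNIV K (unit_seq i)"
  \<comment> \<open>Indices below \<open>n\<close> belong to the cotangent part and index
    \<open>n\<close> to the Reeb line; beyond that the sequence is padded by 0.\<close>
  have val: "\<tau> x (G x (inv_into (fibre E x) (\<sigma> x) w)) i =
      (if i < n then flat x (coord_vec M c a x) (incl x (coord_vec X d b x))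
       else if i = n then \<eta> x (coord_vec M c a x) else 0)" if "x \<in> ?W" for x
  proof -
    have x: "x \<in> points X" and c': "c \<in> charts_at M x" and d': "d \<in> charts_at X x"
      using that c(1) d(1) by (auto simp: charts_at_def)
    note C = coord_vec_in_tangent_space[OF manifold_M c']
    have v: "inv_into (fibre E x) (\<sigma> x) w = coord_vec M c a x"
      unfolding TM_simps V'(2) \<sigma>' a_def
      by (rule inv_into_tangent_triv[OF manifold_M c' L]) (use w in \<open>simp only: TM_simps\<close>)
    have u: "inv_into (tangent_space X x) (\<rho>1 x) (unit_seq i) = coord_vec X d b x" if "i < n"
      unfolding \<rho>1 b_def
      by (rule inv_into_tangent_triv[OF manifold_X d' K]) (use that in \<open>simp add: Rn_iff dim_X\<close>)
    have ranks: "vb_rank (cotangent_bundle X) = n" "vb_rank (tangent_bundle X) = n"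
      "vb_rank (reeb_line_bundle X M \<xi>) = 1" "fibre (tangent_bundle X) x = tangent_space X x"
      by (simp_all add: cotangent_bundle_def dual_bundle_def tangent_bundle_def reeb_line_bundle_def line_bundle_def dim_X)
    consider "i < n" | "i = n" | "i > n" by linarith
    then show ?thesis
    proof cases
      case 1
      then show ?thesis
        unfolding v \<tau> \<tau>1 ranks by (simp add: u G_apply coord_vec_in_tangent_space[OF manifold_X d'])
    next
      case 2
      then show ?thesis
        unfolding v \<tau> \<tau>2 ranks by (simp add: line_frame[OF x \<rho>2] G_apply reeb_in_line flat_reeb[OF x C])
    next
      case 3
      then show ?thesis unfolding \<tau> \<tau>2 ranks by simp
    qed
  qed
  have smooth: "smooth_function_on X ?W (\<lambda>x. if i < n then flat x (coord_vec M c a x) (incl x (coord_vec X d b x))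
       else if i = n then \<eta> x (coord_vec M c a x) else 0)"
    using smooth_flat_incl[OF c(1) d(1)] smooth_function_on_const[OF manifold_X W]
      smooth_function_on_subset[OF smooth_\<eta>_coord_vec[OF c(1)], of ?W a]
    by (cases "i < n"; cases "i = n") auto
  show ?thesis
    unfolding UV
    by (rule iffD2[OF smooth_function_on_cong[OF manifold_X W]], erule val, rule smooth)
qed

lemma isomorphism:
  "\<exists>\<Phi>. vb_isomorphism X (normal_bundle X M) F \<Phi> \<and>
     (\<forall>x\<in>points X. \<forall>v\<in>tangent_space M x. \<Phi> x (normal_class X M x v) = G x v)"
proof -
  note W = tangent_subspace_closed
  have "\<exists>\<Phi>. vb_isomorphism X (quotient_bundle X E (mdim X) (tangent_subspace X M)) F \<Phi> \<and>
    (\<forall>x\<in>points X. \<forall>v\<in>fibre E x. \<Phi> x (coset E (tangent_subspace X M) x v) = G x v)"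
  proof (rule quotient_bundle_isomorphism[OF manifold_X bundle_TM bundle_target])
    \<comment> \<open>Both sides are n + 1: the cotangent part and the Reeb line contribute n and 1,
      and on the right (2n + 1) - n remains.\<close>
    show "vb_rank F = vb_rank E - mdim X"
      unfolding target_simps TM_simps dim_M dim_X by simp
    show "smooth_function_on X (U \<inter> V) (\<lambda>x. \<tau> x (G x (inv_into (fibre E x) (\<sigma> x) w)) i)"
      if "(V, \<sigma>) \<in> trivs E" "(U, \<tau>) \<in> trivs F" "w \<in> Rn (vb_rank E)" for V \<sigma> U \<tau> w i
      using that by (rule G_smooth)
    show "G x u = G x v \<longleftrightarrow> coset E (tangent_subspace X M) x u = coset E (tangent_subspace X M) x v"
      if "x \<in> points X" "u \<in> fibre E x" "v \<in> fibre E x" for x u v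
      using G_kernel[of x u v] that by (simp add: normal_class_def TM_simps)
  qed (simp_all add: TM_simps W G_linear G_surj)
  then show ?thesis by (simp only: normal_bundle_def normal_class_def TM_simps)
qed

end

text \<open>The second conjunct expresses canonicity: every element of a fibre of the normal bundle
  is a normal class, so the formula determines \<Phi> on all fibres over \<open>X\<close>, and no
  choice enters.\<close>

theorem proposition3p19:
  fixes n :: nat
    and M :: "('p, 'e::real_normed_vector) manifold"
    and X :: "('p, 'f::real_normed_vector) manifold"
    and \<omega> :: "('p, 'e) form2" and \<eta> :: "('p, 'e) form1"
    and \<xi> :: "'p \<Rightarrow> ('p, 'e) tvec"
  assumes "cosymplectic n M \<omega> \<eta>"
    and "reeb_field M \<omega> \<eta> \<xi>"
    and "lagrangian_like X M \<omega> \<eta>"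
  shows "\<exists>\<Phi>. vb_isomorphism X (normal_bundle X M)
             (whitney_sum (cotangent_bundle X) (dual_bundle (reeb_line_bundle X M \<xi>))) \<Phi> \<and>
           (\<forall>x\<in>points X. \<forall>v\<in>tangent_space M x.
              \<Phi> x (normal_class X M x v) = covector_restriction X M \<xi> x (flat_map M \<omega> \<eta> x v))"
proof -
  interpret lagrangian_like_in_cosymplectic n M X \<omega> \<eta> \<xi>
    using assms by unfold_locales
  show ?thesis using isomorphism unfolding G_def .
qed

end
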